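(* Let $F:\mathbb{R}^N\to(-\infty,+\infty]$ be a proper, closed (lower semicontinuous), semi-algebraic and coercive function. Let $(x^k)_{k\ge 0}\subset\mathbb{R}^N$ be a sequence, let $(\omega^k)_{k\ge 0}$ be a sequence in some Euclidean space, let $(\eta_k)_{k\ge 0}$ be a sequence of nonnegative reals, let $a,b,c,d>0$ be constants and let $\tau\ge 0$ be an integer. Assume: (i) $F(x^{k})-F(x^{k+1})\ge a\|\omega^{k+1}-\omega^k\|^2-b\,\eta_k^2$ for all $k\ge 0$; (ii) $\mathrm{dist}(0,\partial F(x^{k+1}))\le c\sum_{j=k-\tau}^{k}\|\omega^{j+1}-\omega^j\|+d\,\eta_k$ for all $k\ge\tau$; (iii) for every stationary point $\hat x$ of the sequence $(x^k)_{k\ge0}$ and every subsequence $(x^{k_j})_{j\ge 0}$ with $x^{k_j}\to\hat x$, one has $F(x^{k_j})\to F(\hat x)$; (iv) if $\sum_{k}\|\omega^{k}-\omega^{k+1}\|<+\infty$, then $\sum_{k}\|x^{k}-x^{k+1}\|<+\infty$; (v) $\eta_k=\mathcal{O}(1/k^{\alpha})$ for some $\alpha>1$. Then $(x^k)_{k\ge 0}$ has finite length, i.e. $$\sum_{k=0}^{+\infty}\|x^{k+1}-x^k\|<+\infty,$$ and $(x^k)_{k\ge 0}$ converges to a critical point $x^*$ of $F$.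
   Context: A stationary point of a sequence means a cluster point, i.e. the limit of some subsequence. For a proper lower semicontinuous $J:\mathbb{R}^N\to(-\infty,+\infty]$, the Fréchet subdifferential $\hat\partial J(x)$ at $x\in\mathrm{dom}(J)=\{J<+\infty\}$ is the set of $u\in\mathbb{R}^N$ with $\liminf_{y\to x,\,y\ne x}\frac{J(y)-J(x)-\langle u,y-x\rangle}{\|y-x\|}\ge 0$ (and $\hat\partial J(x)=\emptyset$ if $x\notin \mathrm{dom}(J)$). The (limiting) subdifferential is $\partial J(x)=\{u:\exists\, x^k\to x,\ J(x^k)\to J(x),\ u^k\in\hat\partial J(x^k),\ u^k\to u\}$. A critical point of $J$ is a point $x$ with $0\in\partial J(x)$. $\mathrm{dist}(0,S)=\inf_{s\in S}\|s\|$ (equal to $+\infty$ if $S=\emptyset$). A set in $\mathbb{R}^n$ is semi-algebraic if it is a finite union of finite intersections of sets $\{g(u)=0,\ h(u)<0\}$ with $g,h$ real polynomials; a function is semi-algebraic if its graph $\{(u,t)\in\mathbb{R}^{N+1}: J(u)=t\}$ is semi-algebraic. Coercive means $F(x)\to+\infty$ as $\|x\|\to\infty$. *)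

theory Defs
  imports "HOL-Analysis.Analysis" "HOL-Library.Landau_Symbols"
begin

definition proper :: "('a \<Rightarrow> ereal) \<Rightarrow> bool" where
  "proper J \<longleftrightarrow> (\<forall>x. J x \<noteq> -\<infinity>) \<and> (\<exists>x. J x < \<infinity>)"

definition lower_semicontinuous :: "('a::topological_space \<Rightarrow> ereal) \<Rightarrow> bool" where
  "lower_semicontinuous J \<longleftrightarrow> (\<forall>x. J x \<le> Liminf (at x) J)"

definition coercive :: "('a::real_normed_vector \<Rightarrow> ereal) \<Rightarrow> bool" where
  "coercive J \<longleftrightarrow> (J \<longlongrightarrow> \<infinity>) at_infinity"

text \<open>On a Euclidean space, where every linear form is bounded,
  \<^const>\<open>real_polynomial_function\<close> describes exactly the real polynomials in the coordinates.\<close>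

definition semialgebraic :: "'a::euclidean_space set \<Rightarrow> bool" where
  "semialgebraic S \<longleftrightarrow>
     (\<exists>\<U>. finite \<U> \<and> S = \<Union>\<U> \<and>
        (\<forall>C\<in>\<U>. \<exists>P. finite P \<and>
           (\<forall>(g, h)\<in>P. real_polynomial_function g \<and> real_polynomial_function h) \<and>
           C = (\<Inter>(g, h)\<in>P. {u. g u = 0 \<and> h u < 0})))"

text \<open>Points where the function is infinite do not contribute to the graph.\<close>

definition semialgebraic_function :: "('a::euclidean_space \<Rightarrow> ereal) \<Rightarrow> bool" where
  "semialgebraic_function J \<longleftrightarrow> semialgebraic {(u, t :: real). J u = ereal t}"

definition frechet_subdifferential ::
    "('a::euclidean_space \<Rightarrow> ereal) \<Rightarrow> 'a \<Rightarrow> 'a set" where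
  "frechet_subdifferential J x =
     {u. J x < \<infinity> \<and>
         0 \<le> Liminf (at x) (\<lambda>y. (J y - J x - ereal (u \<bullet> (y - x))) / ereal (norm (y - x)))}"

definition limiting_subdifferential ::
    "('a::euclidean_space \<Rightarrow> ereal) \<Rightarrow> 'a \<Rightarrow> 'a set" where
  "limiting_subdifferential J x =
     {u. \<exists>X U. X \<longlonglongrightarrow> x \<and> (\<lambda>k. J (X k)) \<longlonglongrightarrow> J x \<and>
               (\<forall>k::nat. U k \<in> frechet_subdifferential J (X k)) \<and> U \<longlonglongrightarrow> u}"

definition critical_point :: "('a::euclidean_space \<Rightarrow> ereal) \<Rightarrow> 'a \<Rightarrow> bool" where
  "critical_point J x \<longleftrightarrow> 0 \<in> limiting_subdifferential J x"

text \<open>The infimum is taken in the extended reals, so that the distance to the empty set is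
  infinite (whereas \<^const>\<open>infdist\<close> would give zero).\<close>

definition dist0 :: "'a::real_normed_vector set \<Rightarrow> ereal" where
  "dist0 S = (INF s\<in>S. ereal (norm s))"

definition stationary_point :: "(nat \<Rightarrow> 'a::topological_space) \<Rightarrow> 'a \<Rightarrow> bool" where
  "stationary_point x l \<longleftrightarrow> (\<exists>r. strict_mono r \<and> (x \<circ> r) \<longlonglongrightarrow> l)"

end

theory Submission
  imports Defs
begin

text \<open>
  The argument combines a Lojasiewicz inequality for semialgebraic functions with the usual
  telescoping estimate for perturbed descent methods.

  Suppose \<open>F\<close> takes the values \<open>L + t\<close>, for small \<open>t > 0\<close>, at points \<open>X t\<close> of a ball whose subgradients
  have norm at most \<open>C * t\<close>. If \<open>X\<close> can be chosen semialgebraic, then the drop of \<open>F\<close> along \<open>X\<close> forces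
  speed at least \<open>1 / (C * t)\<close>, so \<open>X\<close> has infinite length near \<open>t = 0\<close>. But the coordinates of a bounded
  semialgebraic curve are continuous, locally monotone on one side and have limits, so the length is
  finite (\<open>sa_curve_not_steep\<close>, \<open>eventually_no_flat_point\<close>). Hence the subgradients at level
  \<open>L + t\<close> dominate every multiple of \<open>t\<close>; since the sign of a polynomial in two variables is constant on
  a region \<open>0 < t \<le> k ^ m\<close> near the origin, they then dominate even a power \<open>t powr \<theta>\<close> with
  \<open>\<theta> < 1\<close> (\<open>sa_corner\<close>, \<open>lojasiewicz_inequality\<close>). The same curve argument with the
  values \<open>1 / t\<close> shows that there are no subgradients at points of infinite value. Limiting
  subgradients enter only through the local slope: a Frechet subgradient \<open>u\<close> bounds the rate at which
  \<open>F\<close> can decrease by \<open>norm u\<close>, and this condition is first order over the real field.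

  The selection of the curve needs that semialgebraic predicates are closed under quantifiers, the
  Tarski--Seidenberg theorem (\<open>sa_ex_upd\<close>). It is proved in the style of Hoermander and Cohen, with
  a predicate called semialgebraic when its truth depends only on the signs of finitely many polynomials:
  two parameters with equal signs admit an order-preserving matching of the real roots.

  For the sequence itself, (v) lets \<open>b * (\<eta> k)\<^sup>2\<close> be absorbed into the decrements of a null
  sequence \<open>E k\<close> of order \<open>k powr (1 - 2 * \<alpha>)\<close>, so \<open>F (x k) + E k\<close> decreases to some \<open>L\<close>. The exponent in
  the Lojasiewicz inequality may be raised until \<open>E k powr \<theta>\<close> is summable, and then the concave function
  \<open>s powr (1 - \<theta>)\<close> turns (i) and (ii) into a recursion for the steps of \<open>\<omega>\<close> in which the past steps
  have total weight one half (\<open>summable_steps_of_lojasiewicz\<close>).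
\<close>

section \<open>Order matchings of real roots\<close>

text \<open>\<open>M\<close> lists pairs of corresponding points on two copies of the line; \<open>y\<close> and \<open>y'\<close> correspond when
  they lie in the same position relative to all of them. A relation is used instead of two sorted lists because
  enlarging it keeps every fact \<open>same_signs M f g\<close> true, so roots can be inserted with no bookkeeping.\<close>

definition corr :: "(real \<times> real) set \<Rightarrow> real \<Rightarrow> real \<Rightarrow> bool" where
  "corr M y y' \<longleftrightarrow> (\<forall>(a, b)\<in>M. sgn (y - a) = sgn (y' - b))"

definition order_matching :: "(real \<times> real) set \<Rightarrow> bool" where
  "order_matching M \<longleftrightarrow> finite M \<and> (\<forall>(a, b)\<in>M. corr M a b)"

definition same_signs :: "(real \<times> real) set \<Rightarrow> real poly \<Rightarrow> real poly \<Rightarrow> bool" where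
  "same_signs M f g \<longleftrightarrow> (\<forall>y y'. corr M y y' \<longrightarrow> sgn (poly f y) = sgn (poly g y'))"

lemma sgn_cases3:
  fixes x y :: real
  shows "sgn x = sgn y \<longleftrightarrow> ((x < 0 \<longleftrightarrow> y < 0) \<and> (x > 0 \<longleftrightarrow> y > 0))"
  by (auto simp: sgn_real_def)

lemma corrD: "corr M y y' \<Longrightarrow> (a, b) \<in> M \<Longrightarrow> (y < a \<longleftrightarrow> y' < b) \<and> (a < y \<longleftrightarrow> b < y') \<and> (y = a \<longleftrightarrow> y' = b)"
  unfolding corr_def sgn_cases3 by fastforce

lemma corrI:
  "(\<And>a b. (a, b) \<in> M \<Longrightarrow> (y < a \<longleftrightarrow> y' < b) \<and> (a < y \<longleftrightarrow> b < y')) \<Longrightarrow> corr M y y'"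
  unfolding corr_def sgn_cases3 by fastforce

lemma corr_mono: "corr N y y' \<Longrightarrow> M \<subseteq> N \<Longrightarrow> corr M y y'"
  unfolding corr_def by blast

lemma corr_Un: "corr (M \<union> N) y y' \<longleftrightarrow> corr M y y' \<and> corr N y y'"
  unfolding corr_def by blast

lemma corr_converse: "corr (M\<inverse>) y' y \<longleftrightarrow> corr M y y'"
  unfolding corr_def by (auto simp: eq_commute)

lemma order_matching_converse: "order_matching (M\<inverse>) \<longleftrightarrow> order_matching M"
  proof -
  have "(\<forall>(a, b)\<in>M\<inverse>. corr (M\<inverse>) a b) \<longleftrightarrow> (\<forall>(a, b)\<in>M. corr (M\<inverse>) b a)" by auto
  then show ?thesis unfolding order_matching_def corr_converse by simp
qed

lemma same_signs_converse: "same_signs (M\<inverse>) g f \<longleftrightarrow> same_signs M f g"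
  unfolding same_signs_def corr_converse by metis

lemma same_signs_mono: "same_signs M f g \<Longrightarrow> M \<subseteq> N \<Longrightarrow> same_signs N f g"
  unfolding same_signs_def using corr_mono by blast

lemma order_matching_subset: "order_matching N \<Longrightarrow> M \<subseteq> N \<Longrightarrow> order_matching M"
  unfolding order_matching_def using corr_mono[of N _ _ M] finite_subset[of M N] by blast

lemma finite_separation:
  fixes L U :: "real set"
  assumes "finite L" "finite U" "\<And>l u. l \<in> L \<Longrightarrow> u \<in> U \<Longrightarrow> l < u"
  obtains y where "\<forall>l\<in>L. l < y" "\<forall>u\<in>U. y < u"
proof -
  consider "L = {}" "U = {}" | "L = {}" "U \<noteq> {}" | "L \<noteq> {}" "U = {}" | "L \<noteq> {}" "U \<noteq> {}" by blast
  then show ?thesis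
  proof cases
    case 2
    then have "\<forall>u\<in>U. Min U - 1 < u" using assms by (smt (verit) Min_le)
    with 2 that show ?thesis by blast
  next
    case 3
    then have "\<forall>l\<in>L. l < Max L + 1" using assms by (smt (verit) Max_ge)
    with 3 that show ?thesis by blast
  next
    case 4
    then have "Max L < Min U" using assms by simp
    then obtain y where "Max L < y" "y < Min U" using dense by blast
    then show ?thesis using 4 assms that[of y] by simp
  qed (use that in auto)
qed

text \<open>Only finitely many points constrain the position, and the real order is dense and unbounded.\<close>

lemma corr_ex:
  assumes "order_matching M"
  obtains y' where "corr M y y'"
proof (cases "y \<in> fst ` M")
  case True
  then obtain b where "(y, b) \<in> M" by force
  then show ?thesis using assms that[of b] unfolding order_matching_def by blast
next
  case False
  define L where "L = snd ` {z \<in> M. fst z < y}"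
  define U where "U = snd ` {z \<in> M. y < fst z}"
  have fin: "finite L" "finite U" using assms by (auto simp: L_def U_def order_matching_def)
  have "l < u" if lu: "l \<in> L" "u \<in> U" for l u
  proof -
    obtain a c where "(a, l) \<in> M" "a < y" "(c, u) \<in> M" "y < c"
      using lu unfolding L_def U_def by force
    moreover from this have "corr M a l" using assms unfolding order_matching_def by blast
    ultimately show ?thesis using corrD[of M a l c u] by simp
  qed
  then obtain y' where y': "\<forall>l\<in>L. l < y'" "\<forall>u\<in>U. y' < u" using finite_separation fin by metis
  have "corr M y y'"
  proof (rule corrI)
    fix a b assume ab: "(a, b) \<in> M"
    then have "y \<noteq> a" using False by force
    moreover have "b < y'" if "a < y" using that ab y' unfolding L_def by force
    moreover have "y' < b" if "y < a" using that ab y' unfolding U_def by force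
    ultimately show "(y < a \<longleftrightarrow> y' < b) \<and> (a < y \<longleftrightarrow> b < y')" by fastforce
  qed
  with that show ?thesis .
qed

text \<open>Away from the finitely many matched points, all nearby points have the same partner, so
  the root would be an interior point of the zero set of a nonzero polynomial.\<close>

lemma root_in_domain:
  assumes M: "order_matching M" "same_signs M f g" and "f \<noteq> 0" "poly f y = 0"
  obtains b where "(y, b) \<in> M"
proof (rule ccontr)
  assume no: "\<not> thesis"
  then have ny: "y \<noteq> a" if "(a, b) \<in> M" for a b using that no \<open>\<And>b. (y, b) \<in> M \<Longrightarrow> thesis\<close> by blast
  obtain y' where y': "corr M y y'" using corr_ex M(1) by blast
  have fin: "finite M" using M unfolding order_matching_def by blast
  have "\<forall>\<^sub>F z in at y. \<forall>q\<in>M. sgn (z - fst q) = sgn (y - fst q)"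
  proof (subst eventually_ball_finite_distrib[OF fin], rule ballI)
    fix q assume "q \<in> M"
    then have "y \<noteq> fst q" using ny[of "fst q" "snd q"] by simp
    then consider "y < fst q" | "y > fst q" by linarith
    then show "\<forall>\<^sub>F z in at y. sgn (z - fst q) = sgn (y - fst q)"
    proof cases
      case 1
      then have "\<forall>\<^sub>F z in at y. z < fst q" using order_tendstoD(2)[OF tendsto_ident_at] by blast
      then show ?thesis by eventually_elim (use 1 in simp)
    next
      case 2
      then have "\<forall>\<^sub>F z in at y. z > fst q" using order_tendstoD(1)[OF tendsto_ident_at] by blast
      then show ?thesis by eventually_elim (use 2 in simp)
    qed
  qed
  then have "\<forall>\<^sub>F z in at y. poly f z = 0"
  proof eventually_elim
    case (elim z)
    then have "corr M z y'" using y' unfolding corr_def by fastforce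
    then show ?case using M(2) y' assms(4) unfolding same_signs_def by (metis sgn_zero_iff)
  qed
  moreover have "\<forall>\<^sub>F z in at y. poly f z \<noteq> 0"
    using poly_roots_finite[OF assms(3)] islimpt_finite
    by (fastforce simp: islimpt_iff_eventually)
  ultimately have "\<forall>\<^sub>F z in at y. False" by eventually_elim simp
  then show False by simp
qed

lemma same_sgn_no_root:
  fixes f :: "real poly"
  assumes "\<And>w. y \<le> w \<Longrightarrow> w \<le> z \<Longrightarrow> poly f w \<noteq> 0" "y \<le> z"
  shows "sgn (poly f y) = sgn (poly f z)"
proof (rule ccontr)
  assume ne: "sgn (poly f y) \<noteq> sgn (poly f z)"
  then have "y < z" using assms(2) by (metis order_le_less)
  have "poly f y \<noteq> 0" "poly f z \<noteq> 0" using assms by auto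
  then have "poly f y * poly f z < 0" using ne
    by (auto simp: sgn_real_def mult_less_0_iff split: if_splits)
  then show False using poly_IVT[OF \<open>y < z\<close>] assms(1) by (meson less_imp_le)
qed

lemma no_root_in_gap:
  assumes M: "order_matching M" "same_signs M f g" and "f \<noteq> 0"
    and N: "\<And>a b. (a, b) \<in> M \<Longrightarrow> poly f a = 0 \<Longrightarrow> (a, b) \<in> N"
    and c: "corr N y y'" "corr N z y'" and "y < z" and w: "y \<le> w" "w \<le> z"
  shows "poly f w \<noteq> 0"
proof
  assume 0: "poly f w = 0"
  then obtain b where "(w, b) \<in> M" using root_in_domain M \<open>f \<noteq> 0\<close> by metis
  then have "(w, b) \<in> N" using N 0 by blast
  then show False using corrD[OF c(1), of w b] corrD[OF c(2), of w b] w \<open>y < z\<close> by auto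
qed

text \<open>A matching may be cut down to actual roots: by the intermediate value theorem, a
  point of \<open>M\<close> where \<open>f\<close> does not vanish cannot separate different signs of \<open>f\<close>.\<close>

lemma same_signs_restrict:
  assumes M: "order_matching M" "same_signs M f g" and fg: "f = 0 \<longleftrightarrow> g = 0"
    and N: "\<And>a b. (a, b) \<in> M \<Longrightarrow> f \<noteq> 0 \<Longrightarrow> poly f a = 0 \<Longrightarrow> poly g b = 0 \<Longrightarrow> (a, b) \<in> N"
      "N \<subseteq> M"
  shows "same_signs N f g"
  unfolding same_signs_def
proof (intro allI impI)
  fix y y' assume c: "corr N y y'"
  obtain z' where z': "corr M y z'" using corr_ex M(1) by blast
  have cz: "corr N y z'" using z' N(2) corr_mono by blast
  have s: "sgn (poly f y) = sgn (poly g z')" using M(2) z' unfolding same_signs_def by blast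
  show "sgn (poly f y) = sgn (poly g y')"
  proof (cases "f = 0")
    case True
    then show ?thesis using fg by simp
  next
    case False
    then have g: "g \<noteq> 0" using fg by blast
    have M': "order_matching (M\<inverse>)" "same_signs (M\<inverse>) g f"
      using M by (simp_all add: order_matching_converse same_signs_converse)
    have N': "(a, b) \<in> N\<inverse>" if "(a, b) \<in> M\<inverse>" "poly g a = 0" for a b
    proof -
      have "corr M b a" using that(1) M(1) unfolding order_matching_def by blast
      then have "poly f b = 0" using M(2) that(2) unfolding same_signs_def
        by (metis sgn_zero_iff)
      then show ?thesis using N(1) that False by blast
    qed
    have c': "corr (N\<inverse>) y' y" "corr (N\<inverse>) z' y" using c cz by (simp_all add: corr_converse)
    have "sgn (poly g z') = sgn (poly g y')"
    proof (cases z' y' rule: linorder_cases)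
      case less
      then show ?thesis
        using no_root_in_gap[OF M' g N' c'(2) c'(1) less] same_sgn_no_root[of z' y' g] by simp
    next
      case greater
      then show ?thesis
        using no_root_in_gap[OF M' g N' c'(1) c'(2) greater] same_sgn_no_root[of y' z' g] by simp
    qed simp
    with s show ?thesis by simp
  qed
qed

text \<open>By Rolle's theorem a root of the derivative separates two roots, and that root is matched.\<close>

lemma root_order_transfer:
  assumes M: "order_matching M" "same_signs M (pderiv p) q'" "pderiv p \<noteq> 0"
    and r: "poly p r = 0" "poly p s = 0" "corr M r r'" "corr M s s'" "r < s"
  shows "r' < s'"
proof -
  obtain w where w: "r < w" "w < s" "poly (pderiv p) w = 0"
    using poly_MVT[OF r(5), of p] r by auto
  obtain b where "(w, b) \<in> M" using root_in_domain[OF M w(3)] .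
  then show ?thesis using corrD[OF r(3), of w b] corrD[OF r(4), of w b] w by linarith
qed

lemma end_signs:
  fixes p :: "real poly"
  assumes "p \<noteq> 0"
  shows "\<exists>B>0. (\<forall>y\<ge>B. sgn (poly p y) = sgn (lead_coeff p)) \<and>
    (\<forall>y\<le>-B. sgn (poly p y) = sgn (lead_coeff p) * (-1) ^ degree p)"
proof -
  have *: "\<exists>B. \<forall>y\<ge>B. sgn (poly p y) = sgn (lead_coeff p)" if "p \<noteq> 0" for p :: "real poly"
  proof -
    have "lead_coeff p \<noteq> 0" using that by simp
    then consider "lead_coeff p > 0" | "lead_coeff (- p) > 0" by (fastforce simp: lead_coeff_minus)
    then show ?thesis
    proof cases
      case 1
      then obtain n where "\<forall>x\<ge>n. poly p x \<ge> lead_coeff p" using poly_pinfty_gt_lc by blast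
      then have "\<forall>x\<ge>n. poly p x > 0" using 1 by (meson less_le_trans)
      then show ?thesis using 1 by (intro exI[of _ n]) simp
    next
      case 2
      then obtain n where "\<forall>x\<ge>n. poly (- p) x \<ge> lead_coeff (- p)" using poly_pinfty_gt_lc by blast
      then have "\<forall>x\<ge>n. poly p x < 0" using 2 by fastforce
      then show ?thesis using 2 by (intro exI[of _ n]) simp
    qed
  qed
  obtain B1 where B1: "\<forall>y\<ge>B1. sgn (poly p y) = sgn (lead_coeff p)" using * assms by blast
  define q where "q = pcompose p [:0, -1:]"
  have lq: "lead_coeff q = lead_coeff p * (-1) ^ degree p"
    unfolding q_def by (subst lead_coeff_comp) auto
  then have "q \<noteq> 0" using assms by auto
  then obtain B2 where B2: "\<forall>y\<ge>B2. sgn (poly q y) = sgn (lead_coeff q)" using * by blast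
  have s1: "sgn ((-1::real) ^ n) = (-1) ^ n" for n by (induction n) (auto simp: sgn_mult)
  show ?thesis
  proof (intro exI[of _ "max 1 (max B1 B2)"] conjI allI impI)
    fix y assume "y \<le> - max 1 (max B1 B2)"
    then have "- y \<ge> B2" by linarith
    then have "sgn (poly q (- y)) = sgn (lead_coeff q)" using B2 by blast
    then show "sgn (poly p y) = sgn (lead_coeff p) * (-1) ^ degree p"
      unfolding lq by (simp add: q_def poly_pcompose sgn_mult s1)
  qed (use B1 in auto)
qed

lemma value_between_endpoints:
  fixes p :: "real poly"
  assumes "\<And>w. a < w \<Longrightarrow> w < c \<Longrightarrow> poly (pderiv p) w \<noteq> 0" "a < z" "z < c"
  shows "(poly p a < poly p z \<and> poly p z < poly p c) \<or> (poly p c < poly p z \<and> poly p z < poly p a)"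
proof -
  obtain u where u: "a < u" "u < z" "poly p z - poly p a = (z - a) * poly (pderiv p) u"
    using poly_MVT assms by blast
  obtain v where v: "z < v" "v < c" "poly p c - poly p z = (c - z) * poly (pderiv p) v"
    using poly_MVT assms by blast
  have "sgn (poly (pderiv p) u) = sgn (poly (pderiv p) v)"
    using assms u v by (intro same_sgn_no_root) auto
  moreover have "poly (pderiv p) u \<noteq> 0" using assms u v by auto
  ultimately consider "poly (pderiv p) u > 0" "poly (pderiv p) v > 0"
    | "poly (pderiv p) u < 0" "poly (pderiv p) v < 0"
    by (auto simp: sgn_real_def split: if_splits)
  then show ?thesis
  proof cases
    case 1
    then have "poly p z - poly p a > 0" "poly p c - poly p z > 0" unfolding u v using assms by auto
    then show ?thesis by simp
  next
    case 2
    then have "poly p z - poly p a < 0" "poly p c - poly p z < 0" unfolding u v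
      using assms by (auto simp: mult_pos_neg)
    then show ?thesis by simp
  qed
qed

text \<open>The induction step of the Hoermander--Cohen method. Between neighbouring roots of the
  polynomials in \<open>L\<close> the derivative of \<open>p\<close> has no zero, so \<open>p\<close> is monotone there and its signs at
  the two ends decide whether it has a root. These end signs agree for \<open>p\<close> and \<open>q\<close>: at roots by hypothesis
  (later supplied by remainders modulo the members of \<open>L\<close>), at infinity because the leading terms agree.\<close>

lemma insert_roots:
  assumes M: "order_matching M" and L: "\<And>f g. (f, g) \<in> L \<Longrightarrow> same_signs M f g"
    and L0: "\<And>f g. (f, g) \<in> L \<Longrightarrow> f = 0 \<longleftrightarrow> g = 0"
    and p: "sgn (lead_coeff p) = sgn (lead_coeff q)" "degree p = degree q"
    and dp: "(pderiv p, pderiv q) \<in> L"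
    and pM: "\<And>f g a b. (f, g) \<in> L \<Longrightarrow> f \<noteq> 0 \<Longrightarrow> (a, b) \<in> M \<Longrightarrow> poly f a = 0 \<Longrightarrow> poly g b = 0
      \<Longrightarrow> sgn (poly p a) = sgn (poly q b)"
  obtains N where "order_matching N" "\<And>f g. (f, g) \<in> insert (p, q) L \<Longrightarrow> same_signs N f g"
proof (cases "pderiv p = 0")
  case True
  then have "pderiv q = 0" using L0 dp by blast
  then obtain c d where "p = [:c:]" "q = [:d:]" using True by (metis pderiv_iszero)
  then have "same_signs M p q" using p by (simp add: same_signs_def)
  then show ?thesis using that[of M] M L by blast
next
  case False
  then have dq: "pderiv q \<noteq> 0" using L0 dp by blast
  then have "p \<noteq> 0" "q \<noteq> 0" using False by auto
  \<comment> \<open>At a point of \<open>M\<close> that is a root only of remainders the sign of \<open>p\<close> is not controlled, so it is dropped.\<close>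
  define M0 where "M0 = {(a, b) \<in> M. \<exists>(f, g)\<in>L. f \<noteq> 0 \<and> g \<noteq> 0 \<and> poly f a = 0 \<and> poly g b = 0}"
  have M0M: "M0 \<subseteq> M" unfolding M0_def by blast
  then have M0: "order_matching M0" using M order_matching_subset by blast
  have finM0: "finite M0" using M0 unfolding order_matching_def by blast
  have M0L: "same_signs M0 f g" if "(f, g) \<in> L" for f g
  proof (rule same_signs_restrict[OF M L[OF that] L0[OF that] _ M0M])
    fix a b assume "(a, b) \<in> M" "f \<noteq> 0" "poly f a = 0" "poly g b = 0"
    moreover have "g \<noteq> 0" using L0[OF that] \<open>f \<noteq> 0\<close> by simp
    ultimately show "(a, b) \<in> M0" using that unfolding M0_def by blast
  qed
  have M0p: "sgn (poly p a) = sgn (poly q b)" if "(a, b) \<in> M0" for a b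
    using that pM unfolding M0_def by blast
  obtain Bp where Bp: "Bp > 0" "\<forall>y\<ge>Bp. sgn (poly p y) = sgn (lead_coeff p)"
    "\<forall>y\<le>-Bp. sgn (poly p y) = sgn (lead_coeff p) * (-1) ^ degree p"
    using end_signs[OF \<open>p \<noteq> 0\<close>] by blast
  obtain Bq where Bq: "Bq > 0" "\<forall>y\<ge>Bq. sgn (poly q y) = sgn (lead_coeff q)"
    "\<forall>y\<le>-Bq. sgn (poly q y) = sgn (lead_coeff q) * (-1) ^ degree q"
    using end_signs[OF \<open>q \<noteq> 0\<close>] by blast
  \<comment> \<open>Artificial end points beyond all roots, so that every point between them has a neighbour on either side.\<close>
  define B where "B = Max (insert Bp ((\<lambda>z. \<bar>fst z\<bar> + 1) ` M0))"
  define C where "C = Max (insert Bq ((\<lambda>z. \<bar>snd z\<bar> + 1) ` M0))"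
  have BC: "B \<ge> Bp" "C \<ge> Bq" unfolding B_def C_def using finM0 by auto
  have BC0: "B > 0" "C > 0" using BC Bp(1) Bq(1) by auto
  have BM: "\<bar>a\<bar> < B" "\<bar>b\<bar> < C" if "(a, b) \<in> M0" for a b
  proof -
    have "\<bar>a\<bar> + 1 \<le> B" unfolding B_def using finM0 that by (intro Max_ge) force+
    moreover have "\<bar>b\<bar> + 1 \<le> C" unfolding C_def using finM0 that by (intro Max_ge) force+
    ultimately show "\<bar>a\<bar> < B" "\<bar>b\<bar> < C" by auto
  qed
  define M1 where "M1 = insert (-B, -C) (insert (B, C) M0)"
  have "corr M1 a b" if "(a, b) \<in> M1" for a b
  proof (rule corrI)
    fix c d assume cd: "(c, d) \<in> M1"
    have "corr M0 c d" "corr M0 a b" if "(c, d) \<in> M0" "(a, b) \<in> M0"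
      using that M0 unfolding order_matching_def by auto
    then show "(a < c \<longleftrightarrow> b < d) \<and> (c < a \<longleftrightarrow> d < b)"
      using that cd BM[of a b] BM[of c d] corrD[of M0 a b c d] BC0 unfolding M1_def by auto
  qed
  then have M1: "order_matching M1" using finM0 unfolding order_matching_def M1_def by auto
  have M1L: "same_signs M1 f g" if "(f, g) \<in> L" for f g
    using M0L[OF that] by (rule same_signs_mono) (auto simp: M1_def)
  have M1p: "sgn (poly p a) = sgn (poly q b)" if "(a, b) \<in> M1" for a b
    using that M0p[of a b] Bp(2,3) Bq(2,3) p BC unfolding M1_def by auto
  have dpM: "same_signs M1 (pderiv p) (pderiv q)" using M1L dp by blast
  have dqM: "same_signs (M1\<inverse>) (pderiv q) (pderiv p)" using dpM by (simp add: same_signs_converse)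
  have M1': "order_matching (M1\<inverse>)" using M1 by (simp add: order_matching_converse)
  define R where "R = {(r, r'). poly p r = 0 \<and> poly q r' = 0 \<and> corr M1 r r'}"
  define N where "N = M1 \<union> R"
  have "finite ({r. poly p r = 0} \<times> {r. poly q r = 0})"
    using poly_roots_finite \<open>p \<noteq> 0\<close> \<open>q \<noteq> 0\<close> by blast
  then have finN: "finite N" using M1 unfolding N_def order_matching_def R_def
    by (auto elim: finite_subset[rotated])
  have RR: "r < s \<longleftrightarrow> r' < s'" if "(r, r') \<in> R" "(s, s') \<in> R" for r s r' s'
    using that root_order_transfer[OF M1 dpM False, of r s r' s']
      root_order_transfer[OF M1' dqM dq, of r' s' r s] unfolding R_def corr_converse by blast
  have N: "order_matching N"
    unfolding order_matching_def
  proof (intro conjI finN ballI, clarify)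
    fix a b assume ab: "(a, b) \<in> N"
    show "corr N a b"
    proof (rule corrI)
      fix c d assume cd: "(c, d) \<in> N"
      have "corr M1 a b" "corr M1 c d" using ab cd M1 unfolding N_def R_def order_matching_def by auto
      then show "(a < c \<longleftrightarrow> b < d) \<and> (c < a \<longleftrightarrow> d < b)"
        using ab cd corrD[of M1 a b c d] corrD[of M1 c d a b] RR[of a b c d] RR[of c d a b]
        unfolding N_def by blast
    qed
  qed
  \<comment> \<open>Every unmatched point between the artificial ends lies between two neighbouring matched points.\<close>
  have gap: thesis if y: "corr M1 y y'" "\<nexists>b. (y, b) \<in> M1" "- B < y" "y < B"
    and k: "\<And>a b c d. (a, b) \<in> M1 \<Longrightarrow> (c, d) \<in> M1 \<Longrightarrow> a < y \<Longrightarrow> y < c \<Longrightarrow> b < y' \<Longrightarrow> y' < d \<Longrightarrow>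
      (\<And>z z'. a < z \<Longrightarrow> z < c \<Longrightarrow> b < z' \<Longrightarrow> z' < d \<Longrightarrow> corr M1 z z') \<Longrightarrow> thesis"
    for y y' thesis
  proof -
    define A where "A = {a \<in> fst ` M1. a < y}"
    define D where "D = {a \<in> fst ` M1. y < a}"
    have fin: "finite A" "finite D" using M1 unfolding A_def D_def order_matching_def by auto
    have ne: "- B \<in> A" "B \<in> D" using y unfolding A_def D_def M1_def by force+
    have "Max A \<in> A" "Min D \<in> D" using fin ne Max_in Min_in by blast+
    then obtain b d where bd: "(Max A, b) \<in> M1" "(Min D, d) \<in> M1" "Max A < y" "y < Min D"
      unfolding A_def D_def by auto
    show ?thesis
    proof (rule k[OF bd])
      show "b < y'" "y' < d" using corrD[OF y(1) bd(1)] corrD[OF y(1) bd(2)] bd by auto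
      fix z z' assume z: "Max A < z" "z < Min D" "b < z'" "z' < d"
      show "corr M1 z z'"
      proof (rule corrI)
        fix u v assume uv: "(u, v) \<in> M1"
        then have cuv: "corr M1 u v" using M1 unfolding order_matching_def by blast
        have "u \<noteq> y" using y(2) uv by blast
        then have "u \<in> A \<or> u \<in> D" using uv unfolding A_def D_def by force
        then have "u \<le> Max A \<or> Min D \<le> u" using fin by auto
        then show "(z < u \<longleftrightarrow> z' < v) \<and> (u < z \<longleftrightarrow> v < z')"
          using z corrD[OF cuv bd(1)] corrD[OF cuv bd(2)] bd by linarith
      qed
    qed
  qed
  have "same_signs N p q"
    unfolding same_signs_def
  proof (intro allI impI)
    fix y y' assume yN: "corr N y y'"
    then have y: "corr M1 y y'" unfolding N_def corr_Un by blast
    have yR: "(y < r \<longleftrightarrow> y' < r') \<and> (r < y \<longleftrightarrow> r' < y') \<and> (y = r \<longleftrightarrow> y' = r')" if "(r, r') \<in> R" for r r'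
      using corrD[OF yN, of r r'] that unfolding N_def by blast
    have ends: "y < - B \<longleftrightarrow> y' < - C" "B < y \<longleftrightarrow> C < y'"
      using corrD[OF y, of "- B" "- C"] corrD[OF y, of B C] unfolding M1_def by auto
    consider "\<exists>b. (y, b) \<in> M1" | "y < - B" | "B < y" | "- B < y" "y < B" "\<nexists>b. (y, b) \<in> M1"
      unfolding M1_def by (metis insertCI linorder_less_linear)
    then show "sgn (poly p y) = sgn (poly q y')"
    proof cases
      case 1
      then obtain b where b: "(y, b) \<in> M1" by blast
      then have "y' = b" using corrD[OF y b] by simp
      then show ?thesis using M1p b by blast
    next
      case 2
      then show ?thesis using ends Bp(3) Bq(3) p BC by simp
    next
      case 3
      then show ?thesis using ends Bp(2) Bq(2) p BC by simp
    next
      case 4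
      show ?thesis
      proof (rule gap[OF y 4(3,1,2)])
        fix a b c d
        assume ab: "(a, b) \<in> M1" and cd: "(c, d) \<in> M1" and ac: "a < y" "y < c" and bd: "b < y'" "y' < d"
          and z: "\<And>z z'. a < z \<Longrightarrow> z < c \<Longrightarrow> b < z' \<Longrightarrow> z' < d \<Longrightarrow> corr M1 z z'"
        have nr: "poly (pderiv p) w \<noteq> 0" if "a < w" "w < c" for w
        proof
          assume 0: "poly (pderiv p) w = 0"
          then obtain v where v: "(w, v) \<in> M1" using root_in_domain[OF M1 dpM False] by blast
          have "b < d" using bd by simp
          then obtain u1 u2 where "b < u1" "u1 < u2" "u2 < d" using dense by meson
          then have "corr M1 w u1" "corr M1 w u2" "u1 \<noteq> u2" using z that by auto
          then show False using corrD[of M1 w _ w v] v by blast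
        qed
        have nr': "poly (pderiv q) w \<noteq> 0" if "b < w" "w < d" for w
        proof
          assume 0: "poly (pderiv q) w = 0"
          then obtain v where "(w, v) \<in> M1\<inverse>" using root_in_domain[OF M1' dqM dq] by blast
          then have v: "(v, w) \<in> M1" by simp
          have "a < c" using ac by simp
          then obtain u1 u2 where "a < u1" "u1 < u2" "u2 < c" using dense by meson
          then have "corr M1 u1 w" "corr M1 u2 w" "u1 \<noteq> u2" using z that by auto
          then show False using corrD[of M1 _ w v w] v by blast
        qed
        have bp: "(poly p a < poly p y \<and> poly p y < poly p c) \<or> (poly p c < poly p y \<and> poly p y < poly p a)"
          using value_between_endpoints nr ac by blast
        have bq: "(poly q b < poly q y' \<and> poly q y' < poly q d) \<or> (poly q d < poly q y' \<and> poly q y' < poly q b)"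
          using value_between_endpoints nr' bd by blast
        have sa: "(poly p a < 0 \<longleftrightarrow> poly q b < 0) \<and> (poly p a > 0 \<longleftrightarrow> poly q b > 0)"
          and sc: "(poly p c < 0 \<longleftrightarrow> poly q d < 0) \<and> (poly p c > 0 \<longleftrightarrow> poly q d > 0)"
          using M1p[OF ab] M1p[OF cd] unfolding sgn_cases3 by auto
        have R: "(r, r') \<in> R" if "a < r" "r < c" "b < r'" "r' < d" "poly p r = 0" "poly q r' = 0" for r r'
          using that z unfolding R_def by blast
        have rootp: "\<exists>r. u < r \<and> r < v \<and> poly p r = 0" if "u < v" "poly p u * poly p v < 0" for u v
          using poly_IVT that by blast
        have rootq: "\<exists>r. u < r \<and> r < v \<and> poly q r = 0" if "u < v" "poly q u * poly q v < 0" for u v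
          using poly_IVT that by blast
        show ?thesis
        proof (cases "poly p a * poly p c < 0")
          case False
          then show ?thesis using bp bq sa sc unfolding sgn_cases3 mult_less_0_iff by linarith
        next
          case True
          then have T': "poly q b * poly q d < 0" using sa sc by (auto simp: mult_less_0_iff)
          obtain r where r: "a < r" "r < c" "poly p r = 0" using rootp[of a c] True ac by auto
          obtain r' where r': "b < r'" "r' < d" "poly q r' = 0" using rootq[of b d] T' bd by auto
          have rr: "(y < r \<longleftrightarrow> y' < r') \<and> (r < y \<longleftrightarrow> r' < y') \<and> (y = r \<longleftrightarrow> y' = r')"
            using yR R r r' by blast
          have vp: "poly p a < poly p r \<and> poly p r < poly p c \<or> poly p c < poly p r \<and> poly p r < poly p a"
            using value_between_endpoints nr r by blast
          have lp: "sgn (poly p y) = sgn (poly p a)" if "y < r"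
            using value_between_endpoints[of a r p y] nr that ac r sa vp by (auto simp: sgn_cases3)
          have rp: "sgn (poly p y) = sgn (poly p c)" if "r < y"
            using value_between_endpoints[of r c p y] nr that ac r sa vp by (auto simp: sgn_cases3)
          have vq: "poly q b < poly q r' \<and> poly q r' < poly q d \<or> poly q d < poly q r' \<and> poly q r' < poly q b"
            using value_between_endpoints nr' r' by blast
          have lq: "sgn (poly q y') = sgn (poly q b)" if "y' < r'"
            using value_between_endpoints[of b r' q y'] nr' that bd r' sa vq by (auto simp: sgn_cases3)
          have rq: "sgn (poly q y') = sgn (poly q d)" if "r' < y'"
            using value_between_endpoints[of r' d q y'] nr' that bd r' sa vq by (auto simp: sgn_cases3)
          show ?thesis
            using lp rp lq rq M1p[OF ab] M1p[OF cd] rr r(3) r'(3)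
            by (cases y r rule: linorder_cases) auto
        qed
      qed
    qed
  qed
  moreover have "same_signs N f g" if "(f, g) \<in> L" for f g
    using M1L[OF that] by (rule same_signs_mono) (auto simp: N_def)
  ultimately show ?thesis using that[OF N] by blast
qed

section \<open>Elimination of one quantifier\<close>

text \<open>An assignment \<open>e\<close> gives values to variables indexed by natural numbers, so that a single type serves
  formulas with any number of free variables.\<close>

inductive polyfun :: "((nat \<Rightarrow> real) \<Rightarrow> real) \<Rightarrow> bool" where
  const: "polyfun (\<lambda>e. c)"
| var: "polyfun (\<lambda>e. e i)"
| add: "polyfun f \<Longrightarrow> polyfun g \<Longrightarrow> polyfun (\<lambda>e. f e + g e)"
| mult: "polyfun f \<Longrightarrow> polyfun g \<Longrightarrow> polyfun (\<lambda>e. f e * g e)"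

lemma polyfun_sum: "(\<And>i. i \<in> I \<Longrightarrow> polyfun (f i)) \<Longrightarrow> polyfun (\<lambda>e. \<Sum>i\<in>I. f i e)"
  by (induction I rule: infinite_finite_induct) (auto intro: polyfun.intros)

lemma polyfun_minus: "polyfun f \<Longrightarrow> polyfun (\<lambda>e. - f e)"
  using mult[OF const[of "-1"]] by simp

lemma polyfun_diff: "polyfun f \<Longrightarrow> polyfun g \<Longrightarrow> polyfun (\<lambda>e. f e - g e)"
  using add[OF _ polyfun_minus] by simp

lemma polyfun_power: "polyfun f \<Longrightarrow> polyfun (\<lambda>e. f e ^ n)"
  by (induction n) (auto intro: polyfun.intros)

lemma polyfun_subst:
  assumes "polyfun p" "\<And>j. polyfun (\<lambda>e. \<sigma> e j)"
  shows "polyfun (\<lambda>e. p (\<sigma> e))"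
  using assms(1) by induction (auto intro: polyfun.intros assms(2))

text \<open>A polynomial in one distinguished variable whose coefficients are polynomials in the
  others. The actual degree depends on the parameters; \<open>d\<close> is a uniform bound.\<close>

definition param_poly :: "nat \<Rightarrow> ((nat \<Rightarrow> real) \<Rightarrow> real poly) \<Rightarrow> bool" where
  "param_poly d P \<longleftrightarrow> (\<forall>j. polyfun (\<lambda>e. coeff (P e) j)) \<and> (\<forall>e. degree (P e) \<le> d)"

lemma polyfun_as_param_poly:
  assumes "polyfun p"
  shows "\<exists>P d. param_poly d P \<and> (\<forall>e y. p (e(i := y)) = poly (P e) y)"
  using assms
proof induction
  case (const c)
  have "polyfun (\<lambda>e. coeff [:c:] j)" for j by (rule polyfun.const)
  then show ?case by (intro exI[of _ "\<lambda>e. [:c:]"] exI[of _ 0]) (simp add: param_poly_def)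
next
  case (var k)
  show ?case
  proof (cases "k = i")
    case True
    have "polyfun (\<lambda>e. coeff [:0, 1:] j)" for j by (rule polyfun.const)
    with True show ?thesis
      by (intro exI[of _ "\<lambda>e. [:0, 1:]"] exI[of _ 1]) (simp add: param_poly_def)
  next
    case False
    have "polyfun (\<lambda>e. coeff [:e k:] j)" for j
      by (cases j) (auto intro: polyfun.intros)
    with False show ?thesis
      by (intro exI[of _ "\<lambda>e. [:e k:]"] exI[of _ 0]) (simp add: param_poly_def)
  qed
next
  case (add f g)
  then obtain P d Q c where *: "param_poly d P" "\<forall>e y. f (e(i := y)) = poly (P e) y"
    "param_poly c Q" "\<forall>e y. g (e(i := y)) = poly (Q e) y" by blast
  have "degree (P e + Q e) \<le> max d c" for e
    using *(1,3) unfolding param_poly_def by (intro degree_add_le) (auto simp: le_max_iff_disj)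
  then have "param_poly (max d c) (\<lambda>e. P e + Q e)"
    using * unfolding param_poly_def by (auto intro: polyfun.add)
  moreover have "\<forall>e y. f (e(i := y)) + g (e(i := y)) = poly (P e + Q e) y"
    using *(2,4) by (simp only: poly_add) blast
  ultimately show ?case by (intro exI[of _ "\<lambda>e. P e + Q e"] exI[of _ "max d c"] conjI)
next
  case (mult f g)
  then obtain P d Q c where *: "param_poly d P" "\<forall>e y. f (e(i := y)) = poly (P e) y"
    "param_poly c Q" "\<forall>e y. g (e(i := y)) = poly (Q e) y" by blast
  have "degree (P e * Q e) \<le> d + c" for e
    using *(1,3) degree_mult_le[of "P e" "Q e"] unfolding param_poly_def by (meson add_mono le_trans)
  then have "param_poly (d + c) (\<lambda>e. P e * Q e)"
    using * unfolding param_poly_def coeff_mult by (auto intro!: polyfun_sum polyfun.mult)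
  moreover have "\<forall>e y. f (e(i := y)) * g (e(i := y)) = poly (P e * Q e) y"
    using *(2,4) by (simp only: poly_mult) blast
  ultimately show ?case by (intro exI[of _ "\<lambda>e. P e * Q e"] exI[of _ "d + c"] conjI)
qed

text \<open>Division by \<open>f e\<close> with denominators cleared. The degree of \<open>f e\<close> jumps with \<open>e\<close>, hence one
  remainder for each possible degree \<open>j\<close>; truncating each intermediate result forces its formal degree down, which
  changes nothing at the parameters where \<open>f e\<close> really has degree \<open>j\<close>.\<close>

lemma pseudo_remainder:
  assumes "param_poly D P" "\<And>i. polyfun (\<lambda>e. coeff (f e) i)"
  shows "\<exists>R n. param_poly (j - 1) R \<and>
    (\<forall>e a. degree (f e) = j \<longrightarrow> poly (f e) a = 0 \<longrightarrow> f e \<noteq> 0 \<longrightarrow>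
       coeff (f e) j ^ n * poly (P e) a = poly (R e) a)"
  using assms(1)
proof (induction D arbitrary: P rule: less_induct)
  case (less D)
  consider "j = 0" | "D \<le> j - 1" | "j \<noteq> 0" "j \<le> D" by linarith
  then show ?case
  proof cases
    case 1
    have "param_poly 0 (\<lambda>e. 0)" by (simp add: param_poly_def polyfun.const)
    moreover have False if "degree (f e) = 0" "poly (f e) a = 0" "f e \<noteq> 0" for e a
      using that by (auto elim!: degree_eq_zeroE)
    ultimately show ?thesis using 1 by (intro exI[of _ "\<lambda>e. 0"]) auto
  next
    case 2
    then have "param_poly (j - 1) P" using less.prems unfolding param_poly_def by (meson le_trans)
    then show ?thesis by (intro exI[of _ P] exI[of _ 0]) simp
  next
    case 3
    then obtain D' where D: "D = Suc D'" by (cases D) auto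
    define S where "S e = smult (coeff (f e) j) (P e) - monom (coeff (P e) D) (D - j) * f e" for e
    define P' where "P' e = poly_cutoff D (S e)" for e
    have "coeff (P' e) k = (if k < D then coeff (f e) j * coeff (P e) k -
        (if k < D - j then 0 else coeff (P e) D * coeff (f e) (k - (D - j))) else 0)" for e k
      unfolding P'_def S_def coeff_poly_cutoff by (simp add: coeff_monom_mult)
    moreover have "polyfun (\<lambda>e. if k < D then coeff (f e) j * coeff (P e) k -
        (if k < D - j then 0 else coeff (P e) D * coeff (f e) (k - (D - j))) else 0)" for k
      using less.prems assms(2) unfolding param_poly_def
      by (cases "k < D"; cases "k < D - j") (auto intro!: polyfun.intros polyfun_diff polyfun_minus)
    moreover have "degree (P' e) \<le> D'" for e
      unfolding P'_def D by (intro degree_le) (simp add: coeff_poly_cutoff)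
    ultimately have "param_poly D' P'" unfolding param_poly_def by simp
    from less.IH[OF _ this] D obtain R n where R: "param_poly (j - 1) R"
      "\<forall>e a. degree (f e) = j \<longrightarrow> poly (f e) a = 0 \<longrightarrow> f e \<noteq> 0 \<longrightarrow>
       coeff (f e) j ^ n * poly (P' e) a = poly (R e) a" by blast
    have P': "poly (P' e) a = coeff (f e) j * poly (P e) a"
      if *: "degree (f e) = j" "poly (f e) a = 0" for e a
    proof -
      have "coeff (S e) k = 0" if "k \<ge> D" for k
      proof (cases "k = D")
        case True
        then show ?thesis using 3 by (simp add: S_def coeff_monom_mult)
      next
        case False
        moreover have "degree (P e) \<le> D" using less.prems unfolding param_poly_def by blast
        ultimately have "coeff (P e) k = 0" "coeff (f e) (k - (D - j)) = 0"
          using that * 3 by (auto intro!: coeff_eq_0)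
        then show ?thesis by (simp add: S_def coeff_monom_mult)
      qed
      then have "P' e = S e" unfolding P'_def by (intro poly_eqI) (simp add: coeff_poly_cutoff)
      then show ?thesis using * by (simp add: S_def)
    qed
    have "coeff (f e) j ^ Suc n * poly (P e) a = poly (R e) a"
      if *: "degree (f e) = j" "poly (f e) a = 0" "f e \<noteq> 0" for e a
      using R(2)[rule_format, OF *] unfolding P'[OF *(1,2)] by (simp add: mult.assoc mult.left_commute)
    then show ?thesis using R(1) by blast
  qed
qed

lemma param_poly_pderiv: "param_poly (Suc d) P \<Longrightarrow> param_poly d (\<lambda>e. pderiv (P e))"
  unfolding param_poly_def by (auto intro!: polyfun.intros simp: coeff_pderiv degree_pderiv le_diff_conv)

lemma param_poly_le: "param_poly c P \<Longrightarrow> c \<le> d \<Longrightarrow> param_poly d P"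
  unfolding param_poly_def by (meson le_trans)

text \<open>The real root pattern of the family \<open>K\<close> is determined by the signs of finitely many
  polynomials in the parameters.\<close>

definition sign_controlled :: "((nat \<Rightarrow> real) \<Rightarrow> real poly) set \<Rightarrow> bool" where
  "sign_controlled K \<longleftrightarrow> (\<exists>Q. finite Q \<and> (\<forall>q\<in>Q. polyfun q) \<and>
     (\<forall>e e'. (\<forall>q\<in>Q. sgn (q e) = sgn (q e')) \<longrightarrow>
        (\<exists>M. order_matching M \<and> (\<forall>P\<in>K. same_signs M (P e) (P e')))))"

lemma same_sgn_coeffs:
  assumes "\<And>i. i \<le> d \<Longrightarrow> sgn (coeff p i) = sgn (coeff q i)" "degree p \<le> d" "degree q \<le> d"
  shows "degree p = degree q" "sgn (lead_coeff p) = sgn (lead_coeff q)" "p = 0 \<longleftrightarrow> q = (0 :: real poly)"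
proof -
  have *: "sgn (coeff p i) = sgn (coeff q i)" for i
    using assms by (cases "i \<le> d") (auto simp: coeff_eq_0)
  have **: "coeff p i = 0 \<longleftrightarrow> coeff q i = 0" for i using *[of i] by (auto simp: sgn_real_def split: if_splits)
  have "degree p \<le> degree q" using ** coeff_eq_0[of q] by (intro degree_le) simp
  moreover have "degree q \<le> degree p" using **[symmetric] coeff_eq_0[of p] by (intro degree_le) simp
  ultimately show "degree p = degree q" by simp
  then show "sgn (lead_coeff p) = sgn (lead_coeff q)" using * by simp
  show "p = 0 \<longleftrightarrow> q = 0" using ** by (auto simp: poly_eq_iff)
qed

text \<open>The sign of \<open>P\<close> at a root of \<open>f\<close> is the sign of the pseudo-remainder of \<open>P\<close> by \<open>f\<close>, up to a
  power of the leading coefficient of \<open>f\<close>. So \<open>P\<close> is traded for its derivative and for such remainders, all of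
  smaller formal degree.\<close>

lemma sign_controlled_insert:
  assumes K: "finite K" "\<And>f. f \<in> K \<Longrightarrow> param_poly (Suc d) f" and P: "param_poly (Suc d) P"
    and L: "\<And>L. finite L \<Longrightarrow> (\<And>f. f \<in> L \<Longrightarrow> param_poly d f) \<Longrightarrow> sign_controlled (L \<union> K)"
  shows "sign_controlled (insert P K)"
proof -
  define dP where "dP = (\<lambda>e. pderiv (P e))"
  define K1 where "K1 = insert dP K"
  have dP: "param_poly d dP" using param_poly_pderiv[OF P] unfolding dP_def .
  have K1: "finite K1" "\<And>f. f \<in> K1 \<Longrightarrow> param_poly (Suc d) f"
    using K param_poly_le[OF dP] unfolding K1_def by auto
  have "\<exists>R n. param_poly d R \<and> (\<forall>e a. degree (f e) = j \<longrightarrow> poly (f e) a = 0 \<longrightarrow> f e \<noteq> 0 \<longrightarrow>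
       coeff (f e) j ^ n * poly (P e) a = poly (R e) a)" if f: "f \<in> K1" and j: "j \<le> Suc d" for f j
    using pseudo_remainder[OF P, of f j] K1(2)[OF f] j param_poly_le[of "j - 1" _ d]
    unfolding param_poly_def[of "Suc d" f] by fastforce
  then obtain R n where R: "\<And>f j. f \<in> K1 \<Longrightarrow> j \<le> Suc d \<Longrightarrow> param_poly d (R f j)"
    and Req: "\<And>f j e a. f \<in> K1 \<Longrightarrow> j \<le> Suc d \<Longrightarrow> degree (f e) = j \<Longrightarrow> poly (f e) a = 0 \<Longrightarrow> f e \<noteq> 0
       \<Longrightarrow> coeff (f e) j ^ (n f j) * poly (P e) a = poly (R f j e) a"
    by metis
  define L1 where "L1 = insert dP ((\<lambda>(f, j). R f j) ` (K1 \<times> {..Suc d}))"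
  have "sign_controlled (L1 \<union> K)"
    using K1 R dP by (intro L) (auto simp: L1_def)
  then obtain Q where Q: "finite Q" "\<forall>q\<in>Q. polyfun q"
    "\<And>e e'. \<forall>q\<in>Q. sgn (q e) = sgn (q e') \<Longrightarrow>
       \<exists>M. order_matching M \<and> (\<forall>f\<in>L1 \<union> K. same_signs M (f e) (f e'))"
    unfolding sign_controlled_def by blast
  define C where "C = (\<lambda>(f, j) e. coeff (f e) j) ` (insert P K1 \<times> {..Suc d})"
  have C: "finite C" "\<forall>q\<in>C. polyfun q" using K1 P unfolding C_def param_poly_def by auto
  show ?thesis
    unfolding sign_controlled_def
  proof (intro exI[of _ "Q \<union> C"] conjI allI impI)
    show "finite (Q \<union> C)" "\<forall>q\<in>Q \<union> C. polyfun q" using Q C by auto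
    fix e e' assume s: "\<forall>q\<in>Q \<union> C. sgn (q e) = sgn (q e')"
    then obtain M where M: "order_matching M" "\<forall>f\<in>L1 \<union> K. same_signs M (f e) (f e')" using Q(3)[of e e'] by blast
    have sc: "sgn (coeff (f e) i) = sgn (coeff (f e') i)" if "f \<in> insert P K1" "i \<le> Suc d" for f i
    proof -
      have "(\<lambda>e. coeff (f e) i) \<in> Q \<union> C" using that unfolding C_def by force
      from bspec[OF s this] show ?thesis .
    qed
    have pp: "degree (f e) = degree (f e')" "sgn (lead_coeff (f e)) = sgn (lead_coeff (f e'))"
      "f e = 0 \<longleftrightarrow> f e' = 0" "degree (f e) \<le> Suc d" if "f \<in> insert P K1" for f
    proof -
      have d: "degree (f e) \<le> Suc d" "degree (f e') \<le> Suc d"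
        using that K1 P unfolding param_poly_def by auto
      show "degree (f e) = degree (f e')" "sgn (lead_coeff (f e)) = sgn (lead_coeff (f e'))"
        "f e = 0 \<longleftrightarrow> f e' = 0" "degree (f e) \<le> Suc d"
        using same_sgn_coeffs[OF sc[OF that] d] d by auto
    qed
    define LL where "LL = (\<lambda>f. (f e, f e')) ` K1"
    have eq: "sgn (poly (P e) a) = sgn (poly (P e') b)"
      if f: "f \<in> K1" "f e \<noteq> 0" "(a, b) \<in> M" "poly (f e) a = 0" "poly (f e') b = 0" for f a b
    proof -
      define j where "j = degree (f e)"
      have j: "j \<le> Suc d" "degree (f e') = j" "f e' \<noteq> 0" using pp[of f] f unfolding j_def by auto
      have e1: "coeff (f e) j ^ n f j * poly (P e) a = poly (R f j e) a"
        by (rule Req) (use f j j_def in auto)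
      have e2: "coeff (f e') j ^ n f j * poly (P e') b = poly (R f j e') b"
        by (rule Req) (use f j in auto)
      have "R f j \<in> L1" using f j unfolding L1_def by force
      then have "same_signs M (R f j e) (R f j e')" using M by blast
      moreover have "corr M a b" using M(1) f(3) unfolding order_matching_def by blast
      ultimately have "sgn (poly (R f j e) a) = sgn (poly (R f j e') b)" unfolding same_signs_def by blast
      then have "sgn (coeff (f e) j) ^ n f j * sgn (poly (P e) a) = sgn (coeff (f e') j) ^ n f j * sgn (poly (P e') b)"
        unfolding e1[symmetric] e2[symmetric] by (simp add: sgn_mult power_sgn)
      moreover have "sgn (coeff (f e) j) = sgn (coeff (f e') j)" using sc f j by simp
      moreover have "sgn (coeff (f e) j) \<noteq> 0" using f(2) unfolding j_def by (simp add: sgn_zero_iff)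
      ultimately show ?thesis by simp
    qed
    obtain N where N: "order_matching N"
      "\<And>f g. (f, g) \<in> insert (P e, P e') LL \<Longrightarrow> same_signs N f g"
    proof (rule insert_roots[OF M(1), of LL "P e" "P e'"])
      fix f g assume "(f, g) \<in> LL"
      then obtain h where "h \<in> K1" "f = h e" "g = h e'" unfolding LL_def by blast
      moreover from this have "h \<in> L1 \<union> K" unfolding L1_def K1_def by blast
      ultimately show "same_signs M f g" using M(2) by blast
    next
      fix f g assume "(f, g) \<in> LL"
      then obtain h where "h \<in> K1" "f = h e" "g = h e'" unfolding LL_def by blast
      then show "f = 0 \<longleftrightarrow> g = 0" using pp(3)[of h] by simp
    next
      show "(pderiv (P e), pderiv (P e')) \<in> LL" unfolding LL_def K1_def dP_def by simp
    next
      fix f g a b assume "(f, g) \<in> LL" "f \<noteq> 0" "(a, b) \<in> M" "poly f a = 0" "poly g b = 0"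
      moreover from this obtain h where "h \<in> K1" "f = h e" "g = h e'" unfolding LL_def by blast
      ultimately show "sgn (poly (P e) a) = sgn (poly (P e') b)" using eq[of h a b] by blast
    qed (use pp[of P] in auto)
    have "same_signs N (f e) (f e')" if "f \<in> insert P K" for f
      using that by (intro N(2)) (auto simp: LL_def K1_def)
    then show "\<exists>M. order_matching M \<and> (\<forall>f\<in>insert P K. same_signs M (f e) (f e'))"
      using N(1) by blast
  qed
qed

text \<open>Outer induction on the degree bound, inner induction on the number of polynomials of the
  maximal degree. The inner hypothesis must allow an arbitrary finite set \<open>L\<close> of lower degree, because the removal of
  one polynomial creates new ones there.\<close>

lemma sign_controlled_finite:
  assumes "finite K" "\<And>f. f \<in> K \<Longrightarrow> param_poly d f"
  shows "sign_controlled K"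
  using assms
proof (induction d arbitrary: K)
  case 0
  define C where "C = (\<lambda>f e. coeff (f e) 0) ` K"
  have "\<exists>M. order_matching M \<and> (\<forall>f\<in>K. same_signs M (f e) (f e'))"
    if s: "\<forall>q\<in>C. sgn (q e) = sgn (q e')" for e e'
  proof (intro exI[of _ "{}"] conjI ballI)
    show "order_matching {}" by (simp add: order_matching_def)
    fix f assume f: "f \<in> K"
    then have "degree (f e) = 0" "degree (f e') = 0" using 0 unfolding param_poly_def by auto
    then obtain c c' where "f e = [:c:]" "f e' = [:c':]" by (meson degree_eq_zeroE)
    moreover have "(\<lambda>e. coeff (f e) 0) \<in> C" using f unfolding C_def by blast
    then have "sgn (coeff (f e) 0) = sgn (coeff (f e') 0)" using bspec[OF s] by blast
    ultimately show "same_signs {} (f e) (f e')" by (simp add: same_signs_def)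
  qed
  moreover have "finite C" "\<forall>q\<in>C. polyfun q" using 0 unfolding C_def param_poly_def by auto
  ultimately show ?case unfolding sign_controlled_def by blast
next
  case (Suc d)
  have "sign_controlled (L \<union> K)" if "finite L" "\<And>f. f \<in> L \<Longrightarrow> param_poly d f" for L
    using Suc.prems that
  proof (induction K arbitrary: L rule: finite_induct)
    case empty
    then show ?case using Suc.IH by simp
  next
    case (insert P K)
    have "sign_controlled (insert P (L \<union> K))"
    proof (rule sign_controlled_insert)
      fix L' assume L': "finite L'" "\<And>f. f \<in> L' \<Longrightarrow> param_poly d f"
      have "sign_controlled ((L' \<union> L) \<union> K)"
        using insert L' by (intro insert.IH) auto
      then show "sign_controlled (L' \<union> (L \<union> K))" by (simp add: Un_assoc)
    qed (use insert.prems insert.hyps param_poly_le[of d _ "Suc d"] in auto)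
    then show ?case by simp
  qed
  from this[of "{}"] show ?case by simp
qed

text \<open>Semialgebraic predicates. A predicate depending only on the signs of finitely many polynomials
  is a finite union of sign conditions, hence semialgebraic, and conversely; in this form closure under Boolean
  operations is immediate.\<close>

definition sa :: "((nat \<Rightarrow> real) \<Rightarrow> bool) \<Rightarrow> bool" where
  "sa \<phi> \<longleftrightarrow> (\<exists>S. finite S \<and> (\<forall>p\<in>S. polyfun p) \<and>
     (\<forall>e e'. (\<forall>p\<in>S. sgn (p e) = sgn (p e')) \<longrightarrow> \<phi> e = \<phi> e'))"

lemma sa_binary:
  assumes "sa \<phi>" "sa \<psi>"
  shows "sa (\<lambda>e. h (\<phi> e) (\<psi> e))"
proof -
  obtain S T where "finite S" "\<forall>p\<in>S. polyfun p" "\<forall>e e'. (\<forall>p\<in>S. sgn (p e) = sgn (p e')) \<longrightarrow> \<phi> e = \<phi> e'"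
    "finite T" "\<forall>p\<in>T. polyfun p" "\<forall>e e'. (\<forall>p\<in>T. sgn (p e) = sgn (p e')) \<longrightarrow> \<psi> e = \<psi> e'"
    using assms unfolding sa_def by blast
  note ST = this
  have "h (\<phi> e) (\<psi> e) = h (\<phi> e') (\<psi> e')" if "\<forall>p\<in>S \<union> T. sgn (p e) = sgn (p e')" for e e'
    using ST(3)[rule_format, of e e'] ST(6)[rule_format, of e e'] that by simp
  moreover have "finite (S \<union> T)" "\<forall>p\<in>S \<union> T. polyfun p" using ST by auto
  ultimately show ?thesis unfolding sa_def by blast
qed

lemma sa_const: "sa (\<lambda>e. c)"
  unfolding sa_def by (intro exI[of _ "{}"]) simp

lemmas sa_conj = sa_binary[where h = "(\<and>)"]
lemmas sa_disj = sa_binary[where h = "(\<or>)"]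
lemmas sa_imp = sa_binary[where h = "(\<longrightarrow>)"]
lemmas sa_not = sa_binary[where h = "\<lambda>x y. \<not> x", OF _ sa_const]

lemma sa_sgn:
  assumes "polyfun p"
  shows "sa (\<lambda>e. h (sgn (p e)))"
  unfolding sa_def using assms by (intro exI[of _ "{p}"]) simp

lemma sa_less: 
  assumes "polyfun p" "polyfun q"
  shows "sa (\<lambda>e. p e < q e)"
proof -
  have "(p e < q e) = (sgn (p e - q e) = -1)" for e by (simp add: sgn_real_def)
  then show ?thesis using sa_sgn[OF polyfun_diff[OF assms], of "\<lambda>x. x = -1"] by simp
qed

lemma sa_le: "polyfun p \<Longrightarrow> polyfun q \<Longrightarrow> sa (\<lambda>e. p e \<le> q e)"
  using sa_not[OF sa_less[of q p]] by (simp add: not_less)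

lemma sa_eq: "polyfun p \<Longrightarrow> polyfun q \<Longrightarrow> sa (\<lambda>e. p e = q e)"
  using sa_conj[OF sa_le[of p q] sa_le[of q p]] by (simp add: eq_iff)

lemma sa_subst:
  assumes "sa \<phi>" "\<And>j. polyfun (\<lambda>e. \<sigma> e j)"
  shows "sa (\<lambda>e. \<phi> (\<sigma> e))"
proof -
  obtain S where S: "finite S" "\<forall>p\<in>S. polyfun p"
    "\<forall>e e'. (\<forall>p\<in>S. sgn (p e) = sgn (p e')) \<longrightarrow> \<phi> e = \<phi> e'"
    using assms(1) unfolding sa_def by blast
  have "\<forall>q\<in>(\<lambda>p e. p (\<sigma> e)) ` S. polyfun q" using S(2) polyfun_subst[where \<sigma> = \<sigma>, OF _ assms(2)] by auto
  moreover have "\<phi> (\<sigma> e) = \<phi> (\<sigma> e')"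
    if "\<forall>q\<in>(\<lambda>p e. p (\<sigma> e)) ` S. sgn (q e) = sgn (q e')" for e e'
    using S(3)[rule_format, of "\<sigma> e" "\<sigma> e'"] that by auto
  ultimately show ?thesis using S(1) unfolding sa_def
    by (intro exI[of _ "(\<lambda>p e. p (\<sigma> e)) ` S"]) simp
qed

text \<open>The Tarski--Seidenberg theorem. If the controlling signs agree at \<open>e\<close> and \<open>e'\<close>, a witness
  at \<open>e\<close> is transported to \<open>e'\<close> along the order matching.\<close>

theorem sa_ex_upd:
  assumes "sa \<phi>"
  shows "sa (\<lambda>e. \<exists>y. \<phi> (e(i := y)))"
proof -
  obtain S where S: "finite S" "\<forall>p\<in>S. polyfun p"
    "\<And>e e'. (\<forall>p\<in>S. sgn (p e) = sgn (p e')) \<Longrightarrow> \<phi> e = \<phi> e'"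
    using assms unfolding sa_def by blast
  have "\<forall>p\<in>S. \<exists>P. \<exists>d. param_poly d P \<and> (\<forall>e y. p (e(i := y)) = poly (P e) y)"
    using polyfun_as_param_poly S(2) by blast
  from bchoice[OF this] obtain P
    where "\<forall>p\<in>S. \<exists>d. param_poly d (P p) \<and> (\<forall>e y. p (e(i := y)) = poly (P p e) y)" by blast
  from bchoice[OF this] obtain d
    where Pd: "\<forall>p\<in>S. param_poly (d p) (P p) \<and> (\<forall>e y. p (e(i := y)) = poly (P p e) y)" by blast
  have "sign_controlled (P ` S)"
  proof (rule sign_controlled_finite[where d = "Max (d ` S)"])
    fix f assume "f \<in> P ` S"
    then show "param_poly (Max (d ` S)) f"
      using Pd S(1) by (auto intro: param_poly_le)
  qed (use S in auto)
  then obtain Q where Q: "finite Q" "\<forall>q\<in>Q. polyfun q"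
    "\<And>e e'. \<forall>q\<in>Q. sgn (q e) = sgn (q e') \<Longrightarrow>
       \<exists>M. order_matching M \<and> (\<forall>f\<in>P ` S. same_signs M (f e) (f e'))"
    unfolding sign_controlled_def by blast
  have "\<exists>y. \<phi> (e'(i := y))" if s: "\<forall>q\<in>Q. sgn (q e) = sgn (q e')" and y: "\<phi> (e(i := y))" for e e' y
  proof -
    obtain M where M: "order_matching M" "\<forall>f\<in>P ` S. same_signs M (f e) (f e')" using Q(3)[OF s] by blast
    obtain y' where y': "corr M y y'" using corr_ex[OF M(1)] by blast
    have "sgn (p (e(i := y))) = sgn (p (e'(i := y')))" if "p \<in> S" for p
      using that Pd M(2) y' unfolding same_signs_def by fastforce
    then show ?thesis using S(3)[of "e(i := y)" "e'(i := y')"] y by blast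
  qed
  note * = this
  have "(\<exists>y. \<phi> (e(i := y))) = (\<exists>y. \<phi> (e'(i := y)))" if s: "\<forall>q\<in>Q. sgn (q e) = sgn (q e')" for e e'
  proof -
    have s': "\<forall>q\<in>Q. sgn (q e') = sgn (q e)" using s by simp
    show ?thesis using *[OF s] *[OF s'] by blast
  qed
  then show ?thesis unfolding sa_def using Q(1,2) by blast
qed

section \<open>Semialgebraic functions of one variable\<close>

lemma polyfun_shift: "polyfun (\<lambda>e. case_nat (p e) (\<lambda>k. q e k) j)" if "polyfun p" "\<And>k. polyfun (\<lambda>e. q e k)"
  using that by (cases j) auto

text \<open>The quantified variable is moved to index 0 and the others are shifted up, as with de Bruijn
  indices. This avoids freshness conditions, so that definability of concrete formulas is proved by plain resolution.\<close>

lemma sa_ex_cons: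
  assumes "sa \<psi>"
  shows "sa (\<lambda>e. \<exists>y. \<psi> (case_nat y e))"
proof -
  have "sa (\<lambda>e. (\<lambda>e. \<exists>y. \<psi> (e(0 := y))) (case_nat 0 e))"
    by (rule sa_subst[OF sa_ex_upd[OF assms]]) (auto intro: polyfun_shift polyfun.intros)
  moreover have "(case_nat 0 e)(0 := y) = case_nat y e" for y :: real and e
    by (auto simp: fun_eq_iff split: nat.split)
  ultimately show ?thesis by simp
qed

lemma sa_ex:
  assumes "sa (\<lambda>e. \<Phi> (\<lambda>j. e (Suc j)) (e 0))"
  shows "sa (\<lambda>e. \<exists>y. \<Phi> e y)"
  using sa_ex_cons[OF assms] by simp

lemma sa_all:
  assumes "sa (\<lambda>e. \<Phi> (\<lambda>j. e (Suc j)) (e 0))"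
  shows "sa (\<lambda>e. \<forall>y. \<Phi> e y)"
  using sa_not[OF sa_ex[OF sa_not[OF assms]]] by simp

lemma sa_eventually:
  assumes "sa (\<lambda>e. \<Phi> (\<lambda>j. e (Suc j)) (e 0))"
  shows "sa (\<lambda>e. \<forall>\<^sub>F h in at_right 0. \<Phi> e h)"
proof -
  have "sa (\<lambda>e. \<Phi> (\<lambda>j. e (Suc (Suc j))) (e 0))"
    using sa_subst[OF assms, of "\<lambda>e j. case_nat (e 0) (\<lambda>k. e (Suc (Suc k))) j"]
    by (simp add: polyfun_shift polyfun.intros)
  then have "sa (\<lambda>e. \<exists>d. 0 < d \<and> (\<forall>h. 0 < h \<longrightarrow> h < d \<longrightarrow> \<Phi> e h))"
    by (intro sa_ex sa_conj sa_all sa_imp sa_less polyfun.intros)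
  then show ?thesis by (simp add: eventually_at_right_field)
qed

lemma sa_exN:
  assumes "sa \<phi>"
  shows "sa (\<lambda>e. \<exists>w. \<phi> (\<lambda>j. if j < N then w j else e (j - N)))"
proof (induction N)
  case 0
  then show ?case using assms by simp
next
  case (Suc N)
  have cn: "case_nat y e (j - N) = (if j = N then y else e (j - Suc N))" if "\<not> j < N" for y :: real and e j
  proof (cases "j - N")
    case (Suc k)
    then have "j = N + Suc k" by simp
    then show ?thesis by simp
  qed (use that in simp)
  have "(\<exists>y w. \<phi> (\<lambda>j. if j < N then w j else case_nat y e (j - N)))
      = (\<exists>w. \<phi> (\<lambda>j. if j < Suc N then w j else e (j - Suc N)))" for e
  proof safe
    fix y w assume "\<phi> (\<lambda>j. if j < N then w j else case_nat y e (j - N))"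
    moreover have "(\<lambda>j. if j < N then w j else case_nat y e (j - N))
      = (\<lambda>j. if j < Suc N then (w(N := y)) j else e (j - Suc N))"
      by (auto simp: fun_eq_iff less_Suc_eq cn)
    ultimately show "\<exists>w. \<phi> (\<lambda>j. if j < Suc N then w j else e (j - Suc N))" by metis
  next
    fix w assume "\<phi> (\<lambda>j. if j < Suc N then w j else e (j - Suc N))"
    moreover have "(\<lambda>j. if j < N then w j else case_nat (w N) e (j - N))
      = (\<lambda>j. if j < Suc N then w j else e (j - Suc N))"
      by (auto simp: fun_eq_iff less_Suc_eq cn)
    ultimately show "\<exists>y w. \<phi> (\<lambda>j. if j < N then w j else case_nat y e (j - N))" by metis
  qed
  then show ?case using sa_ex_cons[OF Suc] by simp
qed

lemma eventually_sgn_poly: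
  fixes p :: "real poly"
  obtains s where "\<forall>\<^sub>F h in at_right 0. sgn (poly p h) = s"
proof (cases "p = 0")
  case True
  then show ?thesis using that[of 0] by simp
next
  case False
  define Z where "Z = {x. poly p x = 0 \<and> x > 0}"
  have fin: "finite Z" using poly_roots_finite[OF False] unfolding Z_def by simp
  define d where "d = Min (insert 1 Z)"
  have d: "d > 0" "\<And>x. x \<in> Z \<Longrightarrow> d \<le> x" using fin unfolding d_def by (auto simp: Z_def)
  have "sgn (poly p h) = sgn (poly p (d / 2))" if h: "0 < h" "h < d" for h
  proof -
    have nz: "poly p w \<noteq> 0" if "0 < w" "w < d" for w using that d(2)[of w] unfolding Z_def by auto
    show ?thesis
    proof (cases "h \<le> d / 2")
      case True
      then show ?thesis using nz h d(1) by (intro same_sgn_no_root) auto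
    next
      case False
      then show ?thesis using nz h d(1) by (intro same_sgn_no_root[symmetric]) auto
    qed
  qed
  then show ?thesis using that[of "sgn (poly p (d / 2))"] d(1)
    unfolding eventually_at_right_field by blast
qed

text \<open>O-minimality at a one-sided limit: a polynomial in one variable has constant sign close to \<open>0\<close> on the right.
  Other points and the left side are reached by an affine change of variable.\<close>

lemma sa_dichotomy:
  assumes "sa (\<lambda>e. A (e 0))"
  shows "(\<forall>\<^sub>F h in at_right 0. A h) \<or> (\<forall>\<^sub>F h in at_right 0. \<not> A h)"
proof -
  obtain S where S: "finite S" "\<forall>p\<in>S. polyfun p"
    "\<And>e e'. (\<forall>p\<in>S. sgn (p e) = sgn (p e')) \<Longrightarrow> A (e 0) = A (e' 0)"
    using assms unfolding sa_def by blast
  define E where "E h = (\<lambda>_::nat. 0 :: real)(0 := h)" for h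
  have "\<exists>s. \<forall>\<^sub>F h in at_right 0. sgn (p (E h)) = s" if p: "p \<in> S" for p
  proof -
    obtain P where P: "\<forall>e y. p (e(0 := y)) = poly (P e) y"
      using polyfun_as_param_poly S(2) p by blast
    obtain s where "\<forall>\<^sub>F h in at_right 0. sgn (poly (P (\<lambda>_. 0)) h) = s"
      using eventually_sgn_poly .
    then show ?thesis using P unfolding E_def by auto
  qed
  then obtain s where s: "\<forall>p\<in>S. \<forall>\<^sub>F h in at_right 0. sgn (p (E h)) = s p" by metis
  then have ev: "\<forall>\<^sub>F h in at_right 0. \<forall>p\<in>S. sgn (p (E h)) = s p"
    using S(1) by (simp add: eventually_ball_finite)
  show ?thesis
  proof (cases "\<exists>h. (\<forall>p\<in>S. sgn (p (E h)) = s p) \<and> A h")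
    case True
    then obtain h0 where h0: "\<forall>p\<in>S. sgn (p (E h0)) = s p" "A h0" by blast
    from ev have "\<forall>\<^sub>F h in at_right 0. A h"
    proof eventually_elim
      case (elim h)
      then show ?case using S(3)[of "E h" "E h0"] h0 by (simp add: E_def)
    qed
    then show ?thesis ..
  next
    case False
    from ev have "\<forall>\<^sub>F h in at_right 0. \<not> A h"
      by eventually_elim (use False in blast)
    then show ?thesis ..
  qed
qed

definition sa_fun :: "(real \<Rightarrow> real) \<Rightarrow> bool" where
  "sa_fun f \<longleftrightarrow> sa (\<lambda>e. e 1 = f (e 0))"

lemma sa_graph:
  assumes "sa_fun f" "polyfun p" "polyfun q"
  shows "sa (\<lambda>e. p e = f (q e))"
  using sa_subst[OF assms(1)[unfolded sa_fun_def], of "\<lambda>e j. case_nat (q e) (\<lambda>_. p e) j"]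
    polyfun_shift[OF assms(3), of "\<lambda>e _. p e"] assms(2) by simp

text \<open>Semialgebraic functions may be applied inside formulas: \<open>\<Phi> e (f (q e))\<close> says that some \<open>y\<close> on the graph
  satisfies \<open>\<Phi> e y\<close>.\<close>

lemma sa_app:
  assumes "sa_fun f" "polyfun q" "sa (\<lambda>e. \<Phi> (\<lambda>j. e (Suc j)) (e 0))"
  shows "sa (\<lambda>e. \<Phi> e (f (q e)))"
proof -
  have "polyfun (\<lambda>e. q (\<lambda>j. e (Suc j)))" by (rule polyfun_subst[OF assms(2)]) (rule polyfun.var)
  then have "sa (\<lambda>e. \<exists>y. y = f (q e) \<and> \<Phi> e y)"
    by (intro sa_ex sa_conj sa_graph assms polyfun.intros)
  then show ?thesis by simp
qed

lemma sa_fun_minus: "sa_fun f \<Longrightarrow> sa_fun (\<lambda>t. - f t)"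
  unfolding sa_fun_def[of "\<lambda>t. - f t"]
  by (rule sa_app[where \<Phi> = "\<lambda>e y. e 1 = - y" and q = "\<lambda>e. e 0"])
     (auto intro!: sa_eq polyfun.intros polyfun_minus)

text \<open>The choice has to be definable by a formula. It is the least element if there is one;
  otherwise the set contains an interval starting at its infimum, and the midpoint of the longest such interval is taken.
  Boundedness guarantees that both ends exist. The value \<open>0\<close> stands for an empty set.\<close>

lemma sa_choice1:
  assumes A: "sa (\<lambda>e. A (e 0) (e 1))" and bd: "\<And>t y. A t y \<Longrightarrow> \<bar>y\<bar> \<le> R"
  obtains f where "sa_fun f" "\<And>t y. A t y \<Longrightarrow> A t (f t)"
proof -
  define least where "least t m \<longleftrightarrow> A t m \<and> (\<forall>z. A t z \<longrightarrow> m \<le> z)" for t m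
  define lb where "lb t a \<longleftrightarrow> (\<forall>z. A t z \<longrightarrow> a \<le> z)" for t a
  define glb where "glb t a \<longleftrightarrow> lb t a \<and> (\<forall>c. lb t c \<longrightarrow> c \<le> a)" for t a
  define D where "D t a b \<longleftrightarrow> a < b \<and> (\<forall>z. a < z \<longrightarrow> z < b \<longrightarrow> A t z)" for t a b
  define lub where "lub t a b \<longleftrightarrow> (\<forall>c. D t a c \<longrightarrow> c \<le> b) \<and> (\<forall>c. (\<forall>d. D t a d \<longrightarrow> d \<le> c) \<longrightarrow> b \<le> c)" for t a b
  define G where "G t y \<longleftrightarrow> (\<not> (\<exists>z. A t z) \<and> y = 0) \<or> least t y \<or>
     ((\<exists>z. A t z) \<and> \<not> (\<exists>m. least t m) \<and> (\<exists>a b. glb t a \<and> lub t a b \<and> 2 * y = a + b))" for t y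
  have A': "sa (\<lambda>e. A (p e) (q e))" if "polyfun p" "polyfun q" for p q
    using sa_subst[OF A, of "\<lambda>e j. case_nat (p e) (\<lambda>_. q e) j"]
      polyfun_shift[OF that(1), of "\<lambda>e _. q e"] that(2) by simp
  note rules = sa_ex sa_all sa_conj sa_disj sa_imp sa_not sa_le sa_less sa_eq A' polyfun.intros
  have "sa (\<lambda>e. G (e 0) (e 1))"
    unfolding G_def least_def lub_def glb_def lb_def D_def by (intro rules)
  have uniq: "y = y'" if "G t y" "G t y'" for t y y'
  proof -
    have "glb t a \<Longrightarrow> glb t a' \<Longrightarrow> a = a'" for a a' unfolding glb_def by (meson antisym)
    moreover have "lub t a b \<Longrightarrow> lub t a b' \<Longrightarrow> b = b'" for a b b' unfolding lub_def by (meson antisym)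
    moreover have "least t y \<Longrightarrow> least t y' \<Longrightarrow> y = y'" unfolding least_def by (meson antisym)
    ultimately show ?thesis using that unfolding G_def by (smt (verit) least_def)
  qed
  have "\<exists>y. G t y \<and> A t y" if z: "A t z" for t z
  proof (cases "\<exists>m. least t m")
    case True
    then show ?thesis unfolding G_def least_def by blast
  next
    case False
    define a where "a = Inf {z. A t z}"
    have bb: "bdd_below {z. A t z}" using bd by (intro bdd_belowI[of _ "-R"]) fastforce
    have glb: "glb t a" unfolding glb_def lb_def a_def
      using z bb by (auto intro!: cInf_lower cInf_greatest)
    then have "\<not> A t a" using False unfolding least_def glb_def lb_def by blast
    have "\<not> (\<forall>\<^sub>F h in at_right 0. \<not> A t (a + h))"
    proof
      assume "\<forall>\<^sub>F h in at_right 0. \<not> A t (a + h)"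
      then obtain d where d: "d > 0" "\<And>h. 0 < h \<Longrightarrow> h < d \<Longrightarrow> \<not> A t (a + h)"
        unfolding eventually_at_right_field by blast
      have "lb t (a + d)" unfolding lb_def
      proof (intro allI impI)
        fix u assume u: "A t u"
        then have "a \<le> u" "u \<noteq> a" using glb \<open>\<not> A t a\<close> unfolding glb_def lb_def by auto
        then show "a + d \<le> u" using d(2)[of "u - a"] u by fastforce
      qed
      then show False using glb d(1) unfolding glb_def by fastforce
    qed
    moreover have "sa (\<lambda>e. A t (a + e 0))" by (intro rules)
    ultimately have "\<forall>\<^sub>F h in at_right 0. A t (a + h)" using sa_dichotomy[of "\<lambda>h. A t (a + h)"] by blast
    then obtain d where d: "d > 0" "\<And>h. 0 < h \<Longrightarrow> h < d \<Longrightarrow> A t (a + h)"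
      unfolding eventually_at_right_field by blast
    have D: "D t a (a + d)" unfolding D_def using d by (metis add_diff_cancel_left' diff_add_cancel
        less_add_same_cancel1 add.commute diff_gt_0_iff_gt less_diff_eq)
    have DR: "b \<le> R" if b: "D t a b" for b
    proof (rule ccontr)
      assume "\<not> b \<le> R"
      then obtain u where "max a R < u" "u < b" using b dense[of "max a R" b] unfolding D_def by auto
      then show False using b bd[of t u] unfolding D_def by auto
    qed
    define b where "b = Sup {b. D t a b}"
    have ba: "bdd_above {b. D t a b}" using DR by (intro bdd_aboveI) auto
    have lub: "lub t a b" unfolding lub_def b_def using D ba
      by (auto intro!: cSup_upper cSup_least)
    have "a < b" using lub D d(1) unfolding lub_def by fastforce
    have "A t u" if "a < u" "u < b" for u
    proof -
      have "\<not> (\<forall>d. D t a d \<longrightarrow> d \<le> u)" using lub that(2) unfolding lub_def by fastforce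
      then show ?thesis using that(1) unfolding D_def by (meson not_le)
    qed
    then have "A t ((a + b) / 2)" using \<open>a < b\<close> by simp
    moreover have "\<exists>a' b'. glb t a' \<and> lub t a' b' \<and> 2 * ((a + b) / 2) = a' + b'"
      using glb lub by (intro exI[of _ a] exI[of _ b]) simp
    then have "G t ((a + b) / 2)" unfolding G_def using z False by blast
    ultimately show ?thesis by blast
  qed
  moreover have "G t 0" if "\<not> (\<exists>z. A t z)" for t using that unfolding G_def by blast
  ultimately have ex: "\<exists>y. G t y \<and> ((\<exists>z. A t z) \<longrightarrow> A t y)" for t by metis
  define f where "f t = (THE y. G t y)" for t
  have Gf: "y = f t \<longleftrightarrow> G t y" for y t
    using ex[of t] uniq unfolding f_def by (metis the_equality)
  show ?thesis
  proof (rule that)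
    show "sa_fun f" unfolding sa_fun_def Gf by fact
    show "A t (f t)" if "A t y" for t y using ex[of t] Gf that by metis
  qed
qed

text \<open>Coordinates are chosen one after the other, each from the projection of what is left.
  The unused indices are set to \<open>0\<close> so that the formula cannot depend on them.\<close>

lemma sa_choiceN:
  assumes "sa \<phi>" "\<And>e j. \<phi> e \<Longrightarrow> j < N \<Longrightarrow> \<bar>e (Suc j)\<bar> \<le> R"
  shows "\<exists>X. (\<forall>j. sa_fun (X j)) \<and> (\<forall>t. (\<exists>w. \<phi> (case_nat t (\<lambda>j. if j < N then w j else 0)))
    \<longrightarrow> \<phi> (case_nat t (\<lambda>j. if j < N then X j t else 0)))"
  using assms
proof (induction N arbitrary: \<phi>)
  case 0
  have "sa_fun (\<lambda>t. 0)" unfolding sa_fun_def by (intro sa_eq polyfun.intros)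
  then show ?case by (intro exI[of _ "\<lambda>_ _. 0"]) (simp cong del: nat.case_cong_weak)
next
  case (Suc N)
  define A where "A t y \<longleftrightarrow> (\<exists>w. \<phi> (case_nat t (case_nat y (\<lambda>j. if j < N then w j else 0))))" for t y
  have "sa (\<lambda>e. \<phi> (case_nat (e N) (case_nat (e (Suc N)) (\<lambda>j. if j < N then e j else 0))))"
  proof (rule sa_subst[OF Suc.prems(1)], intro polyfun_shift polyfun.var)
    show "polyfun (\<lambda>e. if k < N then e k else 0)" for k
      by (cases "k < N") (auto intro: polyfun.intros)
  qed
  from sa_exN[OF this, of N] have "sa (\<lambda>e. A (e 0) (e 1))"
    unfolding A_def by (simp cong: if_cong cong del: nat.case_cong_weak)
  moreover have "\<bar>y\<bar> \<le> R" if "A t y" for t y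
    using that Suc.prems(2)[of _ 0] unfolding A_def by fastforce
  ultimately obtain f where f: "sa_fun f" "\<And>t y. A t y \<Longrightarrow> A t (f t)" using sa_choice1[of A R] by blast
  define \<psi> where "\<psi> e = \<phi> (case_nat (e 0) (case_nat (f (e 0)) (\<lambda>j. e (Suc j))))" for e
  have "sa \<psi>"
    unfolding \<psi>_def
  proof (rule sa_app[where \<Phi> = "\<lambda>e y. \<phi> (case_nat (e 0) (case_nat y (\<lambda>j. e (Suc j))))" and q = "\<lambda>e. e 0"])
    show "sa (\<lambda>e. \<phi> (case_nat (e (Suc 0)) (case_nat (e 0) (\<lambda>j. e (Suc (Suc j))))))"
      by (rule sa_subst[OF Suc.prems(1)]) (intro polyfun_shift polyfun.var)
  qed (use f polyfun.var in auto)
  moreover have "\<bar>e (Suc j)\<bar> \<le> R" if "\<psi> e" "j < N" for e j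
    using Suc.prems(2)[OF that(1)[unfolded \<psi>_def], of "Suc j"] that(2) by simp
  ultimately obtain X where X: "\<forall>j. sa_fun (X j)"
    "\<And>t. \<exists>w. \<psi> (case_nat t (\<lambda>j. if j < N then w j else 0))
       \<Longrightarrow> \<psi> (case_nat t (\<lambda>j. if j < N then X j t else 0))"
    using Suc.IH[of \<psi>] by blast
  have shift: "(\<lambda>j. if j < Suc N then w j else (0::real)) = case_nat (w 0) (\<lambda>j. if j < N then w (Suc j) else 0)" for w
    by (auto simp: fun_eq_iff split: nat.split)
  show ?case
  proof (intro exI[of _ "case_nat f X"] conjI allI impI)
    show "sa_fun (case_nat f X j)" for j using f X(1) by (cases j) auto
    fix t assume "\<exists>w. \<phi> (case_nat t (\<lambda>j. if j < Suc N then w j else 0))"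
    then obtain w where "\<phi> (case_nat t (case_nat (w 0) (\<lambda>j. if j < N then w (Suc j) else 0)))"
      unfolding shift by blast
    then have "A t (w 0)" unfolding A_def by (intro exI[of _ "\<lambda>j. w (Suc j)"])
    then have "A t (f t)" by (rule f(2))
    then have "\<psi> (case_nat t (\<lambda>j. if j < N then X j t else 0))"
      by (intro X(2)) (simp add: A_def \<psi>_def)
    then show "\<phi> (case_nat t (\<lambda>j. if j < Suc N then case_nat f X j t else 0))"
      unfolding \<psi>_def shift[of "\<lambda>j. case_nat f X j t"] by (simp cong: if_cong cong del: nat.case_cong_weak)
  qed
qed

text \<open>A rational number just to the right of each point separates it from the later ones.\<close>

lemma countable_right_isolated:
  fixes A :: "real set"
  assumes "\<And>t. t \<in> A \<Longrightarrow> \<forall>\<^sub>F h in at_right 0. t + h \<notin> A"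
  shows "countable A"
proof -
  have "\<exists>q\<in>\<rat>. t < q \<and> (\<forall>s\<in>A. t < s \<longrightarrow> q < s)" if t: "t \<in> A" for t
  proof -
    obtain d where d: "d > 0" "\<And>h. 0 < h \<Longrightarrow> h < d \<Longrightarrow> t + h \<notin> A"
      using assms[OF t] unfolding eventually_at_right_field by blast
    obtain q where q: "q \<in> \<rat>" "t < q" "q < t + d" using Rats_dense_in_real[of t "t + d"] d(1) by auto
    have "q < s" if s: "s \<in> A" "t < s" for s
    proof (rule ccontr)
      assume "\<not> q < s"
      then show False using d(2)[of "s - t"] s q by simp
    qed
    then show ?thesis using q by blast
  qed
  then obtain q where q: "\<And>t. t \<in> A \<Longrightarrow> q t \<in> \<rat> \<and> t < q t \<and> (\<forall>s\<in>A. t < s \<longrightarrow> q t < s)" by metis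
  have "inj_on q A"
  proof (rule inj_onI)
    fix s t assume "s \<in> A" "t \<in> A" "q s = q t"
    then show "s = t" using q[of s] q[of t] by (cases s t rule: linorder_cases) force+
  qed
  moreover have "countable (q ` A)" using q by (intro countable_subset[OF _ countable_rat]) auto
  ultimately show ?thesis by (simp add: countable_image_inj_eq)
qed

lemma countable_one_side_isolated:
  fixes A :: "real set"
  assumes "\<And>t. t \<in> A \<Longrightarrow> \<forall>\<^sub>F h in at_right 0. t + \<sigma> * h \<notin> A" "\<sigma> = 1 \<or> \<sigma> = -1"
  shows "countable A"
proof (cases "\<sigma> = 1")
  case True
  then show ?thesis using assms by (intro countable_right_isolated) simp
next
  case False
  then have \<sigma>: "\<sigma> = -1" using assms by simp
  have "countable (uminus ` A)"
  proof (rule countable_right_isolated)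
    fix t assume "t \<in> uminus ` A"
    then have "\<forall>\<^sub>F h in at_right 0. - t + \<sigma> * h \<notin> A" using assms(1)[of "- t"] by auto
    then show "\<forall>\<^sub>F h in at_right 0. t + h \<notin> uminus ` A"
    proof eventually_elim
      case (elim h)
      have "- (t + h) \<in> A" if "t + h \<in> uminus ` A"
        using that by (metis imageE minus_minus)
      then show ?case using elim by (auto simp: \<sigma>)
    qed
  qed
  then show ?thesis by (simp add: countable_image_inj_eq)
qed

text \<open>By the dichotomy, a failure would occur at every point of an interval. A failure at \<open>t\<close>
  is witnessed by a rational \<open>q\<close> with \<open>f t < q\<close> and \<open>f > q\<close> just beside \<open>t\<close> on the side \<open>\<sigma>\<close>; for fixed \<open>q\<close> such points are isolated on that
  side, so there are only countably many.\<close>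

lemma sa_fun_eventually_semicontinuous:
  assumes f: "sa_fun f" and \<sigma>: "\<sigma> = 1 \<or> \<sigma> = -1"
  shows "\<forall>\<^sub>F t in at_right 0. \<forall>q>f t. \<forall>\<^sub>F h in at_right 0. f (t + \<sigma> * h) < q"
proof -
  define bad where "bad t q \<longleftrightarrow> f t < q \<and> (\<forall>\<^sub>F h in at_right 0. q < f (t + \<sigma> * h))" for t q
  have "sa (\<lambda>e. (\<exists>q. bad (e 0) q))"
    unfolding bad_def
    by (intro sa_ex sa_conj sa_eventually
        sa_app[OF f, where \<Phi> = "\<lambda>e y. y < e 0" and q = "\<lambda>e. e (Suc 0)"]
        sa_app[OF f, where \<Phi> = "\<lambda>e y. e (Suc 0) < y" and q = "\<lambda>e. e (Suc (Suc 0)) + \<sigma> * e 0"] sa_less polyfun.intros)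
  from sa_dichotomy[OF this] have "\<forall>\<^sub>F t in at_right 0. \<not> (\<exists>q. bad t q)"
  proof
    assume "\<forall>\<^sub>F t in at_right 0. \<exists>q. bad t q"
    then obtain d where d: "d > 0" "\<And>t. 0 < t \<Longrightarrow> t < d \<Longrightarrow> \<exists>q. bad t q"
      unfolding eventually_at_right_field by blast
    have bad_down: "bad t q'" if "bad t q" "f t < q'" "q' \<le> q" for t q q'
      using that unfolding bad_def by (auto elim: eventually_mono)
    have "{0<..<d} \<subseteq> (\<Union>q\<in>\<rat>. {t. bad t q})"
    proof
      fix t assume "t \<in> {0<..<d}"
      then obtain q where q: "bad t q" using d(2) by auto
      then have "f t < q" unfolding bad_def by blast
      then obtain q' where "q' \<in> \<rat>" "f t < q'" "q' < q" using Rats_dense_in_real by blast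
      then have "bad t q'" using bad_down[OF q] by simp
      then show "t \<in> (\<Union>q\<in>\<rat>. {t. bad t q})" using \<open>q' \<in> \<rat>\<close> by blast
    qed
    moreover have "countable {t. bad t q}" for q
    proof (rule countable_one_side_isolated[OF _ \<sigma>])
      fix t assume "t \<in> {t. bad t q}"
      then have "\<forall>\<^sub>F h in at_right 0. q < f (t + \<sigma> * h)" unfolding bad_def by blast
      then show "\<forall>\<^sub>F h in at_right 0. t + \<sigma> * h \<notin> {t. bad t q}"
        by eventually_elim (simp add: bad_def)
    qed
    ultimately have "countable {0<..<d}" using countable_rat
      by (meson countable_UN countable_subset)
    then show ?thesis using d(1) uncountable_open_interval by blast
  qed
  then show ?thesis
  proof eventually_elim
    case (elim t)
    show ?case
    proof (intro allI impI)
      fix q assume q: "f t < q"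
      have "sa (\<lambda>e. f (t + \<sigma> * e 0) < q)"
        by (intro sa_app[OF f, where \<Phi> = "\<lambda>e y. y < q" and q = "\<lambda>e. t + \<sigma> * e 0"] sa_less polyfun.intros)
      from sa_dichotomy[OF this] show "\<forall>\<^sub>F h in at_right 0. f (t + \<sigma> * h) < q"
      proof
        assume "\<forall>\<^sub>F h in at_right 0. \<not> f (t + \<sigma> * h) < q"
        moreover obtain q' where q': "f t < q'" "q' < q" using dense q by blast
        ultimately have "\<forall>\<^sub>F h in at_right 0. q' < f (t + \<sigma> * h)"
          by (auto elim!: eventually_mono)
        then show ?thesis using elim q' unfolding bad_def by blast
      qed
    qed
  qed
qed

lemma sa_fun_eventually_isCont:
  assumes f: "sa_fun f"
  shows "\<forall>\<^sub>F t in at_right 0. isCont f t"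
proof -
  have "\<forall>\<^sub>F t in at_right 0. \<forall>q>f t. \<forall>\<^sub>F h in at_right 0. f (t + h) < q"
    and "\<forall>\<^sub>F t in at_right 0. \<forall>q>f t. \<forall>\<^sub>F h in at_right 0. f (t - h) < q"
    and "\<forall>\<^sub>F t in at_right 0. \<forall>q>- f t. \<forall>\<^sub>F h in at_right 0. - f (t + h) < q"
    and "\<forall>\<^sub>F t in at_right 0. \<forall>q>- f t. \<forall>\<^sub>F h in at_right 0. - f (t - h) < q"
    using sa_fun_eventually_semicontinuous[OF f, of 1] sa_fun_eventually_semicontinuous[OF f, of "-1"]
      sa_fun_eventually_semicontinuous[OF sa_fun_minus[OF f], of 1]
      sa_fun_eventually_semicontinuous[OF sa_fun_minus[OF f], of "-1"] by simp_all
  then show ?thesis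
  proof eventually_elim
    case (elim t)
    have R: "eventually P (at_right t) \<longleftrightarrow> (\<forall>\<^sub>F h in at_right 0. P (t + h))" for P
      by (subst eventually_at_right_to_0) (simp add: add.commute)
    have L: "eventually P (at_left t) \<longleftrightarrow> (\<forall>\<^sub>F h in at_right 0. P (t - h))" for P
      by (subst eventually_at_left_to_right, subst eventually_at_right_to_0) (simp add: add.commute)
    have S: "eventually P (at t) \<longleftrightarrow> (\<forall>\<^sub>F h in at_right 0. P (t - h)) \<and> (\<forall>\<^sub>F h in at_right 0. P (t + h))" for P
      by (simp add: eventually_at_split R L)
    show ?case unfolding isCont_def
    proof (rule order_tendstoI)
      fix q assume "f t < q"
      then show "\<forall>\<^sub>F x in at t. f x < q" unfolding S using elim(1,2) by simp
    next
      fix q assume "q < f t"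
      then show "\<forall>\<^sub>F x in at t. q < f x" unfolding S using elim(3,4)[rule_format, of "- q"] by simp
    qed
  qed
qed

text \<open>At each \<open>t\<close> one of the three signs holds close to \<open>t\<close>, by the dichotomy in \<open>h\<close>; by the
  dichotomy in \<open>t\<close>, one of them holds for all small \<open>t\<close>.\<close>

lemma sa_fun_side_sign:
  assumes f: "sa_fun f"
  shows "\<exists>s. \<forall>\<^sub>F t in at_right 0. \<forall>\<^sub>F h in at_right 0. sgn (f (t + \<sigma> * h) - f t) = s"
proof -
  define C where "C s t \<longleftrightarrow> (\<forall>\<^sub>F h in at_right 0. sgn (f (t + \<sigma> * h) - f t) = s)" for s t
  have sg: "sa (\<lambda>e. sgn (p e - q e) = s)" if "polyfun p" "polyfun q" for p q s
    using sa_sgn[OF polyfun_diff[OF that], of "\<lambda>x. x = s"] .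
  have "(\<forall>\<^sub>F t in at_right 0. C s t) \<or> (\<forall>\<^sub>F t in at_right 0. \<not> C s t)" for s
    unfolding C_def
    by (intro sa_dichotomy sa_eventually
        sa_app[OF f, where \<Phi> = "\<lambda>e y. sgn (y - f (e (Suc 0))) = s" and q = "\<lambda>e. e (Suc 0) + \<sigma> * e 0"]
        sa_app[OF f, where \<Phi> = "\<lambda>e y. sgn (e 0 - y) = s" and q = "\<lambda>e. e (Suc (Suc 0))"] sg polyfun.intros)
  moreover have "C (-1) t \<or> C 0 t \<or> C 1 t" for t
  proof -
    have "(C s t) \<or> (\<forall>\<^sub>F h in at_right 0. sgn (f (t + \<sigma> * h) - f t) \<noteq> s)" for s
      unfolding C_def
      by (intro sa_dichotomy
        sa_app[OF f, where \<Phi> = "\<lambda>e y. sgn (y - f t) = s" and q = "\<lambda>e. t + \<sigma> * e 0"] sg polyfun.intros)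
    then have "C (-1) t \<or> C 0 t \<or> C 1 t \<or> (\<forall>\<^sub>F h in at_right 0. sgn (f (t + \<sigma> * h) - f t) \<noteq> -1 \<and>
        sgn (f (t + \<sigma> * h) - f t) \<noteq> 0 \<and> sgn (f (t + \<sigma> * h) - f t) \<noteq> 1)"
      by (simp add: eventually_conj_iff) blast
    moreover have "\<not> (sgn y \<noteq> -1 \<and> sgn y \<noteq> 0 \<and> sgn y \<noteq> 1)" for y :: real by (simp add: sgn_real_def)
    then have "\<not> (\<forall>\<^sub>F h in at_right (0::real). sgn (f (t + \<sigma> * h) - f t) \<noteq> -1 \<and>
        sgn (f (t + \<sigma> * h) - f t) \<noteq> 0 \<and> sgn (f (t + \<sigma> * h) - f t) \<noteq> 1)"
      by (simp only: eventually_False) simp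
    ultimately show ?thesis by blast
  qed
  ultimately have "\<exists>s. \<forall>\<^sub>F t in at_right 0. C s t"
  proof -
    assume *: "\<And>s. (\<forall>\<^sub>F t in at_right 0. C s t) \<or> (\<forall>\<^sub>F t in at_right 0. \<not> C s t)" "\<And>t. C (-1) t \<or> C 0 t \<or> C 1 t"
    show ?thesis
    proof (rule ccontr)
      assume "\<not> ?thesis"
      then have "\<forall>\<^sub>F t in at_right 0. \<not> C (-1) t \<and> \<not> C 0 t \<and> \<not> C 1 t"
        using *(1) by (auto simp: eventually_conj_iff)
      then have "\<forall>\<^sub>F t in at_right (0::real). False" by eventually_elim (use *(2) in blast)
      then show False by simp
    qed
  qed
  then show ?thesis unfolding C_def .
qed

text \<open>The function stays on one side of every constant near \<open>0\<close>, so it cannot oscillate.\<close>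

lemma sa_fun_bounded_limit:
  assumes f: "sa_fun f" and bd: "\<forall>\<^sub>F t in at_right 0. \<bar>f t\<bar> \<le> R"
  shows "\<exists>l. (f \<longlongrightarrow> l) (at_right 0)"
proof -
  define S where "S = {q. \<forall>\<^sub>F t in at_right 0. q \<le> f t}"
  have dich: "(\<forall>\<^sub>F t in at_right 0. q \<le> f t) \<or> (\<forall>\<^sub>F t in at_right 0. \<not> q \<le> f t)" for q
    by (intro sa_dichotomy sa_app[OF f, where \<Phi> = "\<lambda>e y. q \<le> y" and q = "\<lambda>e. e 0"] sa_le polyfun.intros)
  have ne: "- R \<in> S" using bd unfolding S_def by (auto elim!: eventually_mono)
  have ub: "q \<le> R" if "q \<in> S" for q
  proof -
    have "\<forall>\<^sub>F t in at_right 0. q \<le> f t" using that unfolding S_def by simp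
    from this bd have "\<forall>\<^sub>F t in at_right (0::real). q \<le> R" by eventually_elim linarith
    then show ?thesis by simp
  qed
  then have bdd: "bdd_above S" by (intro bdd_aboveI) auto
  have "(f \<longlongrightarrow> Sup S) (at_right 0)"
  proof (rule order_tendstoI)
    fix q assume "q < Sup S"
    then obtain q' where "q' \<in> S" "q < q'" using ne less_cSup_iff[OF _ bdd] by blast
    then show "\<forall>\<^sub>F x in at_right 0. q < f x" unfolding S_def by (auto elim!: eventually_mono)
  next
    fix q assume "Sup S < q"
    then have "q \<notin> S" using bdd cSup_upper by force
    then show "\<forall>\<^sub>F x in at_right 0. f x < q" using dich[of q] unfolding S_def by (simp add: not_le)
  qed
  then show ?thesis ..
qed

section \<open>Bounded semialgebraic curves are not steep\<close>

text \<open>The last point up to which the estimate holds could be pushed further. Continuity makes that last point exist.\<close>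

lemma growth_from_one_sided_slope:
  fixes g :: "real \<Rightarrow> real"
  assumes "a \<le> b" "continuous_on {a..b} g"
    and sl: "\<And>t. a \<le> t \<Longrightarrow> t < b \<Longrightarrow> \<forall>\<^sub>F h in at_right 0. \<kappa> * h \<le> g (t + h) - g t"
  shows "\<kappa> * (b - a) \<le> g b - g a"
proof (rule ccontr)
  assume neg: "\<not> ?thesis"
  define \<phi> where "\<phi> t = g t - g a - \<kappa> * (t - a)" for t
  define A where "A = {t \<in> {a..b}. 0 \<le> \<phi> t}"
  have "continuous_on {a..b} \<phi>" unfolding \<phi>_def by (intro continuous_intros assms)
  then have "closed A" unfolding A_def
    by (intro continuous_on_closed_Collect_le continuous_on_const) auto
  moreover have A: "a \<in> A" "bdd_above A" using assms(1) by (auto simp: A_def \<phi>_def intro: bdd_aboveI[of _ b])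
  ultimately have m: "Sup A \<in> A" by (intro closed_contains_Sup) auto
  then have "a \<le> Sup A" "Sup A < b" "0 \<le> \<phi> (Sup A)" using neg by (auto simp: A_def \<phi>_def order_less_le)
  from sl[OF this(1,2)] obtain d where d: "d > 0"
    "\<And>h. 0 < h \<Longrightarrow> h < d \<Longrightarrow> \<kappa> * h \<le> g (Sup A + h) - g (Sup A)"
    unfolding eventually_at_right_field by auto
  define h where "h = min d (b - Sup A) / 2"
  have h: "0 < h" "h < d" "Sup A + h \<le> b" using d(1) \<open>Sup A < b\<close> unfolding h_def by (auto simp: min_def field_simps)
  have "0 \<le> \<phi> (Sup A + h)" using d(2)[OF h(1,2)] \<open>0 \<le> \<phi> (Sup A)\<close>
    unfolding \<phi>_def by (simp add: algebra_simps)
  then have "Sup A + h \<in> A" using h \<open>a \<le> Sup A\<close> unfolding A_def by simp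
  then show False using cSup_upper[OF _ A(2)] h(1) by fastforce
qed

text \<open>The coordinates have one-sided differences of constant sign, so the sum of their absolute
  values is the increment of one function \<open>g\<close>, continuous and convergent at \<open>0\<close>. Slope at least \<open>1 / (C * t)\<close> would
  give \<open>g\<close> an increment of at least \<open>1 / (2 * C)\<close> over each interval from \<open>t\<close> to \<open>2 * t\<close>.\<close>

lemma sa_curve_not_steep:
  fixes X :: "'i::finite \<Rightarrow> real \<Rightarrow> real"
  assumes X: "\<And>i. sa_fun (X i)" and bd: "\<forall>\<^sub>F t in at_right 0. \<forall>i. \<bar>X i t\<bar> \<le> R"
    and \<sigma>: "\<sigma> = 1 \<or> \<sigma> = -1"
    and steep: "\<forall>\<^sub>F t in at_right 0. \<forall>\<^sub>F h in at_right 0. h \<le> C * t * (\<Sum>i\<in>UNIV. \<bar>X i (t + \<sigma> * h) - X i t\<bar>)"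
  shows False
proof -
  have "\<forall>i. \<exists>s. \<forall>\<^sub>F t in at_right 0. \<forall>\<^sub>F h in at_right 0. sgn (X i (t + \<sigma> * h) - X i t) = s"
    using sa_fun_side_sign[OF X] by blast
  from choice[OF this] obtain s
    where s: "\<And>i. \<forall>\<^sub>F t in at_right 0. \<forall>\<^sub>F h in at_right 0. sgn (X i (t + \<sigma> * h) - X i t) = s i"
    by blast
  have "\<forall>i. \<exists>l. (X i \<longlongrightarrow> l) (at_right 0)"
  proof
    fix i
    have "\<forall>\<^sub>F t in at_right 0. \<bar>X i t\<bar> \<le> R" using bd by (auto elim: eventually_mono)
    from sa_fun_bounded_limit[OF X this] show "\<exists>l. (X i \<longlongrightarrow> l) (at_right 0)" .
  qed
  from choice[OF this] obtain l where l: "\<And>i. (X i \<longlongrightarrow> l i) (at_right 0)" by blast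
  define g where "g t = (\<Sum>i\<in>UNIV. s i * X i t)" for t
  define K where "K = max C 1"
  have K: "K > 0" "C \<le> K" unfolding K_def by auto
  have "(g \<longlongrightarrow> (\<Sum>i\<in>UNIV. s i * l i)) (at_right 0)" unfolding g_def by (intro tendsto_intros l)
  note gl = this
  have "filterlim (\<lambda>t::real. 2 * t) (at_right 0) (at_right 0)"
    unfolding filterlim_at by (auto intro!: tendsto_eq_intros simp: eventually_at_right_field intro: exI[of _ 1])
  from filterlim_compose[OF gl this] gl
  have "((\<lambda>t. g (2 * t) - g t) \<longlongrightarrow> 0) (at_right 0)" by (auto intro: tendsto_eq_intros)
  then have small: "\<forall>\<^sub>F t in at_right 0. \<bar>g (2 * t) - g t\<bar> < 1 / (2 * K)"
    using K(1) by (auto dest!: tendstoD[where e = "1 / (2 * K)"] simp: dist_real_def)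
  have "\<forall>\<^sub>F t in at_right 0. isCont g t \<and> (\<forall>\<^sub>F h in at_right 0. h \<le> K * t * (g (t + \<sigma> * h) - g t))"
  proof -
    have "\<forall>\<^sub>F t in at_right 0. \<forall>i. isCont (X i) t"
      using sa_fun_eventually_isCont[OF X] by (rule eventually_all_finite)
    moreover have "\<forall>\<^sub>F t in at_right 0. \<forall>i. \<forall>\<^sub>F h in at_right 0. sgn (X i (t + \<sigma> * h) - X i t) = s i"
      using s by (rule eventually_all_finite)
    moreover have "\<forall>\<^sub>F t in at_right (0::real). t > 0" by (simp add: eventually_at_right_less)
    ultimately show ?thesis using steep
    proof eventually_elim
      case (elim t)
      have "\<forall>\<^sub>F h in at_right 0. \<forall>i. sgn (X i (t + \<sigma> * h) - X i t) = s i"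
        using elim(2) by (intro eventually_all_finite) blast
      with elim(4) have "\<forall>\<^sub>F h in at_right 0. h \<le> K * t * (g (t + \<sigma> * h) - g t)"
      proof eventually_elim
        case (elim h)
        have "g (t + \<sigma> * h) - g t = (\<Sum>i\<in>UNIV. s i * (X i (t + \<sigma> * h) - X i t))"
          unfolding g_def by (simp add: sum_subtractf right_diff_distrib)
        also have "\<dots> = (\<Sum>i\<in>UNIV. \<bar>X i (t + \<sigma> * h) - X i t\<bar>)"
          using elim(2) by (intro sum.cong refl) (metis abs_sgn mult.commute)
        finally have eq: "g (t + \<sigma> * h) - g t = (\<Sum>i\<in>UNIV. \<bar>X i (t + \<sigma> * h) - X i t\<bar>)" .
        have "h \<le> C * t * (g (t + \<sigma> * h) - g t)" using elim(1) eq by simp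
        also have "\<dots> \<le> K * t * (g (t + \<sigma> * h) - g t)"
          using K(2) \<open>t > 0\<close> unfolding eq by (intro mult_right_mono sum_nonneg) auto
        finally show ?case .
      qed
      moreover have "isCont g t" unfolding g_def using elim(1) by (intro continuous_intros) auto
      ultimately show ?case by blast
    qed
  qed
  then obtain d where d: "d > 0"
    "\<And>t. 0 < t \<Longrightarrow> t < d \<Longrightarrow> isCont g t \<and> (\<forall>\<^sub>F h in at_right 0. h \<le> K * t * (g (t + \<sigma> * h) - g t))"
    unfolding eventually_at_right_field by auto
  have "\<forall>\<^sub>F t in at_right 0. t > 0 \<and> 2 * t < d"
    unfolding eventually_at_right_field using d(1) by (intro exI[of _ "d / 2"]) auto
  with small have "\<forall>\<^sub>F t in at_right (0::real). False"
  proof eventually_elim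
    case (elim t0)
    define \<kappa> where "\<kappa> = 1 / (2 * K * t0)"
    have t0: "t0 > 0" "2 * t0 < d" using elim by auto
    have slope: "\<forall>\<^sub>F h in at_right 0. \<kappa> * h \<le> g (t + \<sigma> * h) - g t" if t: "t0 \<le> t" "t \<le> 2 * t0" for t
    proof -
      have "\<forall>\<^sub>F h in at_right 0. h \<le> K * t * (g (t + \<sigma> * h) - g t)" using d(2)[of t] t t0 by auto
      moreover have "\<forall>\<^sub>F h in at_right (0::real). h > 0" by (simp add: eventually_at_right_less)
      ultimately show ?thesis
      proof eventually_elim
        case (elim h)
        then have "0 < g (t + \<sigma> * h) - g t" using K(1) t t0
          by (smt (verit) mult_nonneg_nonpos mult_nonneg_nonneg)
        then have "K * t * (g (t + \<sigma> * h) - g t) \<le> K * (2 * t0) * (g (t + \<sigma> * h) - g t)"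
          using K(1) t by (intro mult_right_mono mult_left_mono) auto
        with elim have "h \<le> (2 * K * t0) * (g (t + \<sigma> * h) - g t)" by (simp add: mult_ac)
        then show ?case using K(1) t0 unfolding \<kappa>_def by (simp add: pos_divide_le_eq mult.commute)
      qed
    qed
    have cont: "continuous_on {t0..2 * t0} g"
      using d(2) t0 by (intro continuous_at_imp_continuous_on) auto
    have \<kappa>: "\<kappa> * t0 = 1 / (2 * K)" unfolding \<kappa>_def using t0 by simp
    from \<sigma> show False
    proof
      assume 1: "\<sigma> = 1"
      have "\<kappa> * (2 * t0 - t0) \<le> g (2 * t0) - g t0"
        using t0 slope unfolding 1 by (intro growth_from_one_sided_slope cont) auto
      then show False using elim(1) \<kappa> by (simp add: abs_if split: if_splits)
    next
      assume 1: "\<sigma> = -1"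
      have "\<kappa> * (- t0 - (- (2 * t0))) \<le> g (- (- t0)) - g (- (- (2 * t0)))"
      proof (rule growth_from_one_sided_slope[where g = "\<lambda>t. g (- t)"])
        show "continuous_on {- (2 * t0)..- t0} (\<lambda>t. g (- t))"
          by (rule continuous_on_compose2[OF cont]) (auto intro!: continuous_intros)
        fix t assume "- (2 * t0) \<le> t" "t < - t0"
        then show "\<forall>\<^sub>F h in at_right 0. \<kappa> * h \<le> g (- (t + h)) - g (- t)" using slope[of "- t"] unfolding 1 by simp
      qed (use t0 in auto)
      then show False using elim(1) \<kappa> by (simp add: abs_if split: if_splits)
    qed
  qed
  then show False by simp
qed

section \<open>Semialgebraic functions on Euclidean space\<close>

definition coord_index :: "'n::finite \<Rightarrow> nat" where
  "coord_index = (SOME f. bij_betw f UNIV {0..<CARD('n)})"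

lemma coord_index: "bij_betw (coord_index :: 'n::finite \<Rightarrow> nat) UNIV {0..<CARD('n)}"
proof -
  have "\<exists>f :: 'n \<Rightarrow> nat. bij_betw f UNIV {0..<CARD('n)}"
    by (rule ex_bij_betw_finite_nat) simp
  then show ?thesis unfolding coord_index_def by (rule someI_ex[of "\<lambda>f. bij_betw f UNIV {0..<CARD('n)}"])
qed

lemma coord_index_less: "coord_index (i :: 'n::finite) < CARD('n)"
  using coord_index[where 'n = 'n] by (auto simp: bij_betw_def)

lemma coord_index_cases: "j < CARD('n) \<Longrightarrow> \<exists>i::'n::finite. j = coord_index i"
  using coord_index[where 'n = 'n] by (auto simp: bij_betw_def image_iff set_eq_iff)

definition vec_of :: "nat \<Rightarrow> (nat \<Rightarrow> real) \<Rightarrow> real ^ 'n" where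
  "vec_of b e = (\<chi> i. e (b + coord_index i))"

lemma vec_of_surj: "\<exists>w. x = vec_of 0 w"
proof
  show "x = vec_of 0 (\<lambda>j. x $ inv coord_index j)"
    using coord_index[where 'n = 'a] by (simp add: vec_of_def vec_eq_iff bij_betw_def)
qed

lemma sa_ex_vec:
  fixes \<Phi> :: "(nat \<Rightarrow> real) \<Rightarrow> real ^ 'n \<Rightarrow> bool"
  assumes "sa (\<lambda>e. \<Phi> (\<lambda>j. e (j + CARD('n))) (vec_of 0 e))"
  shows "sa (\<lambda>e. \<exists>x. \<Phi> e x)"
proof -
  have "vec_of 0 (\<lambda>j. if j < CARD('n) then w j else e (j - CARD('n))) = (vec_of 0 w :: real ^ 'n)"
    for w e :: "nat \<Rightarrow> real"
    by (simp add: vec_of_def coord_index_less)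
  then have "sa (\<lambda>e. \<exists>w. \<Phi> e (vec_of 0 w))" using sa_exN[OF assms, of "CARD('n)"] by simp
  moreover have "(\<exists>w. \<Phi> e (vec_of 0 w)) \<longleftrightarrow> (\<exists>x. \<Phi> e x)" for e by (metis vec_of_surj)
  ultimately show ?thesis by simp
qed

lemma sa_all_vec:
  fixes \<Phi> :: "(nat \<Rightarrow> real) \<Rightarrow> real ^ 'n \<Rightarrow> bool"
  assumes "sa (\<lambda>e. \<Phi> (\<lambda>j. e (j + CARD('n))) (vec_of 0 e))"
  shows "sa (\<lambda>e. \<forall>x. \<Phi> e x)"
  using sa_not[OF sa_ex_vec[OF sa_not[OF assms]]] by simp

lemma sa_choice_vec:
  fixes \<Phi> :: "real \<Rightarrow> real ^ 'n \<Rightarrow> bool"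
  assumes sa: "sa (\<lambda>e. \<Phi> (e 0) (vec_of 1 e))" and bd: "\<And>t x. \<Phi> t x \<Longrightarrow> norm x \<le> R"
  obtains X where "\<And>i. sa_fun (\<lambda>t. X t $ i)" "\<And>t x. \<Phi> t x \<Longrightarrow> \<Phi> t (X t)"
proof -
  have vec: "vec_of 1 (case_nat t (\<lambda>j. if j < CARD('n) then w j else 0)) = (vec_of 0 w :: real ^ 'n)"
    for w t by (simp add: vec_of_def coord_index_less)
  have le: "\<bar>e (Suc j)\<bar> \<le> R" if e: "\<Phi> (e 0) (vec_of 1 e)" and j: "j < CARD('n)" for e j
  proof -
    obtain i :: 'n where i: "j = coord_index i" using coord_index_cases j by blast
    have "\<bar>(vec_of 1 e :: real ^ 'n) $ i\<bar> \<le> R" using component_le_norm_cart bd[OF e] order_trans by blast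
    then show ?thesis unfolding i by (simp add: vec_of_def)
  qed
  have "\<exists>X. (\<forall>j. sa_fun (X j)) \<and>
      (\<forall>t. (\<exists>w. \<Phi> (case_nat t (\<lambda>j. if j < CARD('n) then w j else 0) 0)
          (vec_of 1 (case_nat t (\<lambda>j. if j < CARD('n) then w j else 0)))) \<longrightarrow>
        \<Phi> (case_nat t (\<lambda>j. if j < CARD('n) then X j t else 0) 0)
          (vec_of 1 (case_nat t (\<lambda>j. if j < CARD('n) then X j t else 0))))"
    using sa le by (intro sa_choiceN[where \<phi> = "\<lambda>e. \<Phi> (e 0) (vec_of 1 e)"])
  then have "\<exists>X. (\<forall>j. sa_fun (X j)) \<and>
      (\<forall>t. (\<exists>w. \<Phi> t (vec_of 0 w)) \<longrightarrow> \<Phi> t (vec_of 0 (\<lambda>j. X j t)))"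
    by (simp only: vec nat.case)
  then obtain X where X: "\<forall>j. sa_fun (X j)"
    "\<And>t w. \<Phi> t (vec_of 0 w) \<Longrightarrow> \<Phi> t (vec_of 0 (\<lambda>j. X j t))" by blast
  show ?thesis
  proof (rule that[of "\<lambda>t. vec_of 0 (\<lambda>j. X j t)"])
    show "sa_fun (\<lambda>t. (vec_of 0 (\<lambda>j. X j t) :: real ^ 'n) $ i)" for i
      using X(1) by (simp add: vec_of_def)
    show "\<Phi> t (vec_of 0 (\<lambda>j. X j t))" if "\<Phi> t x" for t x using X(2) that vec_of_surj by metis
  qed
qed

definition polyvec :: "((nat \<Rightarrow> real) \<Rightarrow> real ^ 'n) \<Rightarrow> bool" where
  "polyvec V \<longleftrightarrow> (\<forall>i. polyfun (\<lambda>e. V e $ i))"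

lemma polyvec_vec_of: "polyvec (vec_of b)"
  unfolding polyvec_def vec_of_def by (simp add: polyfun.var)

lemma polyvec_diff: "polyvec V \<Longrightarrow> polyvec W \<Longrightarrow> polyvec (\<lambda>e. V e - W e)"
  unfolding polyvec_def by (simp add: polyfun_diff)

lemma polyvec_subst: "polyvec V \<Longrightarrow> (\<And>j. polyfun (\<lambda>e. \<sigma> e j)) \<Longrightarrow> polyvec (\<lambda>e. V (\<sigma> e))"
  unfolding polyvec_def using polyfun_subst by blast

lemma sa_norm_eq:
  assumes "polyvec V" "polyfun p"
  shows "sa (\<lambda>e. p e = norm (V e))"
proof -
  have "p e = norm (V e) \<longleftrightarrow> 0 \<le> p e \<and> p e ^ 2 = (\<Sum>i\<in>UNIV. (V e $ i) ^ 2)" for e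
    unfolding norm_vec_def L2_set_def
    by (auto simp: sum_nonneg real_sqrt_unique)
  moreover have "sa (\<lambda>e. 0 \<le> p e \<and> p e ^ 2 = (\<Sum>i\<in>UNIV. (V e $ i) ^ 2))"
    using assms unfolding polyvec_def
    by (intro sa_conj sa_le sa_eq polyfun_sum polyfun_power polyfun.const) auto
  ultimately show ?thesis by simp
qed

lemma sa_norm_le:
  assumes "polyvec V"
  shows "sa (\<lambda>e. norm (V e) \<le> R)"
proof -
  have "sa (\<lambda>e. \<exists>n. n = norm (V e) \<and> n \<le> R)"
    by (intro sa_ex sa_conj sa_norm_eq sa_le polyfun.intros polyvec_subst[OF assms])
  then show ?thesis by simp
qed

lemma polyfun_real_polynomial_function:
  fixes g :: "(real ^ 'n) \<times> real \<Rightarrow> real"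
  assumes "real_polynomial_function g" "polyvec V" "polyfun p"
  shows "polyfun (\<lambda>e. g (V e, p e))"
  using assms(1)
proof induction
  case (linear f)
  then have lf: "linear f" by (rule bounded_linear.linear)
  have "f (V e, p e) = (\<Sum>i\<in>UNIV. V e $ i * f (axis i 1, 0)) + p e * f (0, 1)" for e
  proof -
    have "(V e, p e) = (\<Sum>i\<in>UNIV. V e $ i *\<^sub>R (axis i 1, 0)) + p e *\<^sub>R (0, 1)"
      by (simp add: prod_eq_iff fst_sum snd_sum basis_expansion flip: scalar_mult_eq_scaleR)
    then have "f (V e, p e) = f ((\<Sum>i\<in>UNIV. V e $ i *\<^sub>R (axis i 1, 0)) + p e *\<^sub>R (0, 1))" by simp
    then show ?thesis by (simp add: linear_add[OF lf] linear_sum[OF lf] linear_cmul[OF lf] del: scaleR_Pair)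
  qed
  moreover have "polyfun (\<lambda>e. (\<Sum>i\<in>UNIV. V e $ i * f (axis i 1, 0)) + p e * f (0, 1))"
    using assms(2,3) unfolding polyvec_def by (auto intro!: polyfun.intros polyfun_sum)
  ultimately show ?case by simp
qed (auto intro: polyfun.intros)

lemma sa_Inter: "finite I \<Longrightarrow> (\<And>i. i \<in> I \<Longrightarrow> sa (\<phi> i)) \<Longrightarrow> sa (\<lambda>e. \<forall>i\<in>I. \<phi> i e)"
  by (induction I rule: finite_induct) (auto intro: sa_const sa_conj)

lemma sa_Union: "finite I \<Longrightarrow> (\<And>i. i \<in> I \<Longrightarrow> sa (\<phi> i)) \<Longrightarrow> sa (\<lambda>e. \<exists>i\<in>I. \<phi> i e)"
  by (induction I rule: finite_induct) (auto intro: sa_const sa_disj)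

text \<open>Links the definition of semialgebraic functions by their graphs to predicates on assignments.\<close>

lemma sa_value:
  fixes F :: "real ^ 'n \<Rightarrow> ereal"
  assumes F: "semialgebraic_function F" and V: "polyvec V" and p: "polyfun p"
  shows "sa (\<lambda>e. F (V e) = ereal (p e))"
proof -
  obtain \<U> where U: "finite \<U>" "{(u, t :: real). F u = ereal t} = \<Union>\<U>"
    "\<forall>C\<in>\<U>. \<exists>P. finite P \<and> (\<forall>(g, h)\<in>P. real_polynomial_function g \<and> real_polynomial_function h) \<and>
           C = (\<Inter>(g, h)\<in>P. {u. g u = 0 \<and> h u < 0})"
    using F unfolding semialgebraic_function_def semialgebraic_def by iprover
  have "sa (\<lambda>e. \<exists>C\<in>\<U>. (V e, p e) \<in> C)"
  proof (intro sa_Union U(1))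
    fix C assume "C \<in> \<U>"
    then obtain P where P: "finite P"
      "\<forall>(g, h)\<in>P. real_polynomial_function g \<and> real_polynomial_function h"
      "C = (\<Inter>(g, h)\<in>P. {u. g u = 0 \<and> h u < 0})" using bspec[OF U(3)] by iprover
    have "sa (\<lambda>e. \<forall>q\<in>P. fst q (V e, p e) = 0 \<and> snd q (V e, p e) < 0)"
      using P(2) by (intro sa_Inter P(1) sa_conj sa_eq sa_less polyfun.const
          polyfun_real_polynomial_function V p) auto
    moreover have "(V e, p e) \<in> C \<longleftrightarrow> (\<forall>q\<in>P. fst q (V e, p e) = 0 \<and> snd q (V e, p e) < 0)" for e
      unfolding P(3) by (auto simp: split_def)
    ultimately show "sa (\<lambda>e. (V e, p e) \<in> C)" by simp
  qed
  moreover have "F (V e) = ereal (p e) \<longleftrightarrow> (\<exists>C\<in>\<U>. (V e, p e) \<in> C)" for e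
    using U(2) by (auto simp: set_eq_iff)
  ultimately show ?thesis by simp
qed

text \<open>The strong slope at \<open>x\<close>, where the value is \<open>s\<close>, is at most \<open>l\<close>. Unlike
  subgradients, this needs no vector besides \<open>x\<close> and \<open>y\<close>, and it is directly a first-order condition. Points of infinite value
  impose nothing, hence the real number \<open>r\<close> in place of \<open>F y\<close>.\<close>

definition slope_at_most :: "('a::real_normed_vector \<Rightarrow> ereal) \<Rightarrow> 'a \<Rightarrow> real \<Rightarrow> real \<Rightarrow> bool" where
  "slope_at_most F x s l \<longleftrightarrow>
     (\<exists>\<delta>>0. \<forall>y r. norm (y - x) < \<delta> \<longrightarrow> F y = ereal r \<longrightarrow> s - l * norm (y - x) \<le> r)"

lemma sa_slope_at_most:
  fixes F :: "real ^ 'n \<Rightarrow> ereal"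
  assumes F: "semialgebraic_function F" and V: "polyvec V" and p: "polyfun p" and q: "polyfun q"
  shows "sa (\<lambda>e. slope_at_most F (V e) (p e) (q e))"
proof -
  have "sa (\<lambda>e. \<exists>\<delta>. \<delta> > 0 \<and> (\<forall>y. \<forall>r n. n = norm (y - V e) \<longrightarrow> n < \<delta> \<longrightarrow> F y = ereal r \<longrightarrow> p e - q e * n \<le> r))"
    by (intro sa_ex sa_conj sa_all sa_all_vec sa_imp sa_less sa_le sa_norm_eq sa_value[OF F] polyfun.intros
        polyfun_diff polyvec_diff polyvec_vec_of polyvec_subst[OF V] polyvec_subst[OF polyvec_vec_of] polyfun_subst[OF p] polyfun_subst[OF q])
  then show ?thesis unfolding slope_at_most_def by simp
qed

section \<open>The Lojasiewicz inequality\<close>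

text \<open>Suppose the level \<open>v t\<close> contains a point of slope at most \<open>w t\<close>, for all small \<open>t\<close>. Such points can be chosen along a
  semialgebraic curve, and the slope condition at \<open>t\<close>, tested at nearby points of the curve, bounds the change of \<open>v\<close> by \<open>w t\<close> times
  the displacement. If \<open>v\<close> drops at a rate of at least \<open>\<kappa> * w t / t\<close>, the curve is too steep. The direction \<open>\<sigma>\<close> is the one
  in which \<open>v\<close> decreases.\<close>

lemma eventually_no_flat_point:
  fixes F :: "real ^ 'n \<Rightarrow> ereal"
  assumes F: "semialgebraic_function F" and v: "sa_fun v" and w: "sa_fun w" and \<sigma>: "\<sigma> = 1 \<or> \<sigma> = -1"
    and \<kappa>: "\<kappa> > 0" and wpos: "\<forall>\<^sub>F t in at_right 0. w t > 0"
    and drop: "\<forall>\<^sub>F t in at_right 0. \<forall>\<^sub>F h in at_right 0. \<kappa> * h * w t \<le> t * (v t - v (t + \<sigma> * h))"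
  shows "\<forall>\<^sub>F t in at_right 0. \<not> (\<exists>x. norm x \<le> R \<and> F x = ereal (v t) \<and> slope_at_most F x (v t) (w t))"
proof (rule ccontr)
  define \<Phi> where "\<Phi> t x \<longleftrightarrow> norm x \<le> R \<and> F x = ereal (v t) \<and> slope_at_most F x (v t) (w t)" for t x
  have sa\<Phi>: "sa (\<lambda>e. \<Phi> (p e) (V e))" if "polyfun p" "polyvec V" for p V
  proof -
    have "sa (\<lambda>e. \<exists>s l. s = v (p e) \<and> l = w (p e) \<and> norm (V e) \<le> R \<and> F (V e) = ereal s \<and> slope_at_most F (V e) s l)"
      by (intro sa_ex sa_conj sa_graph[OF v] sa_graph[OF w] sa_norm_le sa_value[OF F] sa_slope_at_most[OF F]
          polyfun.intros polyvec_subst[OF that(2)] polyfun_subst[OF that(1)])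
    then show ?thesis unfolding \<Phi>_def by simp
  qed
  assume neg: "\<not> ?thesis"
  have "sa (\<lambda>e. \<exists>x. \<Phi> (e 0) x)"
    by (intro sa_ex_vec sa\<Phi> polyfun.intros polyvec_vec_of)
  from sa_dichotomy[OF this] neg have ex: "\<forall>\<^sub>F t in at_right 0. \<exists>x. \<Phi> t x" unfolding \<Phi>_def by blast
  have "sa (\<lambda>e. \<Phi> (e 0) (vec_of 1 e))" by (intro sa\<Phi> polyfun.intros polyvec_vec_of)
  moreover have "norm x \<le> R" if "\<Phi> t x" for t x using that unfolding \<Phi>_def by blast
  ultimately obtain X where X: "\<And>i. sa_fun (\<lambda>t. X t $ i)" "\<And>t x. \<Phi> t x \<Longrightarrow> \<Phi> t (X t)"
    using sa_choice_vec[of \<Phi> R] by blast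
  from ex obtain d where d: "d > 0" "\<And>t. 0 < t \<Longrightarrow> t < d \<Longrightarrow> \<Phi> t (X t)"
    unfolding eventually_at_right_field using X(2) by blast
  have td: "\<forall>\<^sub>F t in at_right 0. 0 < t \<and> t < d"
    unfolding eventually_at_right_field using d(1) by auto
  have "\<forall>\<^sub>F t in at_right 0. \<forall>i. \<bar>X t $ i\<bar> \<le> R"
    using td
  proof eventually_elim
    case (elim t)
    then have "norm (X t) \<le> R" using d(2) unfolding \<Phi>_def by blast
    then show ?case using component_le_norm_cart order_trans by blast
  qed
  moreover have "\<forall>\<^sub>F t in at_right 0. \<forall>\<^sub>F h in at_right 0.
      h \<le> (1 / \<kappa>) * t * (\<Sum>i\<in>UNIV. \<bar>X (t + \<sigma> * h) $ i - X t $ i\<bar>)"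
  proof -
    have "\<forall>\<^sub>F t in at_right 0. \<forall>i. isCont (\<lambda>t. X t $ i) t"
      using sa_fun_eventually_isCont[OF X(1)] by (rule eventually_all_finite)
    from this td wpos drop show ?thesis
    proof eventually_elim
      case (elim t)
      then have \<Phi>t: "\<Phi> t (X t)" and t: "0 < t" "t < d" using d(2) by auto
      then obtain \<delta> where \<delta>: "\<delta> > 0"
        "\<And>y r. norm (y - X t) < \<delta> \<Longrightarrow> F y = ereal r \<Longrightarrow> v t - w t * norm (y - X t) \<le> r"
        unfolding \<Phi>_def slope_at_most_def by blast
      have lim: "((\<lambda>h. t + \<sigma> * h) \<longlongrightarrow> t) (at_right 0)" by (auto intro!: tendsto_eq_intros)
      have "((\<lambda>h. X (t + \<sigma> * h)) \<longlongrightarrow> X t) (at_right 0)"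
        by (rule vec_tendstoI) (rule isCont_tendsto_compose[OF spec[OF elim(1)] lim])
      then have "\<forall>\<^sub>F h in at_right 0. norm (X (t + \<sigma> * h) - X t) < \<delta>"
        using \<delta>(1) by (auto dest!: tendstoD simp: dist_norm)
      moreover have "\<forall>\<^sub>F h in at_right 0. 0 < t + \<sigma> * h \<and> t + \<sigma> * h < d"
        using order_tendstoD[OF lim] t by (simp add: eventually_conj)
      ultimately show ?case using elim(4)
      proof eventually_elim
        case (elim h)
        define n where "n = norm (X (t + \<sigma> * h) - X t)"
        have "F (X (t + \<sigma> * h)) = ereal (v (t + \<sigma> * h))" using d(2) elim(2) unfolding \<Phi>_def by blast
        then have "v t - w t * n \<le> v (t + \<sigma> * h)" using \<delta>(2) elim(1) unfolding n_def by blast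
        then have "t * (v t - v (t + \<sigma> * h)) \<le> t * (w t * n)" using t(1) by (intro mult_left_mono) auto
        then have "(\<kappa> * h) * w t \<le> (t * n) * w t" using elim(3) by (simp add: mult_ac)
        then have "\<kappa> * h \<le> t * n" using \<open>w t > 0\<close> by simp
        also have "\<dots> \<le> t * (\<Sum>i\<in>UNIV. \<bar>X (t + \<sigma> * h) $ i - X t $ i\<bar>)"
          using norm_le_l1_cart[of "X (t + \<sigma> * h) - X t"] t(1) unfolding n_def by (intro mult_left_mono) auto
        finally show ?case using \<kappa> by (simp add: field_simps)
      qed
    qed
  qed
  ultimately show False 
    by (rule sa_curve_not_steep[where X = "\<lambda>i t. X t $ i", OF X(1) _ \<sigma>])
qed

text \<open>Polynomials in \<open>t\<close> with coefficients in \<open>k\<close>: the lowest coefficient in \<open>t\<close> will dominate.\<close>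

lemma polyfun_as_bivariate:
  assumes "polyfun p"
  shows "\<exists>P. \<forall>t k. p ((\<lambda>_. 0)(0 := t, 1 := k)) = poly (poly P [:t:]) k"
  using assms
proof induction
  case (const c)
  show ?case by (intro exI[of _ "[:[:c:]:]"]) simp
next
  case (var i)
  consider "i = 0" | "i = 1" | "i \<noteq> 0" "i \<noteq> 1" by blast
  then show ?case
  proof cases
    case 1
    then show ?thesis by (intro exI[of _ "[:0, 1:]"]) simp
  next
    case 2
    then show ?thesis by (intro exI[of _ "[:[:0, 1:]:]"]) simp
  next
    case 3
    then show ?thesis by (intro exI[of _ 0]) simp
  qed
next
  case (add f g)
  then obtain P Q where "\<forall>t k. f ((\<lambda>_. 0)(0 := t, 1 := k)) = poly (poly P [:t:]) k"
    "\<forall>t k. g ((\<lambda>_. 0)(0 := t, 1 := k)) = poly (poly Q [:t:]) k" by blast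
  then show ?case by (intro exI[of _ "P + Q"]) (simp del: fun_upd_apply)
next
  case (mult f g)
  then obtain P Q where "\<forall>t k. f ((\<lambda>_. 0)(0 := t, 1 := k)) = poly (poly P [:t:]) k"
    "\<forall>t k. g ((\<lambda>_. 0)(0 := t, 1 := k)) = poly (poly Q [:t:]) k" by blast
  then show ?case by (intro exI[of _ "P * Q"]) (simp del: fun_upd_apply)
qed

lemma bivariate_bounded:
  fixes P :: "real poly poly"
  obtains B where "B > 0" "\<And>t k. 0 \<le> t \<Longrightarrow> t \<le> 1 \<Longrightarrow> 0 \<le> k \<Longrightarrow> k \<le> 1 \<Longrightarrow> \<bar>poly (poly P [:t:]) k\<bar> \<le> B"
proof -
  have "\<exists>B>0. \<forall>t k. 0 \<le> t \<longrightarrow> t \<le> 1 \<longrightarrow> 0 \<le> k \<longrightarrow> k \<le> 1 \<longrightarrow> \<bar>poly (poly P [:t:]) k\<bar> \<le> B"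
  proof (induction P)
    case 0
    show ?case by (intro exI[of _ 1]) simp
  next
    case (pCons b P)
    then obtain B where B: "B > 0" "\<And>t k. 0 \<le> t \<Longrightarrow> t \<le> 1 \<Longrightarrow> 0 \<le> k \<Longrightarrow> k \<le> 1 \<Longrightarrow> \<bar>poly (poly P [:t:]) k\<bar> \<le> B"
      by blast
    have "compact (poly b ` {0..1})" by (intro compact_continuous_image continuous_intros compact_Icc)
    then obtain B' where B': "B' > 0" "\<And>k. 0 \<le> k \<Longrightarrow> k \<le> 1 \<Longrightarrow> \<bar>poly b k\<bar> \<le> B'"
      using compact_imp_bounded bounded_pos by (force simp: bounded_pos)
    have "\<bar>poly (poly (pCons b P) [:t:]) k\<bar> \<le> B' + B" if "0 \<le> t" "t \<le> 1" "0 \<le> k" "k \<le> 1" for t k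
    proof -
      have "\<bar>t * poly (poly P [:t:]) k\<bar> \<le> 1 * B"
        unfolding abs_mult using that B by (intro mult_mono) auto
      then show ?thesis using B'(2)[of k] that by simp
    qed
    then show ?case using B(1) B'(1) by (intro exI[of _ "B' + B"]) auto
  qed
  then show ?thesis using that by blast
qed

text \<open>After division by a power of \<open>t\<close>, a nonzero polynomial is \<open>b k + t * P\<close> with \<open>b\<close> nonzero. If \<open>b\<close> vanishes to order
  \<open>j\<close> at \<open>0\<close>, then \<open>b k\<close> is comparable to \<open>k ^ j\<close> and, for small \<open>k\<close>, dominates the rest as soon as \<open>t \<le> k ^ (j + 1)\<close>.\<close>

lemma bivariate_corner_sign:
  fixes P :: "real poly poly"
  shows "\<exists>m \<kappa> s. 0 < \<kappa> \<and> (\<forall>k t. 0 < k \<longrightarrow> k < \<kappa> \<longrightarrow> 0 < t \<longrightarrow> t \<le> k ^ m \<longrightarrow> sgn (poly (poly P [:t:]) k) = s)"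
proof (induction P)
  case 0
  show ?case by (intro exI[of _ 0] exI[of _ 1]) simp
next
  case (pCons b P)
  show ?case
  proof (cases "b = 0")
    case True
    then show ?thesis using pCons.IH by (simp add: sgn_mult)
  next
    case False
    obtain c where c: "b = [:0, 1:] ^ order 0 b * c" "\<not> [:0, 1:] dvd c"
      using order_decomp[OF False, of 0] by auto
    define j where "j = order 0 b"
    define c0 where "c0 = poly c 0"
    have c0: "c0 \<noteq> 0" using c(2) poly_eq_0_iff_dvd[of c 0] unfolding c0_def by simp
    have "(poly c \<longlongrightarrow> c0) (at_right 0)" unfolding c0_def by (auto intro!: tendsto_eq_intros)
    then have "\<forall>\<^sub>F k in at_right 0. \<bar>poly c k - c0\<bar> < \<bar>c0\<bar> / 2"
      using c0 by (auto dest!: tendstoD[where e = "\<bar>c0\<bar> / 2"] simp: dist_real_def)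
    then obtain k1 where k1: "k1 > 0" "\<And>k. 0 < k \<Longrightarrow> k < k1 \<Longrightarrow> \<bar>poly c k - c0\<bar> < \<bar>c0\<bar> / 2"
      unfolding eventually_at_right_field by blast
    obtain B where B: "B > 0" "\<And>t k. 0 \<le> t \<Longrightarrow> t \<le> 1 \<Longrightarrow> 0 \<le> k \<Longrightarrow> k \<le> 1 \<Longrightarrow> \<bar>poly (poly P [:t:]) k\<bar> \<le> B"
      using bivariate_bounded[of P] by blast
    define \<kappa> where "\<kappa> = min k1 (min 1 (\<bar>c0\<bar> / (2 * B)))"
    have "sgn (poly (poly (pCons b P) [:t:]) k) = sgn c0"
      if k: "0 < k" "k < \<kappa>" "0 < t" "t \<le> k ^ Suc j" for k t
    proof -
      have k': "k < k1" "k < 1" "k * B < \<bar>c0\<bar> / 2" using k(2) B(1) unfolding \<kappa>_def by (auto simp: field_simps)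
      have "t \<le> 1" using k k'(2) power_le_one[of k "Suc j"] by linarith
      have "\<bar>t * poly (poly P [:t:]) k\<bar> \<le> k ^ Suc j * B"
        unfolding abs_mult using B k k' \<open>t \<le> 1\<close> by (intro mult_mono) auto
      also have "\<dots> = k ^ j * (k * B)" by simp
      also have "\<dots> < k ^ j * (\<bar>c0\<bar> / 2)" using k k' by (intro mult_strict_left_mono) auto
      finally have 1: "\<bar>t * poly (poly P [:t:]) k\<bar> < k ^ j * (\<bar>c0\<bar> / 2)" .
      have v: "poly (poly (pCons b P) [:t:]) k = k ^ j * poly c k + t * poly (poly P [:t:]) k"
        using arg_cong[OF c(1), of "\<lambda>p. poly p k"] unfolding j_def by (simp add: mult.commute)
      have kj: "k ^ j > 0" using k by simp
      consider "c0 > 0" | "c0 < 0" using c0 by linarith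
      then show ?thesis
      proof cases
        case 1
        then have "poly c k > c0 / 2" using k1(2)[OF k(1) k'(1)] by (auto simp: abs_if split: if_splits)
        then have "k ^ j * poly c k > k ^ j * (c0 / 2)" using kj by simp
        then show ?thesis using \<open>\<bar>t * _\<bar> < _\<close> 1 unfolding v by simp
      next
        case 2
        then have "poly c k < c0 / 2" using k1(2)[OF k(1) k'(1)] by (auto simp: abs_if split: if_splits)
        then have "k ^ j * poly c k < k ^ j * (c0 / 2)" using kj by simp
        then show ?thesis using 1 2 unfolding v by simp
      qed
    qed
    moreover have "\<kappa> > 0" using k1 B c0 unfolding \<kappa>_def by auto
    ultimately show ?thesis by blast
  qed
qed

text \<open>A one-variable Lojasiewicz estimate. The predicate is constant on the corner region, which meets
  every line of constant small \<open>k\<close> in points with \<open>t\<close> arbitrarily close to \<open>0\<close>, where it fails.\<close>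

lemma sa_corner:
  assumes sa: "sa (\<lambda>e. D (e 0) (e 1))" and ev: "\<And>k. 0 < k \<Longrightarrow> \<forall>\<^sub>F t in at_right 0. \<not> D t k"
  shows "\<exists>m \<kappa>. 0 < \<kappa> \<and> (\<forall>k t. 0 < k \<longrightarrow> k < \<kappa> \<longrightarrow> 0 < t \<longrightarrow> t \<le> k ^ m \<longrightarrow> \<not> D t k)"
proof -
  define E where "E t k = (\<lambda>_::nat. 0 :: real)(0 := t, 1 := k)" for t k
  obtain S where S: "finite S" "\<forall>p\<in>S. polyfun p"
    "\<And>e e'. (\<forall>p\<in>S. sgn (p e) = sgn (p e')) \<Longrightarrow> D (e 0) (e 1) = D (e' 0) (e' 1)"
    using sa unfolding sa_def by blast
  have "\<exists>m \<kappa> s. 0 < \<kappa> \<and> (\<forall>k t. 0 < k \<longrightarrow> k < \<kappa> \<longrightarrow> 0 < t \<longrightarrow> t \<le> k ^ m \<longrightarrow> sgn (p (E t k)) = s)"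
    if p: "p \<in> S" for p
  proof -
    obtain P where P: "\<forall>t k. p (E t k) = poly (poly P [:t:]) k"
      using polyfun_as_bivariate S(2) p unfolding E_def by blast
    show ?thesis unfolding P[rule_format] by (rule bivariate_corner_sign)
  qed
  then have "\<forall>p\<in>S. \<exists>q. 0 < fst (snd q) \<and> (\<forall>k t. 0 < k \<longrightarrow> k < fst (snd q) \<longrightarrow> 0 < t \<longrightarrow> t \<le> k ^ fst q \<longrightarrow> sgn (p (E t k)) = snd (snd q))"
    by simp
  from bchoice[OF this] obtain q where q: "\<And>p. p \<in> S \<Longrightarrow> 0 < fst (snd (q p))"
    "\<And>p k t. p \<in> S \<Longrightarrow> 0 < k \<Longrightarrow> k < fst (snd (q p)) \<Longrightarrow> 0 < t \<Longrightarrow> t \<le> k ^ fst (q p) \<Longrightarrow> sgn (p (E t k)) = snd (snd (q p))"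
    by blast
  define m where "m = Max (insert 0 ((\<lambda>p. fst (q p)) ` S))"
  define \<kappa> where "\<kappa> = Min (insert 1 ((\<lambda>p. fst (snd (q p))) ` S))"
  have \<kappa>: "\<kappa> > 0" "\<kappa> \<le> 1" "\<And>p. p \<in> S \<Longrightarrow> \<kappa> \<le> fst (snd (q p))" unfolding \<kappa>_def using S(1) q(1) by auto
  have m: "\<And>p. p \<in> S \<Longrightarrow> fst (q p) \<le> m" unfolding m_def using S(1) by auto
  have sg: "sgn (p (E t k)) = snd (snd (q p))" if "p \<in> S" "0 < k" "k < \<kappa>" "0 < t" "t \<le> k ^ m" for p k t
  proof -
    have "k ^ m \<le> k ^ fst (q p)" using that \<kappa>(2) m by (intro power_decreasing) auto
    then show ?thesis using that q(2)[of p k t] \<kappa>(3)[of p] by auto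
  qed
  show ?thesis
  proof (intro exI[of _ m] exI[of _ \<kappa>] conjI \<kappa>(1) allI impI)
    fix k t assume k: "0 < k" "k < \<kappa>" "0 < t" "t \<le> k ^ m"
    have "\<forall>\<^sub>F t' in at_right 0. 0 < t' \<and> t' \<le> k ^ m"
      unfolding eventually_at_right_field using k by (intro exI[of _ "k ^ m"]) auto
    from eventually_conj[OF this ev[OF k(1)]] obtain t' where "0 < t'" "t' \<le> k ^ m" "\<not> D t' k"
      using eventually_happens' trivial_limit_at_right_real by blast
    moreover from this have "D (E t k 0) (E t k 1) = D (E t' k 0) (E t' k 1)"
      using sg k by (intro S(3)) metis
    ultimately show "\<not> D t k" unfolding E_def by simp
  qed
qed

lemma slope_at_most_mono: "slope_at_most F x s l \<Longrightarrow> l \<le> l' \<Longrightarrow> slope_at_most F x s l'"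
  unfolding slope_at_most_def by (smt (verit) mult_right_mono norm_ge_zero)

text \<open>With \<open>D t k\<close> saying that the level \<open>L + \<sigma> * t\<close> has a point of slope at most \<open>t / k\<close>, the
  curve argument refutes \<open>D t k\<close> for each fixed \<open>k\<close> and small \<open>t\<close>. The corner estimate makes this uniform, and
  \<open>k = t powr q\<close> is a point of the corner region.\<close>

lemma lojasiewicz_one_sided:
  fixes F :: "real ^ 'n \<Rightarrow> ereal"
  assumes F: "semialgebraic_function F" and \<sigma>: "\<sigma> = 1 \<or> \<sigma> = -1"
  shows "\<exists>\<theta> \<epsilon>. 0 < \<theta> \<and> \<theta> < 1 \<and> 0 < \<epsilon> \<and>
    (\<forall>x t l. norm x \<le> R \<longrightarrow> 0 < t \<longrightarrow> t < \<epsilon> \<longrightarrow> F x = ereal (L + \<sigma> * t) \<longrightarrow>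
       slope_at_most F x (L + \<sigma> * t) l \<longrightarrow> t powr \<theta> \<le> l)"
proof -
  define B where "B t l \<longleftrightarrow> (\<exists>x. norm x \<le> R \<and> F x = ereal (L + \<sigma> * t) \<and> slope_at_most F x (L + \<sigma> * t) l)" for t l
  have saB: "sa (\<lambda>e. B (e i) (e j))" for i j
    unfolding B_def
    by (intro sa_ex_vec sa_conj sa_norm_le sa_value[OF F] sa_slope_at_most[OF F] polyvec_vec_of polyfun.intros)
  have Bmono: "B t l \<Longrightarrow> l \<le> l' \<Longrightarrow> B t l'" for t l l' unfolding B_def using slope_at_most_mono by blast
  define D where "D t k \<longleftrightarrow> (\<exists>l. l * k = t \<and> B t l)" for t k
  have saD: "sa (\<lambda>e. D (e 0) (e 1))"
    unfolding D_def by (intro sa_ex sa_conj sa_eq saB polyfun.intros)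
  have evD: "\<forall>\<^sub>F t in at_right 0. \<not> D t k" if k: "k > 0" for k
  proof -
    have "\<forall>\<^sub>F t in at_right 0. \<not> B t (1 / k * t)"
      unfolding B_def
    proof (rule eventually_no_flat_point[OF F, where \<sigma> = "- \<sigma>" and \<kappa> = k])
      show "sa_fun (\<lambda>t. L + \<sigma> * t)" "sa_fun (\<lambda>t. 1 / k * t)"
        unfolding sa_fun_def by (intro sa_eq polyfun.intros)+
      show "\<forall>\<^sub>F t in at_right 0. 0 < 1 / k * t"
        using k unfolding eventually_at_right_field by (auto intro: exI[of _ 1])
      show "\<forall>\<^sub>F t in at_right 0. \<forall>\<^sub>F h in at_right 0. k * h * (1 / k * t) \<le> t * (L + \<sigma> * t - (L + \<sigma> * (t + - \<sigma> * h)))"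
        using k \<sigma> by (auto simp: algebra_simps)
    qed (use \<sigma> k in auto)
    then show ?thesis
    proof eventually_elim
      case (elim t)
      then show ?case using k unfolding D_def by (auto simp: field_simps)
    qed
  qed
  obtain m \<kappa> where \<kappa>: "0 < \<kappa>" and m: "\<And>k t. 0 < k \<Longrightarrow> k < \<kappa> \<Longrightarrow> 0 < t \<Longrightarrow> t \<le> k ^ m \<Longrightarrow> \<not> D t k"
    using sa_corner[of D, OF saD evD] by blast
  \<comment> \<open>Any \<open>q > 0\<close> with \<open>q * m \<le> 1\<close> puts \<open>t powr q\<close> into the corner region; the \<open>2\<close> keeps \<open>1 - q\<close> strictly between \<open>0\<close> and \<open>1\<close>.\<close>
  define q where "q = 1 / (real m + 2)"
  have q: "0 < q" "q < 1" "q * real m \<le> 1" unfolding q_def by (auto simp: field_simps)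
  define \<epsilon> where "\<epsilon> = min 1 (\<kappa> powr (1 / q))"
  show ?thesis
  proof (rule exI[of _ "1 - q"], rule exI[of _ \<epsilon>], intro conjI allI impI)
    show "0 < 1 - q" "1 - q < 1" "0 < \<epsilon>" using q \<kappa> unfolding \<epsilon>_def by auto
    fix x t l assume t: "norm x \<le> R" "0 < t" "t < \<epsilon>" "F x = ereal (L + \<sigma> * t)" "slope_at_most F x (L + \<sigma> * t) l"
    define k where "k = t powr q"
    have "k > 0" using t unfolding k_def by simp
    have "k < (\<kappa> powr (1 / q)) powr q" using t q unfolding k_def \<epsilon>_def by (intro powr_less_mono2) auto
    also have "\<dots> = \<kappa>" using q \<kappa> by (simp add: powr_powr)
    finally have "k < \<kappa>" .
    have "t powr 1 \<le> t powr (q * real m)"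
      using t q unfolding \<epsilon>_def by (intro powr_mono') auto
    also have "t powr (q * real m) = k ^ m"
      using t unfolding k_def by (simp add: powr_powr[symmetric] powr_realpow)
    finally have "t \<le> k ^ m" using t by simp
    then have nD: "\<not> D t k" using m \<open>k > 0\<close> \<open>k < \<kappa>\<close> t by blast
    have "t powr (1 - q) * k = t" using t unfolding k_def by (simp flip: powr_add)
    then have "\<not> B t (t powr (1 - q))" using nD unfolding D_def by blast
    moreover have "B t l" unfolding B_def using t by blast
    ultimately show "t powr (1 - q) \<le> l" using Bmono by (meson linear)
  qed
qed

lemma slope_at_most_frechet:
  fixes F :: "'a::euclidean_space \<Rightarrow> ereal"
  assumes u: "u \<in> frechet_subdifferential F x" and s: "F x = ereal s" and l: "norm u < l"
  shows "slope_at_most F x s l"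
proof -
  define e where "e = l - norm u"
  have "e > 0" using l unfolding e_def by simp
  have "0 \<le> Liminf (at x) (\<lambda>y. (F y - F x - ereal (u \<bullet> (y - x))) / ereal (norm (y - x)))"
    using u unfolding frechet_subdifferential_def by simp
  then have "\<forall>\<^sub>F y in at x. ereal (- e) < (F y - F x - ereal (u \<bullet> (y - x))) / ereal (norm (y - x))"
    using \<open>e > 0\<close> unfolding le_Liminf_iff by simp
  then obtain \<delta> where \<delta>: "\<delta> > 0" "\<And>y. y \<noteq> x \<Longrightarrow> dist y x < \<delta> \<Longrightarrow>
      ereal (- e) < (F y - F x - ereal (u \<bullet> (y - x))) / ereal (norm (y - x))"
    unfolding eventually_at by auto
  have "s - l * norm (y - x) \<le> r" if y: "norm (y - x) < \<delta>" "F y = ereal r" for y r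
  proof (cases "y = x")
    case True
    then show ?thesis using y s by simp
  next
    case False
    then have n: "norm (y - x) > 0" by simp
    have "- e < (r - s - u \<bullet> (y - x)) / norm (y - x)"
      using \<delta>(2)[OF False] y n s by (simp add: dist_norm)
    then have "- e * norm (y - x) < r - s - u \<bullet> (y - x)" using n by (simp add: pos_less_divide_eq)
    moreover have "- (norm u * norm (y - x)) \<le> u \<bullet> (y - x)"
      using Cauchy_Schwarz_ineq2[of u "y - x"] by (simp add: abs_le_iff)
    ultimately show ?thesis unfolding e_def by (simp add: algebra_simps)
  qed
  then show ?thesis using \<delta>(1) unfolding slope_at_most_def by blast
qed

lemma limiting_subgradient_approx:
  fixes F :: "'a::euclidean_space \<Rightarrow> ereal"
  assumes F: "proper F" and u: "u \<in> limiting_subdifferential F x"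
  obtains X U f where "X \<longlonglongrightarrow> x" "U \<longlonglongrightarrow> u" "(\<lambda>k. ereal (f k)) \<longlonglongrightarrow> F x"
    "\<And>k::nat. F (X k) = ereal (f k)" "\<And>k. U k \<in> frechet_subdifferential F (X k)"
proof -
  obtain X U where XU: "X \<longlonglongrightarrow> x" "(\<lambda>k. F (X k)) \<longlonglongrightarrow> F x" "\<forall>k::nat. U k \<in> frechet_subdifferential F (X k)" "U \<longlonglongrightarrow> u"
    using u unfolding limiting_subdifferential_def by blast
  have "F (X k) < \<infinity> \<and> F (X k) \<noteq> -\<infinity>" for k
    using XU(3) F unfolding frechet_subdifferential_def proper_def by auto
  note FX = this
  have fin: "F (X k) = ereal (real_of_ereal (F (X k)))" for k
    using FX[of k] by (cases "F (X k)") auto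
  show ?thesis
  proof (rule that[of X U "\<lambda>k. real_of_ereal (F (X k))"])
    show "(\<lambda>k. ereal (real_of_ereal (F (X k)))) \<longlonglongrightarrow> F x" using XU(2) fin by simp
  qed (use XU fin in auto)
qed

text \<open>The inequality is uniform on the whole ball, since the two one-sided estimates are. It passes from Frechet to limiting subgradients by continuity, at the price of a slightly larger ball. Every larger
  exponent is allowed since \<open>\<bar>s - L\<bar> < 1\<close>; for \<open>s = L\<close> the left side is \<open>0 powr \<theta> = 0\<close>.\<close>

theorem lojasiewicz_inequality:
  fixes F :: "real ^ 'n \<Rightarrow> ereal"
  assumes F: "semialgebraic_function F" "proper F"
  shows "\<exists>\<theta>0 \<epsilon>. 0 < \<theta>0 \<and> \<theta>0 < 1 \<and> 0 < \<epsilon> \<and>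
    (\<forall>x u s \<theta>. norm x \<le> R \<longrightarrow> u \<in> limiting_subdifferential F x \<longrightarrow> F x = ereal s \<longrightarrow> \<bar>s - L\<bar> < \<epsilon> \<longrightarrow>
       \<theta>0 \<le> \<theta> \<longrightarrow> \<bar>s - L\<bar> powr \<theta> \<le> norm u)"
proof -
  obtain \<theta>1 \<epsilon>1 where 1: "0 < \<theta>1" "\<theta>1 < 1" "0 < \<epsilon>1"
    "\<And>x t l. norm x \<le> R + 1 \<Longrightarrow> 0 < t \<Longrightarrow> t < \<epsilon>1 \<Longrightarrow> F x = ereal (L + 1 * t) \<Longrightarrow>
       slope_at_most F x (L + 1 * t) l \<Longrightarrow> t powr \<theta>1 \<le> l"
    using lojasiewicz_one_sided[OF F(1), of 1 "R + 1" L] by blast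
  obtain \<theta>2 \<epsilon>2 where 2: "0 < \<theta>2" "\<theta>2 < 1" "0 < \<epsilon>2"
    "\<And>x t l. norm x \<le> R + 1 \<Longrightarrow> 0 < t \<Longrightarrow> t < \<epsilon>2 \<Longrightarrow> F x = ereal (L + (-1) * t) \<Longrightarrow>
       slope_at_most F x (L + (-1) * t) l \<Longrightarrow> t powr \<theta>2 \<le> l"
    using lojasiewicz_one_sided[OF F(1), of "-1" "R + 1" L] by blast
  define \<epsilon> where "\<epsilon> = min 1 (min \<epsilon>1 \<epsilon>2)"
  have slope: "\<bar>s - L\<bar> powr \<theta> \<le> l"
    if x: "norm x \<le> R + 1" "F x = ereal s" "s \<noteq> L" "\<bar>s - L\<bar> < \<epsilon>" "slope_at_most F x s l" "max \<theta>1 \<theta>2 \<le> \<theta>"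
    for x s l \<theta>
  proof (cases "L < s")
    case True
    have "\<bar>s - L\<bar> powr \<theta> \<le> (s - L) powr \<theta>1" using x True unfolding \<epsilon>_def by (auto intro!: powr_mono')
    also have "\<dots> \<le> l" using 1(4)[of x "s - L" l] x True unfolding \<epsilon>_def by simp
    finally show ?thesis .
  next
    case False
    have "\<bar>s - L\<bar> powr \<theta> \<le> (L - s) powr \<theta>2" using x False unfolding \<epsilon>_def by (auto intro!: powr_mono')
    also have "\<dots> \<le> l" using 2(4)[of x "L - s" l] x False unfolding \<epsilon>_def by simp
    finally show ?thesis .
  qed
  show ?thesis
  proof (rule exI[of _ "max \<theta>1 \<theta>2"], rule exI[of _ \<epsilon>], intro conjI allI impI)
    fix x :: "real ^ 'n" and u s \<theta>
    assume x: "norm x \<le> R" and u: "u \<in> limiting_subdifferential F x" and s: "F x = ereal s"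
      "\<bar>s - L\<bar> < \<epsilon>" and \<theta>: "max \<theta>1 \<theta>2 \<le> \<theta>"
    show "\<bar>s - L\<bar> powr \<theta> \<le> norm u"
    proof (cases "s = L")
      case False
      obtain X U f where X: "X \<longlonglongrightarrow> x" "U \<longlonglongrightarrow> u" "(\<lambda>k. ereal (f k)) \<longlonglongrightarrow> F x"
        "\<And>k::nat. F (X k) = ereal (f k)" "\<And>k. U k \<in> frechet_subdifferential F (X k)"
        using limiting_subgradient_approx[OF F(2) u] by blast
      have f: "f \<longlonglongrightarrow> s" using X(3) s(1) by simp
      have "\<forall>\<^sub>F k in sequentially. \<bar>f k - L\<bar> powr \<theta> \<le> norm (U k)"
      proof -
        have "(\<lambda>k. norm (X k)) \<longlonglongrightarrow> norm x" using X(1) by (rule tendsto_norm)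
        then have "\<forall>\<^sub>F k in sequentially. norm (X k) < R + 1" using x by (intro order_tendstoD) auto
        moreover have "(\<lambda>k. \<bar>f k - L\<bar>) \<longlonglongrightarrow> \<bar>s - L\<bar>" using f by (intro tendsto_intros)
        from order_tendstoD(1)[OF this, of 0] order_tendstoD(2)[OF this s(2)]
        have "\<forall>\<^sub>F k in sequentially. \<bar>f k - L\<bar> < \<epsilon>" "\<forall>\<^sub>F k in sequentially. 0 < \<bar>f k - L\<bar>"
          using False by auto
        ultimately show ?thesis
        proof eventually_elim
          case (elim k)
          have "\<bar>f k - L\<bar> powr \<theta> \<le> l" if "norm (U k) < l" for l
            using slope[of "X k" "f k" l \<theta>] elim X(4) slope_at_most_frechet[OF X(5) X(4) that] \<theta> by auto
          then show ?case by (rule dense_ge)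
        qed
      qed
      moreover have "(\<lambda>k. \<bar>f k - L\<bar> powr \<theta>) \<longlonglongrightarrow> \<bar>s - L\<bar> powr \<theta>"
        using f False by (intro tendsto_powr tendsto_intros) auto
      ultimately show ?thesis using tendsto_le[OF _ tendsto_norm[OF X(2)]] by auto
    qed simp
  qed (use 1 2 in \<open>auto simp: \<epsilon>_def\<close>)
qed

text \<open>The definition of limiting subgradients does not by itself exclude points where \<open>F\<close> is
  infinite: the approximating points might have values tending to infinity with bounded subgradients. On the levels \<open>1 / t\<close> the values drop
  at rate \<open>1 / t\<^sup>2\<close>, so the curve argument excludes this with a constant slope bound.\<close>

lemma no_subgradient_at_infinite_value:
  fixes F :: "real ^ 'n \<Rightarrow> ereal"
  assumes F: "semialgebraic_function F" "proper F" and u: "u \<in> limiting_subdifferential F x"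
  shows "F x < \<infinity>"
proof (rule ccontr)
  assume "\<not> F x < \<infinity>"
  then have inf: "F x = \<infinity>" by simp
  obtain X U f where X: "X \<longlonglongrightarrow> x" "U \<longlonglongrightarrow> u" "(\<lambda>k. ereal (f k)) \<longlonglongrightarrow> F x"
    "\<And>k::nat. F (X k) = ereal (f k)" "\<And>k. U k \<in> frechet_subdifferential F (X k)"
    using limiting_subgradient_approx[OF F(2) u] by blast
  have f: "filterlim f at_top sequentially"
    using X(3) unfolding inf by (simp add: tendsto_PInfty_eq_at_top)
  define R where "R = norm x + 1"
  define C where "C = norm u + 1"
  have "C > 0" unfolding C_def by (smt (verit) norm_ge_zero)
  have "\<forall>\<^sub>F t in at_right 0. \<not> (\<exists>x. norm x \<le> R \<and> F x = ereal (1 / t) \<and> slope_at_most F x (1 / t) C)"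
  proof (rule eventually_no_flat_point[OF F(1), where \<sigma> = 1 and \<kappa> = "1 / C"])
    have "e 1 = 1 / e 0 \<longleftrightarrow> e 0 = 0 \<and> e 1 = 0 \<or> e 0 \<noteq> 0 \<and> e 1 * e 0 = 1" for e :: "nat \<Rightarrow> real"
      by (cases "e 0 = 0") (auto simp: field_simps)
    then show "sa_fun (\<lambda>t. 1 / t)"
      unfolding sa_fun_def by (simp only:) (intro sa_disj sa_conj sa_not sa_eq polyfun.intros)
    show "sa_fun (\<lambda>t. C)" unfolding sa_fun_def by (intro sa_eq polyfun.intros)
    have "1 / C * h * C \<le> t * (1 / t - 1 / (t + 1 * h))" if "0 < t" "t < 1 / 2" "0 < h" "h < 1 / 2" for t h :: real
    proof -
      have "h * (t + h) \<le> h * 1" using that by (intro mult_left_mono) auto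
      then have "h \<le> h / (t + h)" using that by (simp add: pos_le_divide_eq)
      also have "h / (t + h) = 1 - t / (t + h)" using that by (simp add: field_simps)
      also have "\<dots> = t * (1 / t - 1 / (t + 1 * h))" using that by (simp add: right_diff_distrib)
      finally show ?thesis using \<open>C > 0\<close> by simp
    qed
    then show "\<forall>\<^sub>F t in at_right 0. \<forall>\<^sub>F h in at_right 0. 1 / C * h * C \<le> t * (1 / t - 1 / (t + 1 * h))"
      unfolding eventually_at_right_field by (intro exI[of _ "1 / 2"]) auto
  qed (use \<open>C > 0\<close> in auto)
  moreover have "filterlim (\<lambda>k. 1 / f k) (at_right 0) sequentially"
    using filterlim_compose[OF filterlim_inverse_at_right_top f] by (simp add: inverse_eq_divide)
  ultimately have "\<forall>\<^sub>F k in sequentially. \<not> (\<exists>x. norm x \<le> R \<and> F x = ereal (1 / (1 / f k)) \<and> slope_at_most F x (1 / (1 / f k)) C)"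
    by (rule eventually_compose_filterlim)
  moreover have "\<forall>\<^sub>F k in sequentially. norm (X k) < R"
    using tendsto_norm[OF X(1)] by (intro order_tendstoD) (auto simp: R_def)
  moreover have "\<forall>\<^sub>F k in sequentially. norm (U k) < C"
    using tendsto_norm[OF X(2)] by (intro order_tendstoD) (auto simp: C_def)
  ultimately have "\<forall>\<^sub>F k in sequentially. False"
  proof eventually_elim
    case (elim k)
    then show ?case using X(4)[of k] slope_at_most_frechet[OF X(5) X(4), of k C] by auto
  qed
  then show False by simp
qed

section \<open>Summability of the steps\<close>

lemma powr_sum_le:
  fixes x y \<theta> :: real
  assumes "0 \<le> x" "0 \<le> y" "0 < \<theta>" "\<theta> < 1"
  shows "(x + y) powr \<theta> \<le> 2 * (x powr \<theta> + y powr \<theta>)"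
proof -
  have "(x + y) powr \<theta> \<le> (2 * max x y) powr \<theta>" using assms by (intro powr_mono2) auto
  also have "\<dots> = 2 powr \<theta> * max x y powr \<theta>" using assms by (simp add: powr_mult)
  also have "\<dots> \<le> 2 powr 1 * (x powr \<theta> + y powr \<theta>)"
    using assms by (intro mult_mono powr_mono) (auto simp: max_def)
  finally show ?thesis by simp
qed

text \<open>Concavity of \<open>s powr (1 - \<theta>)\<close> in a form without division by \<open>x\<close>; it is Young's inequality for
  \<open>x powr \<theta> * y powr (1 - \<theta>)\<close>.\<close>

lemma powr_desingularization:
  fixes x y \<theta> :: real
  assumes "0 \<le> y" "y \<le> x" "0 < \<theta>" "\<theta> < 1"
  shows "(1 - \<theta>) * (x - y) \<le> x powr \<theta> * (x powr (1 - \<theta>) - y powr (1 - \<theta>))"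
proof (cases "y = 0")
  case True
  show ?thesis
  proof (cases "x = 0")
    case False
    then have "x powr \<theta> * x powr (1 - \<theta>) = x" using assms by (simp flip: powr_add)
    then show ?thesis using True assms by (simp add: algebra_simps)
  qed (use True in simp)
next
  case False
  then have "x > 0" "y > 0" using assms by auto
  then have "x powr \<theta> * y powr (1 - \<theta>) \<le> \<theta> * x + (1 - \<theta>) * y"
    using assms by (intro Youngs_inequality_0) auto
  moreover have "x powr \<theta> * x powr (1 - \<theta>) = x" using \<open>x > 0\<close> by (simp flip: powr_add)
  ultimately show ?thesis by (simp add: algebra_simps)
qed

text \<open>Each step is charged by at most \<open>\<tau> + 1\<close> later ones, each with weight \<open>q\<close>, so the partial sums
  satisfy \<open>T \<le> const + T / 2\<close>.\<close>

lemma summable_of_delayed_contraction: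
  fixes \<delta> r :: "nat \<Rightarrow> real"
  assumes \<delta>: "\<And>k. 0 \<le> \<delta> k" and q: "0 \<le> q" "q * (real \<tau> + 1) \<le> 1 / 2"
    and N: "\<tau> \<le> N" and rec: "\<And>k. N \<le> k \<Longrightarrow> \<delta> (Suc k) \<le> q * (\<Sum>j = k - \<tau>..k. \<delta> j) + r k"
    and r: "\<And>n. (\<Sum>i<n. r (N + i)) \<le> R"
  shows "summable \<delta>"
proof -
  define T where "T n = (\<Sum>j<N + n. \<delta> j)" for n
  have window: "(\<Sum>i<n. \<Sum>j = N + i - \<tau>..N + i. \<delta> j) \<le> (real \<tau> + 1) * T n" for n
  proof -
    have "(\<Sum>j = N + i - \<tau>..N + i. \<delta> j) = (\<Sum>l\<le>\<tau>. \<delta> (N + i - l))" for i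
      using N by (intro sum.reindex_bij_witness[of _ "\<lambda>l. N + i - l" "\<lambda>j. N + i - j"]) auto
    then have "(\<Sum>i<n. \<Sum>j = N + i - \<tau>..N + i. \<delta> j) = (\<Sum>l\<le>\<tau>. \<Sum>i<n. \<delta> (N + i - l))"
      by (simp add: sum.swap[of _ "{..\<tau>}"])
    also have "\<dots> \<le> (\<Sum>l\<le>\<tau>. T n)"
    proof (rule sum_mono)
      fix l assume l: "l \<in> {..\<tau>}"
      have "(\<Sum>i<n. \<delta> (N + i - l)) = (\<Sum>j\<in>(\<lambda>i. N + i - l) ` {..<n}. \<delta> j)"
        using l N by (subst sum.reindex) (auto simp: inj_on_def)
      also have "\<dots> \<le> T n" unfolding T_def using l N by (intro sum_mono2) (auto simp: \<delta>)
      finally show "(\<Sum>i<n. \<delta> (N + i - l)) \<le> T n" .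
    qed
    finally show ?thesis by (simp add: add.commute)
  qed
  define B where "B = 2 * (\<bar>T 1\<bar> + \<bar>R\<bar>)"
  have Tmono: "T n \<le> T (Suc n)" for n unfolding T_def using \<delta> by simp
  have T0: "0 \<le> T n" for n unfolding T_def using \<delta> by (simp add: sum_nonneg)
  have bound: "T (Suc n) \<le> B" for n
  proof -
    have "T (Suc n) = T 1 + (\<Sum>i<n. \<delta> (Suc (N + i)))"
      unfolding T_def by (induction n) auto
    also have "(\<Sum>i<n. \<delta> (Suc (N + i))) \<le> (\<Sum>i<n. q * (\<Sum>j = N + i - \<tau>..N + i. \<delta> j) + r (N + i))"
      by (intro sum_mono rec) simp
    also have "\<dots> = q * (\<Sum>i<n. \<Sum>j = N + i - \<tau>..N + i. \<delta> j) + (\<Sum>i<n. r (N + i))"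
      by (simp add: sum.distrib sum_distrib_left)
    also have "\<dots> \<le> q * ((real \<tau> + 1) * T n) + R"
      by (intro add_mono mult_left_mono window r q)
    also have "q * ((real \<tau> + 1) * T n) \<le> 1 / 2 * T n"
      using mult_right_mono[OF q(2) T0[of n]] by (simp add: mult.assoc)
    finally have "T (Suc n) \<le> T 1 + (1 / 2 * T n + R)" by simp
    then show ?thesis using Tmono[of n] abs_ge_self[of "T 1"] abs_ge_self[of R]
      unfolding B_def distrib_left by linarith
  qed
  show ?thesis
  proof (rule bounded_imp_summable[OF \<delta>, of _ B])
    fix n
    have "sum \<delta> {..n} \<le> T (Suc n)" unfolding T_def by (intro sum_mono2) (auto simp: \<delta>)
    then show "sum \<delta> {..n} \<le> B" using bound order_trans by blast
  qed
qed

lemma square_le_product_imp: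
  fixes x w v \<mu> :: real
  assumes "x\<^sup>2 \<le> w * v" "0 \<le> w" "0 \<le> v" "0 < \<mu>"
  shows "x \<le> \<mu> * w + v / (4 * \<mu>)"
proof (rule power2_le_imp_le)
  have "w * v \<le> (\<mu> * w + v / (4 * \<mu>))\<^sup>2"
  proof -
    have "0 \<le> (\<mu> * w - v / (4 * \<mu>))\<^sup>2" by simp
    also have "\<dots> = (\<mu> * w + v / (4 * \<mu>))\<^sup>2 - w * v" using assms(4) by (simp add: power2_eq_square field_simps)
    finally show ?thesis by simp
  qed
  then show "x\<^sup>2 \<le> (\<mu> * w + v / (4 * \<mu>))\<^sup>2" using assms(1) by linarith
  show "0 \<le> \<mu> * w + v / (4 * \<mu>)" using assms by simp
qed

text \<open>With \<open>h = f + E - L\<close>, the bound for \<open>h powr \<theta>\<close> from the Lojasiewicz inequality and the concavity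
  estimate give \<open>(\<delta> (Suc k))\<^sup>2 \<le> W k * V k\<close>, where \<open>V\<close> telescopes and \<open>W\<close> collects past steps and errors. The
  arithmetic-geometric mean inequality with a small weight \<open>\<mu>\<close> on \<open>W\<close> yields a contractive recursion. Nonnegativity of \<open>h\<close> follows from
  monotone convergence to \<open>0\<close>; \<open>f - L\<close> itself may have either sign.\<close>

lemma summable_steps_of_lojasiewicz:
  fixes f \<delta> \<eta> E :: "nat \<Rightarrow> real"
  assumes a: "a > 0" and \<theta>: "0 < \<theta>" "\<theta> < 1" and c: "c > 0" "d > 0"
    and nonneg: "\<And>k. 0 \<le> \<delta> k" "\<And>k. 0 \<le> \<eta> k" "\<And>k. 0 \<le> E k"
    and N: "\<tau> \<le> N"
    and dec: "\<And>k. N \<le> k \<Longrightarrow> a * (\<delta> k)\<^sup>2 \<le> (f k + E k) - (f (Suc k) + E (Suc k))"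
    and lim: "(\<lambda>k. f k + E k) \<longlonglongrightarrow> L"
    and KL: "\<And>k. N \<le> k \<Longrightarrow> \<bar>f (Suc k) - L\<bar> powr \<theta> \<le> c * (\<Sum>j = k - \<tau>..k. \<delta> j) + d * \<eta> k"
    and sum\<eta>: "summable \<eta>" and sumE: "summable (\<lambda>k. E k powr \<theta>)"
  shows "summable \<delta>"
proof -
  define h where "h k = f k + E k - L" for k
  have hdec: "a * (\<delta> k)\<^sup>2 \<le> h k - h (Suc k)" if "N \<le> k" for k using dec[OF that] unfolding h_def by simp
  have h0: "0 \<le> h k" if "N \<le> k" for k
  proof -
    have "h (Suc (N + i)) \<le> h (N + i)" for i
      using hdec[of "N + i"] a by (smt (verit) le_add1 mult_nonneg_nonneg zero_le_power2)
    then have "decseq (\<lambda>i. h (N + i))" by (intro decseq_SucI) simp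
    moreover have "(\<lambda>i. h (N + i)) \<longlonglongrightarrow> 0"
    proof -
      have "h \<longlonglongrightarrow> L - L" unfolding h_def by (intro tendsto_intros lim)
      then show ?thesis using LIMSEQ_ignore_initial_segment[of h 0 N] by (simp add: add.commute)
    qed
    ultimately have "0 \<le> h (N + (k - N))" by (rule decseq_ge)
    then show ?thesis using that by simp
  qed
  have hmono: "h (Suc k) \<le> h k" if "N \<le> k" for k
    using hdec[OF that] a by (smt (verit) mult_nonneg_nonneg zero_le_power2)
  define \<phi> where "\<phi> k = h k powr (1 - \<theta>)" for k
  define S where "S k = (\<Sum>j = k - \<tau>..k. \<delta> j)" for k
  define W where "W k = c * S k + d * \<eta> k + E (Suc k) powr \<theta>" for k
  define M where "M = 2 / (a * (1 - \<theta>))"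
  define V where "V k = M * (\<phi> (Suc k) - \<phi> (Suc (Suc k)))" for k
  have M: "M > 0" using a \<theta> unfolding M_def by simp
  have S0: "0 \<le> S k" for k unfolding S_def by (intro sum_nonneg nonneg)
  have W0: "0 \<le> W k" for k unfolding W_def using S0 c nonneg by simp
  have V0: "0 \<le> V k" if "N \<le> k" for k
    unfolding V_def \<phi>_def using M \<theta> hmono[of "Suc k"] h0[of "Suc (Suc k)"] that
    by (auto intro!: mult_nonneg_nonneg powr_mono2)
  have key: "(\<delta> (Suc k))\<^sup>2 \<le> W k * V k" if k: "N \<le> k" for k
  proof -
    have hh: "0 \<le> h (Suc (Suc k))" "h (Suc (Suc k)) \<le> h (Suc k)" "0 \<le> h (Suc k)"
      using h0 hmono k by auto
    have "h (Suc k) powr \<theta> \<le> (\<bar>f (Suc k) - L\<bar> + E (Suc k)) powr \<theta>"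
      using hh nonneg \<theta> unfolding h_def by (intro powr_mono2) auto
    also have "\<dots> \<le> 2 * (\<bar>f (Suc k) - L\<bar> powr \<theta> + E (Suc k) powr \<theta>)"
      using nonneg \<theta> by (intro powr_sum_le) auto
    also have "\<dots> \<le> 2 * W k" using KL[OF k] unfolding W_def S_def by simp
    finally have hW: "h (Suc k) powr \<theta> \<le> 2 * W k" .
    have "(1 - \<theta>) * (a * (\<delta> (Suc k))\<^sup>2) \<le> (1 - \<theta>) * (h (Suc k) - h (Suc (Suc k)))"
      using hdec[of "Suc k"] k \<theta> by (intro mult_left_mono) auto
    also have "\<dots> \<le> h (Suc k) powr \<theta> * (\<phi> (Suc k) - \<phi> (Suc (Suc k)))"
      unfolding \<phi>_def using hh \<theta> by (intro powr_desingularization) auto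
    also have "\<dots> \<le> 2 * W k * (\<phi> (Suc k) - \<phi> (Suc (Suc k)))"
      using hW V0[OF k] M unfolding V_def by (intro mult_right_mono) (auto simp: zero_le_mult_iff)
    finally show ?thesis using a \<theta> unfolding V_def M_def by (simp add: field_simps)
  qed
  define \<mu> where "\<mu> = 1 / (2 * (c * (real \<tau> + 1)))"
  have ct: "c * (real \<tau> + 1) > 0" using c by simp
  have \<mu>: "\<mu> > 0" "\<mu> * c * (real \<tau> + 1) = 1 / 2" using ct unfolding \<mu>_def by (auto simp: field_simps)
  define r1 where "r1 k = \<mu> * (d * \<eta> k + E (Suc k) powr \<theta>)" for k
  have "summable (\<lambda>k. E (Suc k) powr \<theta>)" using sumE by (simp add: summable_Suc_iff[of "\<lambda>k. E k powr \<theta>"])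
  then have r1: "summable r1" "\<And>k. 0 \<le> r1 k"
    unfolding r1_def using sum\<eta> \<mu> c nonneg by (auto intro!: summable_mult summable_add)
  show ?thesis
  proof (rule summable_of_delayed_contraction[where q = "\<mu> * c" and r = "\<lambda>k. r1 k + V k / (4 * \<mu>)" and N = N and \<tau> = \<tau>])
    fix k assume k: "N \<le> k"
    have "\<delta> (Suc k) \<le> \<mu> * W k + V k / (4 * \<mu>)"
      using square_le_product_imp[OF key[OF k] W0 V0[OF k] \<mu>(1)] .
    then show "\<delta> (Suc k) \<le> \<mu> * c * (\<Sum>j = k - \<tau>..k. \<delta> j) + (r1 k + V k / (4 * \<mu>))"
      unfolding W_def r1_def S_def by (simp add: algebra_simps)
  next
    fix n
    have "(\<Sum>i<n. r1 (N + i)) \<le> suminf r1"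
    proof -
      have "(\<Sum>i<n. r1 (N + i)) = sum r1 ((+) N ` {..<n})" by (simp add: sum.reindex)
      also have "\<dots> \<le> suminf r1" using r1 by (intro sum_le_suminf) auto
      finally show ?thesis .
    qed
    moreover have "(\<Sum>i<n. V (N + i)) = M * (\<phi> (Suc N) - \<phi> (Suc (N + n)))"
      unfolding V_def by (induction n) (auto simp: algebra_simps)
    then have "(\<Sum>i<n. V (N + i)) \<le> M * \<phi> (Suc N)"
      using M unfolding \<phi>_def by (simp add: right_diff_distrib)
    then have "(\<Sum>i<n. V (N + i)) / (4 * \<mu>) \<le> M * \<phi> (Suc N) / (4 * \<mu>)"
      using \<mu> by (intro divide_right_mono) auto
    ultimately show "(\<Sum>i<n. r1 (N + i) + V (N + i) / (4 * \<mu>)) \<le> suminf r1 + M * \<phi> (Suc N) / (4 * \<mu>)"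
      by (simp add: sum.distrib sum_divide_distrib)
  qed (use N \<mu> c nonneg in auto)
qed

text \<open>The mean value theorem for \<open>k powr (1 - 2 * \<alpha>)\<close>; the factor \<open>2 powr (- (2 * \<alpha>))\<close> comes from
  \<open>Suc k \<le> 2 * k\<close>.\<close>

lemma powr_decrement:
  fixes \<alpha> :: real
  assumes "\<alpha> > 1" "k \<ge> 1"
  shows "(2 * \<alpha> - 1) * 2 powr (- (2 * \<alpha>)) * real k powr (- (2 * \<alpha>))
     \<le> real k powr (1 - 2 * \<alpha>) - real (Suc k) powr (1 - 2 * \<alpha>)"
proof -
  have k: "0 < real k" using assms by simp
  have "\<exists>z>real k. z < real (Suc k) \<and> real (Suc k) powr (1 - 2 * \<alpha>) - real k powr (1 - 2 * \<alpha>)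
      = (real (Suc k) - real k) * ((1 - 2 * \<alpha>) * z powr (1 - 2 * \<alpha> - 1))"
    using k by (intro MVT2 has_real_derivative_powr) auto
  then obtain z where z: "real k < z" "z < real (Suc k)"
    "real k powr (1 - 2 * \<alpha>) - real (Suc k) powr (1 - 2 * \<alpha>) = (2 * \<alpha> - 1) * z powr (- (2 * \<alpha>))"
    by (auto simp: algebra_simps)
  have "(2 * real k) powr (- (2 * \<alpha>)) \<le> z powr (- (2 * \<alpha>))"
    using z k assms by (intro powr_mono2') auto
  then show ?thesis unfolding z(3) using assms by (simp add: powr_mult mult_left_mono mult.assoc)
qed

section \<open>Convergence to a critical point\<close>

text \<open>The graph of the limiting subdifferential is closed along sequences with converging values: approximate the \<open>k\<close>-th limiting
  subgradient by a Frechet subgradient to accuracy \<open>1 / (k + 1)\<close>.\<close>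

lemma critical_point_of_vanishing_subgradients:
  fixes F :: "'a::euclidean_space \<Rightarrow> ereal"
  assumes F: "proper F" and x: "x \<longlonglongrightarrow> xs"
    and g: "\<And>k. F (x k) = ereal (g k)" "(\<lambda>k. ereal (g k)) \<longlonglongrightarrow> F xs"
    and dist: "\<And>k. dist0 (limiting_subdifferential F (x k)) \<le> ereal (D k)" and D: "D \<longlonglongrightarrow> 0"
  shows "critical_point F xs"
proof -
  define e where "e k = 1 / (real k + 1)" for k
  have e: "e k > 0" for k unfolding e_def by simp
  have e0: "e \<longlonglongrightarrow> 0"
    unfolding e_def using LIMSEQ_inverse_real_of_nat by (simp add: inverse_eq_divide add.commute)
  have "\<exists>q. fst q \<in> frechet_subdifferential F (fst (snd q)) \<and> norm (fst q) \<le> D k + 2 * e k \<and>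
      norm (fst (snd q) - x k) \<le> e k \<and> norm (snd (snd q) - g k) \<le> e k \<and> F (fst (snd q)) = ereal (snd (snd q))" for k
  proof -
    have "ereal (D k) < ereal (D k + e k)" using e[of k] by simp
    then have "dist0 (limiting_subdifferential F (x k)) < ereal (D k + e k)"
      using dist[of k] by (rule le_less_trans[rotated])
    then obtain u where u: "u \<in> limiting_subdifferential F (x k)" "norm u < D k + e k"
      unfolding dist0_def INF_less_iff by auto
    obtain X U f where X: "X \<longlonglongrightarrow> x k" "U \<longlonglongrightarrow> u" "(\<lambda>k. ereal (f k)) \<longlonglongrightarrow> F (x k)"
      "\<And>j::nat. F (X j) = ereal (f j)" "\<And>j. U j \<in> frechet_subdifferential F (X j)"
      using limiting_subgradient_approx[OF F u(1)] by blast
    have f: "f \<longlonglongrightarrow> g k" using X(3) g(1) by simp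
    have "\<forall>\<^sub>F j in sequentially. dist (X j) (x k) < e k" using X(1) e by (rule tendstoD)
    moreover have "\<forall>\<^sub>F j in sequentially. dist (U j) u < e k" using X(2) e by (rule tendstoD)
    moreover have "\<forall>\<^sub>F j in sequentially. dist (f j) (g k) < e k" using f e by (rule tendstoD)
    ultimately have "\<forall>\<^sub>F j in sequentially. dist (X j) (x k) < e k \<and> dist (U j) u < e k \<and> dist (f j) (g k) < e k"
      by eventually_elim simp
    then obtain j where j: "dist (X j) (x k) < e k" "dist (U j) u < e k" "dist (f j) (g k) < e k"
      by (auto simp: eventually_sequentially)
    have "norm (U j) \<le> D k + 2 * e k"
      using j(2) u(2) norm_triangle_ineq2[of "U j" u] by (simp add: dist_norm)
    then show ?thesis using X(4,5) j
      by (intro exI[of _ "(U j, X j, f j)"]) (simp add: dist_norm)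
  qed
  then have "\<forall>k. \<exists>q. fst q \<in> frechet_subdifferential F (fst (snd q)) \<and> norm (fst q) \<le> D k + 2 * e k \<and>
      norm (fst (snd q) - x k) \<le> e k \<and> norm (snd (snd q) - g k) \<le> e k \<and> F (fst (snd q)) = ereal (snd (snd q))" ..
  from choice[OF this] obtain q where q: "\<forall>k. fst (q k) \<in> frechet_subdifferential F (fst (snd (q k))) \<and>
      norm (fst (q k)) \<le> D k + 2 * e k \<and> norm (fst (snd (q k)) - x k) \<le> e k \<and>
      norm (snd (snd (q k)) - g k) \<le> e k \<and> F (fst (snd (q k))) = ereal (snd (snd (q k)))" ..
  define U Y h where "U k = fst (q k)" and "Y k = fst (snd (q k))" and "h k = snd (snd (q k))" for k
  have near: "U k \<in> frechet_subdifferential F (Y k)" "norm (U k) \<le> D k + 2 * e k"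
    "norm (Y k - x k) \<le> e k" "norm (h k - g k) \<le> e k" "F (Y k) = ereal (h k)" for k
    using spec[OF q, of k] unfolding U_def Y_def h_def by blast+
  have "(\<lambda>k. D k + 2 * e k) \<longlonglongrightarrow> 0 + 2 * 0" by (intro tendsto_intros D e0)
  then have "(\<lambda>k. D k + 2 * e k) \<longlonglongrightarrow> 0" by simp
  then have u: "U \<longlonglongrightarrow> 0" by (rule Lim_null_comparison[OF always_eventually[OF allI[OF near(2)]]])
  have "(\<lambda>k. Y k - x k) \<longlonglongrightarrow> 0"
    by (rule Lim_null_comparison[OF always_eventually[OF allI[OF near(3)]] e0])
  from tendsto_add[OF this x] have y: "Y \<longlonglongrightarrow> xs" by simp
  have "(\<lambda>k. h k - g k) \<longlonglongrightarrow> 0"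
    by (rule Lim_null_comparison[OF always_eventually[OF allI[OF near(4)]] e0])
  then have "(\<lambda>k. ereal (h k - g k)) \<longlonglongrightarrow> ereal 0" by simp
  from tendsto_add_ereal_general2[OF _ this g(2)]
  have "(\<lambda>k. F (Y k)) \<longlonglongrightarrow> F xs" unfolding near(5) by (simp flip: zero_ereal_def)
  then show ?thesis unfolding critical_point_def limiting_subdifferential_def
    using y u near(1) by blast
qed

theorem theorem1:
  fixes F :: "real ^ 'n \<Rightarrow> ereal"
    and x :: "nat \<Rightarrow> real ^ 'n"
    and \<omega> :: "nat \<Rightarrow> 'b::euclidean_space"
    and \<eta> :: "nat \<Rightarrow> real"
    and a b c d :: real
    and \<tau> :: nat
  assumes "proper F"
    and "lower_semicontinuous F"
    and "semialgebraic_function F"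
    and "coercive F"
    and "\<And>k. \<eta> k \<ge> 0"
    and "a > 0" and "b > 0" and "c > 0" and "d > 0"
    and i: "\<And>k. F (x k) - F (x (Suc k)) \<ge> ereal (a * (norm (\<omega> (Suc k) - \<omega> k))\<^sup>2 - b * (\<eta> k)\<^sup>2)"
    and ii: "\<And>k. k \<ge> \<tau> \<Longrightarrow>
        dist0 (limiting_subdifferential F (x (Suc k)))
          \<le> ereal (c * (\<Sum>j = k - \<tau>..k. norm (\<omega> (Suc j) - \<omega> j)) + d * \<eta> k)"
    and iii: "\<And>xhat r. stationary_point x xhat \<Longrightarrow> strict_mono r \<Longrightarrow>
        (\<lambda>j. x (r j)) \<longlonglongrightarrow> xhat \<Longrightarrow> (\<lambda>j. F (x (r j))) \<longlonglongrightarrow> F xhat"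
    and iv: "summable (\<lambda>k. norm (\<omega> k - \<omega> (Suc k))) \<Longrightarrow> summable (\<lambda>k. norm (x k - x (Suc k)))"
    and v: "\<exists>\<alpha>>1. \<eta> \<in> O(\<lambda>k. 1 / real k powr \<alpha>)"
  shows "summable (\<lambda>k. norm (x (Suc k) - x k)) \<and>
         (\<exists>xstar. x \<longlonglongrightarrow> xstar \<and> critical_point F xstar)"
proof -
  define \<delta> where "\<delta> k = norm (\<omega> (Suc k) - \<omega> k)" for k
  define D where "D k = c * (\<Sum>j = k - \<tau>..k. \<delta> j) + d * \<eta> k" for k
  have dist: "dist0 (limiting_subdifferential F (x (Suc k))) \<le> ereal (D k)" if "\<tau> \<le> k" for k
    using ii[OF that] unfolding D_def \<delta>_def .
  define f where "f k = real_of_ereal (F (x k))" for k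
  have fin: "F (x k) = ereal (f k)" if k: "Suc \<tau> \<le> k" for k
  proof -
    obtain k' where k': "k = Suc k'" "\<tau> \<le> k'" using k by (cases k) auto
    then have "dist0 (limiting_subdifferential F (x k)) < \<infinity>" 
      using le_less_trans[OF dist[OF k'(2)], of "\<infinity>"] k'(1) by simp
    then obtain u where "u \<in> limiting_subdifferential F (x k)" unfolding dist0_def INF_less_iff by blast
    then have "F (x k) < \<infinity>" using no_subgradient_at_infinite_value assms(1,3) by blast
    then show ?thesis using \<open>proper F\<close> unfolding f_def proper_def by (cases "F (x k)") auto
  qed
  have descent: "a * (\<delta> k)\<^sup>2 - b * (\<eta> k)\<^sup>2 \<le> f k - f (Suc k)" if "Suc \<tau> \<le> k" for k
    using i[of k] fin[of k] fin[of "Suc k"] that unfolding \<delta>_def by simp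
  obtain \<alpha> where \<alpha>: "\<alpha> > 1" "\<eta> \<in> O(\<lambda>k. 1 / real k powr \<alpha>)" using v by blast
  obtain C where C: "C > 0" "\<forall>\<^sub>F k in sequentially. norm (\<eta> k) \<le> C * norm (1 / real k powr \<alpha>)"
    using \<alpha>(2) by (rule landau_o.bigE)
  then obtain N0 where N0: "\<And>k. N0 \<le> k \<Longrightarrow> \<eta> k \<le> C * real k powr (- \<alpha>)"
    using assms(5) by (auto simp: eventually_sequentially powr_minus_divide)
  define \<beta> where "\<beta> = 2 * \<alpha> - 1"
  have \<beta>: "\<beta> > 1" using \<alpha> unfolding \<beta>_def by simp
  define K where "K = b * C\<^sup>2 / (\<beta> * 2 powr (- (2 * \<alpha>)))"
  have K: "K > 0" using \<open>b > 0\<close> C \<beta> unfolding K_def by simp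
  \<comment> \<open>An explicit majorant of the tails of \<open>b * (\<eta> k)\<^sup>2\<close>; its powers are again of the form \<open>k powr s\<close>.\<close>
  define E where "E k = K * real k powr (- \<beta>)" for k
  have E0: "0 \<le> E k" for k unfolding E_def using K by simp
  have Edec: "b * (\<eta> k)\<^sup>2 \<le> E k - E (Suc k)" if k: "N0 \<le> k" "1 \<le> k" for k
  proof -
    have "(\<eta> k)\<^sup>2 \<le> (C * real k powr (- \<alpha>))\<^sup>2" using N0[OF k(1)] assms(5) by (intro power_mono) auto
    also have "\<dots> = C\<^sup>2 * real k powr (- (2 * \<alpha>))"
      using k by (simp add: power_mult_distrib powr_power mult.commute)
    finally have "b * (\<eta> k)\<^sup>2 \<le> b * (C\<^sup>2 * real k powr (- (2 * \<alpha>)))" using \<open>b > 0\<close> by simp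
    also have "\<dots> = K * (\<beta> * 2 powr (- (2 * \<alpha>)) * real k powr (- (2 * \<alpha>)))"
      unfolding K_def using \<beta> by simp
    also have "\<dots> \<le> K * (real k powr (- \<beta>) - real (Suc k) powr (- \<beta>))"
      using powr_decrement[OF \<alpha>(1) k(2)] K unfolding \<beta>_def by (intro mult_left_mono) auto
    finally show ?thesis unfolding E_def by (simp add: right_diff_distrib)
  qed
  have "(\<lambda>k. K * real k powr (- \<beta>)) \<longlonglongrightarrow> K * 0"
    using \<beta> by (intro tendsto_intros tendsto_neg_powr filterlim_real_sequentially) auto
  then have Elim: "E \<longlonglongrightarrow> 0" unfolding E_def by simp
  have "summable (\<lambda>k. C * real k powr (- \<alpha>))" using \<alpha> by (intro summable_mult) (simp add: summable_real_powr_iff)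
  then have sum\<eta>: "summable \<eta>"
  proof (rule summable_comparison_test')
    show "norm (\<eta> k) \<le> C * real k powr (- \<alpha>)" if "N0 \<le> k" for k
      using N0[OF that] assms(5)[of k] by simp
  qed
  \<comment> \<open>Monotonicity alone would allow the limit minus infinity; coercivity gives a cluster point, and (iii) a finite limit.\<close>
  define N where "N = max (Suc \<tau>) (max N0 1)"
  have hdec: "a * (\<delta> k)\<^sup>2 \<le> (f k + E k) - (f (Suc k) + E (Suc k))" if "N \<le> k" for k
    using descent[of k] Edec[of k] that unfolding N_def by simp
  have "f (Suc (N + i)) + E (Suc (N + i)) \<le> f (N + i) + E (N + i)" for i
  proof -
    have "0 \<le> a * (\<delta> (N + i))\<^sup>2" using \<open>a > 0\<close> by simp
    then show ?thesis using hdec[of "N + i"] by linarith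
  qed
  then have hanti: "decseq (\<lambda>i. f (N + i) + E (N + i))" by (intro decseq_SucI) simp
  define B where "B = f N + E N"
  have fB: "f k \<le> B" if "N \<le> k" for k
    using decseqD[OF hanti, of 0 "k - N"] that E0[of k] unfolding B_def by simp
  have "\<forall>\<^sub>F y in at_infinity. ereal B < F y"
    using \<open>coercive F\<close> unfolding coercive_def by (intro order_tendstoD) auto
  then obtain R where R: "\<And>y. R \<le> norm y \<Longrightarrow> ereal B < F y" unfolding eventually_at_infinity by blast
  have xR: "norm (x k) \<le> R" if "N \<le> k" for k
  proof (rule ccontr)
    assume "\<not> ?thesis"
    then have "ereal B < F (x k)" using R by simp
    then show False using fin[of k] fB[of k] that unfolding N_def by simp
  qed
  have "bounded (range (\<lambda>i. x (N + i)))" using xR by (intro boundedI[of _ R]) auto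
  then obtain xh r0 where r0: "strict_mono r0" "((\<lambda>i. x (N + i)) \<circ> r0) \<longlonglongrightarrow> xh"
    using bounded_imp_convergent_subsequence by blast
  define r where "r j = N + r0 j" for j
  have r: "strict_mono r" "(\<lambda>j. x (r j)) \<longlonglongrightarrow> xh"
    using r0 unfolding r_def by (auto simp: strict_mono_def o_def)
  then have "stationary_point x xh" unfolding stationary_point_def o_def by blast
  then have Fr: "(\<lambda>j. F (x (r j))) \<longlonglongrightarrow> F xh" using iii r by blast
  have "F (x (r j)) \<le> ereal B" for j using fin[of "r j"] fB[of "r j"] unfolding r_def N_def by simp
  then have "F xh \<le> ereal B" using Fr by (intro LIMSEQ_le_const2) auto
  then obtain L where L: "F xh = ereal L" using \<open>proper F\<close> unfolding proper_def by (cases "F xh") auto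
  have "(\<lambda>j. ereal (f (r j))) \<longlonglongrightarrow> ereal L"
    using Fr fin unfolding L r_def N_def by simp
  then have "(\<lambda>j. f (r j)) \<longlonglongrightarrow> L" by simp
  moreover have "(\<lambda>j. E (r j)) \<longlonglongrightarrow> 0" using LIMSEQ_subseq_LIMSEQ[OF Elim r(1)] by (simp add: o_def)
  ultimately have hr: "(\<lambda>j. f (N + r0 j) + E (N + r0 j)) \<longlonglongrightarrow> L" unfolding r_def using tendsto_add by fastforce
  have "L \<le> f (N + i) + E (N + i)" for i
  proof -
    have "decseq (\<lambda>j. f (N + r0 j) + E (N + r0 j))"
      using hanti r0(1) unfolding decseq_def by (simp add: strict_mono_less_eq)
    then have "L \<le> f (N + r0 i) + E (N + r0 i)" using hr by (rule decseq_ge)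
    also have "\<dots> \<le> f (N + i) + E (N + i)" using decseqD[OF hanti seq_suble[OF r0(1)]] .
    finally show ?thesis .
  qed
  then obtain L' where L': "(\<lambda>i. f (N + i) + E (N + i)) \<longlonglongrightarrow> L'" using decseq_convergent[OF hanti] by blast
  from LIMSEQ_subseq_LIMSEQ[OF this r0(1)]
  have "(\<lambda>j. f (N + r0 j) + E (N + r0 j)) \<longlonglongrightarrow> L'" by (simp add: o_def)
  then have "L' = L" using hr by (rule LIMSEQ_unique)
  with L' have "(\<lambda>i. f (i + N) + E (i + N)) \<longlonglongrightarrow> L" by (simp add: add.commute)
  then have hlim: "(\<lambda>k. f k + E k) \<longlonglongrightarrow> L" by (rule LIMSEQ_offset)
  from tendsto_diff[OF this Elim] have flim: "f \<longlonglongrightarrow> L" by simp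
  obtain \<theta>0 \<epsilon> where KL: "0 < \<theta>0" "\<theta>0 < 1" "0 < \<epsilon>"
    "\<And>y u s \<theta>. norm y \<le> R \<Longrightarrow> u \<in> limiting_subdifferential F y \<Longrightarrow> F y = ereal s \<Longrightarrow> \<bar>s - L\<bar> < \<epsilon> \<Longrightarrow>
       \<theta>0 \<le> \<theta> \<Longrightarrow> \<bar>s - L\<bar> powr \<theta> \<le> norm u"
    using lojasiewicz_inequality[OF assms(3,1), of R L] by blast
  \<comment> \<open>Since \<open>\<beta> > 1\<close>, an exponent below \<open>1\<close> can satisfy \<open>\<beta> * \<theta> > 1\<close>, which makes \<open>E k powr \<theta>\<close> summable.\<close>
  define \<theta> where "\<theta> = max \<theta>0 ((1 + 1 / \<beta>) / 2)"
  have \<theta>: "0 < \<theta>" "\<theta> < 1" "\<theta>0 \<le> \<theta>" using KL(1,2) \<beta> unfolding \<theta>_def by auto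
  have "1 < \<beta> * ((1 + 1 / \<beta>) / 2)" using \<beta> by (simp add: field_simps)
  also have "\<dots> \<le> \<beta> * \<theta>" using \<beta> unfolding \<theta>_def by (intro mult_left_mono) auto
  finally have \<beta>\<theta>: "1 < \<beta> * \<theta>" .
  have "summable (\<lambda>k. K powr \<theta> * real k powr (- (\<beta> * \<theta>)))"
    using \<beta>\<theta> by (intro summable_mult) (simp add: summable_real_powr_iff)
  then have sumE: "summable (\<lambda>k. E k powr \<theta>)" unfolding E_def using K by (simp add: powr_mult powr_powr)
  have "(\<lambda>k. \<bar>f k - L\<bar>) \<longlonglongrightarrow> \<bar>L - L\<bar>" by (intro tendsto_intros flim)
  then have "\<forall>\<^sub>F k in sequentially. \<bar>f k - L\<bar> < \<epsilon>" using KL(3) by (intro order_tendstoD) auto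
  then obtain N1 where N1: "\<And>k. N1 \<le> k \<Longrightarrow> \<bar>f k - L\<bar> < \<epsilon>" unfolding eventually_sequentially by blast
  have loj: "\<bar>f (Suc k) - L\<bar> powr \<theta> \<le> D k" if k: "max N N1 \<le> k" for k
  proof -
    have "ereal (\<bar>f (Suc k) - L\<bar> powr \<theta>) \<le> dist0 (limiting_subdifferential F (x (Suc k)))"
      unfolding dist0_def
    proof (rule INF_greatest)
      fix u assume "u \<in> limiting_subdifferential F (x (Suc k))"
      then show "ereal (\<bar>f (Suc k) - L\<bar> powr \<theta>) \<le> ereal (norm u)"
        using KL(4)[OF xR[of "Suc k"] _ fin[of "Suc k"] N1[of "Suc k"] \<theta>(3)] k unfolding N_def by simp
    qed
    also have "\<dots> \<le> ereal (D k)" using k by (intro dist) (simp add: N_def)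
    finally show ?thesis by simp
  qed
  have \<delta>0: "0 \<le> \<delta> k" for k unfolding \<delta>_def by simp
  have sum\<delta>: "summable \<delta>"
  proof (rule summable_steps_of_lojasiewicz[where f = f and E = E and L = L and a = a and \<theta> = \<theta> and c = c and d = d
        and \<eta> = \<eta> and \<tau> = \<tau> and N = "max N N1"])
    show "\<bar>f (Suc k) - L\<bar> powr \<theta> \<le> c * (\<Sum>j = k - \<tau>..k. \<delta> j) + d * \<eta> k" if "max N N1 \<le> k" for k
      using loj[OF that] unfolding D_def .
    show "\<tau> \<le> max N N1" unfolding N_def by simp
  qed (use assms \<theta> \<delta>0 E0 hdec hlim sum\<eta> sumE in auto)
  then have "summable (\<lambda>k. norm (\<omega> k - \<omega> (Suc k)))" unfolding \<delta>_def by (simp add: norm_minus_commute)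
  then have len: "summable (\<lambda>k. norm (x (Suc k) - x k))" using iv by (simp add: norm_minus_commute)
  have "summable (\<lambda>k. x (Suc k) - x k)" using len by (rule summable_norm_cancel)
  from tendsto_add[OF summable_LIMSEQ[OF this] tendsto_const[of "x 0"]]
  obtain xs where xs: "x \<longlonglongrightarrow> xs" by (auto simp: sum_lessThan_telescope)
  have "stationary_point x xs" unfolding stationary_point_def using xs by (intro exI[of _ id]) (simp add: strict_mono_id)
  then have Fxs: "(\<lambda>k. F (x k)) \<longlonglongrightarrow> F xs" using iii[of xs id] xs by (simp add: strict_mono_id)
  have Dlim: "D \<longlonglongrightarrow> 0"
  proof -
    have \<delta>lim: "\<delta> \<longlonglongrightarrow> 0" using sum\<delta> by (rule summable_LIMSEQ_zero)
    have "(\<lambda>k. c * (\<Sum>l\<le>\<tau>. \<delta> (k + \<tau> - l)) + d * \<eta> (k + \<tau>)) \<longlonglongrightarrow> c * (\<Sum>l\<le>\<tau>. 0) + d * 0"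
    proof (intro tendsto_intros)
      fix l assume "l \<in> {..\<tau>}"
      then have "(\<lambda>k. \<delta> (k + \<tau> - l)) = (\<lambda>k. \<delta> (k + (\<tau> - l)))" by auto
      then show "(\<lambda>k. \<delta> (k + \<tau> - l)) \<longlonglongrightarrow> 0" using LIMSEQ_ignore_initial_segment[OF \<delta>lim] by simp
    next
      show "(\<lambda>k. \<eta> (k + \<tau>)) \<longlonglongrightarrow> 0"
        using summable_LIMSEQ_zero[OF sum\<eta>] by (rule LIMSEQ_ignore_initial_segment)
    qed
    moreover have "(\<Sum>j = k + \<tau> - \<tau>..k + \<tau>. \<delta> j) = (\<Sum>l\<le>\<tau>. \<delta> (k + \<tau> - l))" for k
      by (intro sum.reindex_bij_witness[of _ "\<lambda>l. k + \<tau> - l" "\<lambda>j. k + \<tau> - j"]) auto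
    ultimately have "(\<lambda>k. D (k + \<tau>)) \<longlonglongrightarrow> 0" unfolding D_def by simp
    then show ?thesis by (rule LIMSEQ_offset)
  qed
  have "critical_point F xs"
  proof (rule critical_point_of_vanishing_subgradients[OF \<open>proper F\<close>])
    show "(\<lambda>k. x (Suc (\<tau> + k))) \<longlonglongrightarrow> xs" 
      using LIMSEQ_ignore_initial_segment[OF xs, of "Suc \<tau>"] by (simp add: add.commute)
    show "F (x (Suc (\<tau> + k))) = ereal (f (Suc (\<tau> + k)))" for k by (rule fin) simp
    then show "(\<lambda>k. ereal (f (Suc (\<tau> + k)))) \<longlonglongrightarrow> F xs"
      using LIMSEQ_ignore_initial_segment[OF Fxs, of "Suc \<tau>"] by (simp add: add.commute)
    show "dist0 (limiting_subdifferential F (x (Suc (\<tau> + k)))) \<le> ereal (D (\<tau> + k))" for k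
      by (rule dist) simp
    show "(\<lambda>k. D (\<tau> + k)) \<longlonglongrightarrow> 0"
      using LIMSEQ_ignore_initial_segment[OF Dlim, of \<tau>] by (simp add: add.commute)
  qed
  with len xs show ?thesis by blast
qed

end
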